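(* Let $E$ be a locally finite directed graph with no sources, $A=C^*(E)$, $F=C^*(E)^\gamma$, and let $X$ and $\mathcal{D}$ be the right $C^*$-$F$-module and the self-adjoint regular operator on it described in the context. Let $V=\mathcal{D}(1+\mathcal{D}^2)^{-1/2}$. Then $(X,V)$ defines a class in $KK^1(A,F)$.
   Context: A directed graph $E=(E^0,E^1,r,s)$ has countable sets $E^0$ (vertices), $E^1$ (edges) and range and source maps $r,s:E^1\to E^0$. It is locally finite if each vertex emits and receives finitely many edges; it has no sources if each vertex receives at least one edge. A path of length $|\mu|=n\ge1$ is $\mu=\mu_1\cdots\mu_n$ with $r(\mu_i)=s(\mu_{i+1})$; vertices are paths of length $0$; $E^*$ is the set of all finite paths and $r,s$ extend to $E^*$. $C^*(E)$ is the universal $C^*$-algebra generated by mutually orthogonal projections $p_v$ ($v\in E^0$) and partial isometries $S_e$ ($e\in E^1$) with $S_e^*S_e=p_{r(e)}$ and $p_v=\sum_{s(e)=v}S_eS_e^*$ whenever $v$ emits at least one edge. $S_\mu=S_{\mu_1}\cdots S_{\mu_n}$, $S_v=p_v$. The gauge action $\gamma$ of $S^1$ on $A=C^*(E)$ is $\gamma_z(S_e)=zS_e$, $\gamma_z(p_v)=p_v$; $F=A^\gamma$ is the fixed point algebra; $\Phi(a)=\frac1{2\pi}\int_{S^1}\gamma_z(a)\,d\theta$ ($z=e^{i\theta}$) is the faithful expectation $A\to F$. $X$ is the right $C^*$-$F$-module obtained by completing $A$ for the $F$-valued inner product $(x|y)_R=\Phi(x^*y)$, with right multiplication by $F$. $A$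 acts on $X$ by (the extension of) left multiplication. $\gamma$ extends to $X$ and $\Phi_k(x)=\frac1{2\pi}\int_{S^1}z^{-k}\gamma_z(x)\,d\theta$ are the spectral projections; write $x_k=\Phi_kx$. $\mathcal{D}$ is the self-adjoint regular operator with domain $X_\mathcal{D}=\{x\in X:\sum_{k\in\mathbb{Z}}k^2(x_k|x_k)_R\text{ converges in norm}\}$ and $\mathcal{D}x=\sum_kkx_k$. A pair $(X,V)$ (with $A$ acting on the countably generated ungraded right $C^*$-$F$-module $X$ and $V$ an adjointable endomorphism) defines a class in $KK^1(A,F)$ when $a(V-V^* )$, $a(1-V^2)$ and $[V,a]$ are compact endomorphisms of $X$ for all $a\in A$. *)

theory Defs
  imports
    "HOL-Analysis.Analysis"
    "HOL-Algebra.Module"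
    "HOL-Algebra.Algebraic_Closure_Type"
    "Graph_Theory.Digraph"
begin

section \<open>C*-algebras\<close>

class complex_banach = banach +
  fixes scaleC :: "complex \<Rightarrow> 'a \<Rightarrow> 'a" (infixr \<open>*\<^sub>C\<close> 75)
  assumes scaleC_add_right: "c *\<^sub>C (x + y) = c *\<^sub>C x + c *\<^sub>C y"
    and scaleC_add_left: "(c + d) *\<^sub>C x = c *\<^sub>C x + d *\<^sub>C x"
    and scaleC_scaleC: "c *\<^sub>C (d *\<^sub>C x) = (c * d) *\<^sub>C x"
    and scaleR_scaleC: "r *\<^sub>R x = complex_of_real r *\<^sub>C x"
    and norm_scaleC: "norm (c *\<^sub>C x) = cmod c * norm x"

class cstar_algebra = complex_banach + real_normed_algebra +
  fixes star :: "'a \<Rightarrow> 'a"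
  assumes scaleC_mult_left: "(c *\<^sub>C x) * y = c *\<^sub>C (x * y)"
    and scaleC_mult_right: "x * (c *\<^sub>C y) = c *\<^sub>C (x * y)"
    and star_star: "star (star x) = x"
    and star_add: "star (x + y) = star x + star y"
    and star_scaleC: "star (c *\<^sub>C x) = cnj c *\<^sub>C star x"
    and star_mult: "star (x * y) = star y * star x"
    and norm_star_mult: "norm (star x * x) = (norm x)\<^sup>2"

text \<open>
  The universal property of \<open>C\<^sup>*(E)\<close> quantifies over C*-algebras inside a formula, which
  type classes do not allow. The target algebras are therefore explicit structures on a carrier,
  based on the module records of HOL-Algebra. C*-algebras need not be unital: the record field
  \<^term>\<open>one\<close> is never used.
\<close>

record 'b cstar = "(complex, 'b) module" +
  adj :: "'b \<Rightarrow> 'b"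
  nrm :: "'b \<Rightarrow> real"

definition cstar_structure :: "'b cstar \<Rightarrow> bool" where
  "cstar_structure B \<longleftrightarrow>
     Module.module (ring_of_type_algebra :: complex ring) B \<and>
     (\<forall>x\<in>carrier B. \<forall>y\<in>carrier B. x \<otimes>\<^bsub>B\<^esub> y \<in> carrier B) \<and>
     (\<forall>x\<in>carrier B. \<forall>y\<in>carrier B. \<forall>z\<in>carrier B.
        (x \<otimes>\<^bsub>B\<^esub> y) \<otimes>\<^bsub>B\<^esub> z = x \<otimes>\<^bsub>B\<^esub> (y \<otimes>\<^bsub>B\<^esub> z) \<and>
        (x \<oplus>\<^bsub>B\<^esub> y) \<otimes>\<^bsub>B\<^esub> z = (x \<otimes>\<^bsub>B\<^esub> z) \<oplus>\<^bsub>B\<^esub> (y \<otimes>\<^bsub>B\<^esub> z) \<and>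
        z \<otimes>\<^bsub>B\<^esub> (x \<oplus>\<^bsub>B\<^esub> y) = (z \<otimes>\<^bsub>B\<^esub> x) \<oplus>\<^bsub>B\<^esub> (z \<otimes>\<^bsub>B\<^esub> y)) \<and>
     (\<forall>c. \<forall>x\<in>carrier B. \<forall>y\<in>carrier B.
        (c \<odot>\<^bsub>B\<^esub> x) \<otimes>\<^bsub>B\<^esub> y = c \<odot>\<^bsub>B\<^esub> (x \<otimes>\<^bsub>B\<^esub> y) \<and>
        x \<otimes>\<^bsub>B\<^esub> (c \<odot>\<^bsub>B\<^esub> y) = c \<odot>\<^bsub>B\<^esub> (x \<otimes>\<^bsub>B\<^esub> y)) \<and>
     (\<forall>x\<in>carrier B. adj B x \<in> carrier B \<and> adj B (adj B x) = x \<and>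
        (\<forall>c. adj B (c \<odot>\<^bsub>B\<^esub> x) = cnj c \<odot>\<^bsub>B\<^esub> adj B x)) \<and>
     (\<forall>x\<in>carrier B. \<forall>y\<in>carrier B.
        adj B (x \<oplus>\<^bsub>B\<^esub> y) = adj B x \<oplus>\<^bsub>B\<^esub> adj B y \<and>
        adj B (x \<otimes>\<^bsub>B\<^esub> y) = adj B y \<otimes>\<^bsub>B\<^esub> adj B x) \<and>
     (\<forall>x\<in>carrier B. 0 \<le> nrm B x \<and> (nrm B x = 0 \<longleftrightarrow> x = \<zero>\<^bsub>B\<^esub>) \<and>
        (\<forall>c. nrm B (c \<odot>\<^bsub>B\<^esub> x) = cmod c * nrm B x) \<and>
        nrm B (adj B x \<otimes>\<^bsub>B\<^esub> x) = (nrm B x)\<^sup>2) \<and>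
     (\<forall>x\<in>carrier B. \<forall>y\<in>carrier B.
        nrm B (x \<oplus>\<^bsub>B\<^esub> y) \<le> nrm B x + nrm B y \<and>
        nrm B (x \<otimes>\<^bsub>B\<^esub> y) \<le> nrm B x * nrm B y) \<and>
     (\<forall>f :: nat \<Rightarrow> 'b. range f \<subseteq> carrier B \<and>
        (\<forall>\<epsilon>>0. \<exists>N. \<forall>m\<ge>N. \<forall>n\<ge>N. nrm B (f m \<ominus>\<^bsub>B\<^esub> f n) < \<epsilon>) \<longrightarrow>
        (\<exists>l\<in>carrier B. (\<lambda>n. nrm B (f n \<ominus>\<^bsub>B\<^esub> l)) \<longlonglongrightarrow> 0))"

definition cstar_of_type :: "'a::cstar_algebra cstar" where
  "cstar_of_type = \<lparr>carrier = UNIV, mult = (*), one = undefined, zero = 0, add = (+),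
     smult = scaleC, adj = star, nrm = norm\<rparr>"

lemma cstar_structure_of_type: "cstar_structure (cstar_of_type :: 'a::cstar_algebra cstar)"
proof -
  let ?B = "cstar_of_type :: 'a cstar"
  have ag: "abelian_group ?B"
    by (rule abelian_groupI) (auto simp: cstar_of_type_def algebra_simps intro: exI[of _ "- x" for x])
  have zero: "c *\<^sub>C (0::'a) = 0" for c by (metis add_cancel_right_left scaleC_add_right)
  have m: "Module.module (ring_of_type_algebra :: complex ring) ?B"
    by (rule Module.moduleI[OF cring_from_type_algebra ag])
       (auto simp: cstar_of_type_def ring_of_type_algebra_def scaleC_add_left scaleC_add_right scaleC_scaleC
         simp flip: scaleR_scaleC[of 1, simplified])
  interpret M: abelian_group ?B by (fact ag)
  have inv: "\<ominus>\<^bsub>?B\<^esub> x = - x" for x :: 'a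
    by (rule M.minus_equality) (auto simp: cstar_of_type_def)
  have minus: "x \<ominus>\<^bsub>?B\<^esub> y = x - y" for x y :: 'a
    unfolding a_minus_def inv by (simp add: cstar_of_type_def)
  show ?thesis unfolding cstar_structure_def minus
    using m
    apply (simp add: cstar_of_type_def algebra_simps scaleC_mult_left scaleC_mult_right star_star star_add star_scaleC star_mult norm_star_mult norm_scaleC norm_mult_ineq norm_triangle_ineq)
    apply (metis CauchyI Cauchy_convergent LIMSEQ_iff convergent_def tendsto_norm_zero_iff LIM_zero_iff)
    done
qed

definition star_hom :: "'a cstar \<Rightarrow> 'b cstar \<Rightarrow> ('a \<Rightarrow> 'b) \<Rightarrow> bool" where
  "star_hom B C \<phi> \<longleftrightarrow>
     (\<forall>x\<in>carrier B. \<phi> x \<in> carrier C \<and> \<phi> (adj B x) = adj C (\<phi> x) \<and>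
        (\<forall>c. \<phi> (c \<odot>\<^bsub>B\<^esub> x) = c \<odot>\<^bsub>C\<^esub> \<phi> x)) \<and>
     (\<forall>x\<in>carrier B. \<forall>y\<in>carrier B.
        \<phi> (x \<oplus>\<^bsub>B\<^esub> y) = \<phi> x \<oplus>\<^bsub>C\<^esub> \<phi> y \<and> \<phi> (x \<otimes>\<^bsub>B\<^esub> y) = \<phi> x \<otimes>\<^bsub>C\<^esub> \<phi> y)"

definition closed_star_subalgebra :: "'a::cstar_algebra set \<Rightarrow> bool" where
  "closed_star_subalgebra C \<longleftrightarrow> closed C \<and> 0 \<in> C \<and>
     (\<forall>x\<in>C. \<forall>y\<in>C. x + y \<in> C \<and> x * y \<in> C) \<and> (\<forall>x\<in>C. star x \<in> C \<and> (\<forall>c. c *\<^sub>C x \<in> C))"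


section \<open>Graph algebras and the gauge action\<close>

text \<open>
  Source and range of an edge \<open>e\<close> are \<^term>\<open>tail G e\<close> and \<^term>\<open>head G e\<close>; a vertex \<open>v\<close> emits the
  edges in \<^term>\<open>out_arcs G v\<close> and receives those in \<^term>\<open>in_arcs G v\<close>.
\<close>

definition locally_finite_digraph :: "('v, 'e) pre_digraph \<Rightarrow> bool" where
  "locally_finite_digraph G \<longleftrightarrow> (\<forall>v\<in>verts G. finite (out_arcs G v) \<and> finite (in_arcs G v))"

definition no_sources :: "('v, 'e) pre_digraph \<Rightarrow> bool" where
  "no_sources G \<longleftrightarrow> (\<forall>v\<in>verts G. in_arcs G v \<noteq> {})"

text \<open>The sums below are finite because this is only used for locally finite \<open>G\<close>.\<close>

definition CK_family :: "('v, 'e) pre_digraph \<Rightarrow> 'b cstar \<Rightarrow> ('v \<Rightarrow> 'b) \<Rightarrow> ('e \<Rightarrow> 'b) \<Rightarrow> bool" where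
  "CK_family G B p S \<longleftrightarrow>
     (\<forall>v\<in>verts G. p v \<in> carrier B \<and> adj B (p v) = p v \<and> p v \<otimes>\<^bsub>B\<^esub> p v = p v) \<and>
     (\<forall>v\<in>verts G. \<forall>w\<in>verts G. v \<noteq> w \<longrightarrow> p v \<otimes>\<^bsub>B\<^esub> p w = \<zero>\<^bsub>B\<^esub>) \<and>
     (\<forall>e\<in>arcs G. S e \<in> carrier B \<and> S e \<otimes>\<^bsub>B\<^esub> adj B (S e) \<otimes>\<^bsub>B\<^esub> S e = S e \<and>
        adj B (S e) \<otimes>\<^bsub>B\<^esub> S e = p (head G e)) \<and>
     (\<forall>v\<in>verts G. out_arcs G v \<noteq> {} \<longrightarrow>
        p v = (\<Oplus>\<^bsub>B\<^esub>e\<in>out_arcs G v. S e \<otimes>\<^bsub>B\<^esub> adj B (S e)))"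

text \<open>
  \<open>p, S\<close> exhibit \<open>'a\<close> as \<open>C\<^sup>*(G)\<close>. For the universal property it suffices to consider targets
  whose carrier consists of elements of \<^typ>\<open>nat \<Rightarrow> real\<close>: a Cuntz-Krieger family of a countable
  graph generates a separable C*-algebra, hence one with at most continuum many elements, and
  every C*-algebra of that size has an isomorphic copy of this form.
\<close>

definition graph_algebra ::
  "('v, 'e) pre_digraph \<Rightarrow> ('v \<Rightarrow> 'a::cstar_algebra) \<Rightarrow> ('e \<Rightarrow> 'a) \<Rightarrow> bool" where
  "graph_algebra G p S \<longleftrightarrow>
     CK_family G (cstar_of_type :: 'a cstar) p S \<and>
     (\<forall>C. closed_star_subalgebra C \<and> p ` verts G \<subseteq> C \<and> S ` arcs G \<subseteq> C \<longrightarrow> C = UNIV) \<and>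
     (\<forall>(B :: (nat \<Rightarrow> real) cstar) q T. cstar_structure B \<and> CK_family G B q T \<longrightarrow>
        (\<exists>\<phi>. star_hom cstar_of_type B \<phi> \<and>
             (\<forall>v\<in>verts G. \<phi> (p v) = q v) \<and> (\<forall>e\<in>arcs G. \<phi> (S e) = T e)))"

text \<open>Only the values of \<open>\<gamma>\<close> at \<open>z\<close> on the unit circle matter here and below.\<close>

definition gauge_action ::
  "('v, 'e) pre_digraph \<Rightarrow> ('v \<Rightarrow> 'a::cstar_algebra) \<Rightarrow> ('e \<Rightarrow> 'a) \<Rightarrow> (complex \<Rightarrow> 'a \<Rightarrow> 'a) \<Rightarrow> bool"
where
  "gauge_action G p S \<gamma> \<longleftrightarrow> (\<forall>z\<in>sphere 0 1.
     star_hom (cstar_of_type :: 'a cstar) cstar_of_type (\<gamma> z) \<and>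
     (\<forall>v\<in>verts G. \<gamma> z (p v) = p v) \<and> (\<forall>e\<in>arcs G. \<gamma> z (S e) = z *\<^sub>C S e))"

definition fixed_point_algebra :: "(complex \<Rightarrow> 'a \<Rightarrow> 'a) \<Rightarrow> 'a set" where
  "fixed_point_algebra \<gamma> = {a. \<forall>z\<in>sphere 0 1. \<gamma> z a = a}"

definition expectation_of :: "(complex \<Rightarrow> 'a \<Rightarrow> 'a) \<Rightarrow> 'a::cstar_algebra \<Rightarrow> 'a" where
  "expectation_of \<gamma> a = (1 / (2 * pi)) *\<^sub>R integral {0..2 * pi} (\<lambda>\<theta>. \<gamma> (cis \<theta>) a)"


section \<open>Hilbert modules\<close>

text \<open>
  A right C*-\<open>F\<close>-module is a type \<open>'x\<close> with right multiplication \<open>act\<close> by the elements of a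
  C*-subalgebra \<open>F\<close> and an \<open>F\<close>-valued inner product \<open>ip\<close>, linear in the second variable.
  Completeness is part of the class \<^class>\<open>complex_banach\<close>.
\<close>

definition hilbert_module ::
  "'a::cstar_algebra set \<Rightarrow> ('x::complex_banach \<Rightarrow> 'a \<Rightarrow> 'x) \<Rightarrow> ('x \<Rightarrow> 'x \<Rightarrow> 'a) \<Rightarrow> bool" where
  "hilbert_module F act ip \<longleftrightarrow> closed_star_subalgebra F \<and>
     (\<forall>f\<in>F. \<forall>x y. act (x + y) f = act x f + act y f) \<and>
     (\<forall>f\<in>F. \<forall>g\<in>F. \<forall>x. act x (f + g) = act x f + act x g \<and> act x (f * g) = act (act x f) g) \<and>
     (\<forall>f\<in>F. \<forall>c x. act (c *\<^sub>C x) f = c *\<^sub>C act x f \<and> act x (c *\<^sub>C f) = c *\<^sub>C act x f) \<and>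
     (\<forall>x y. ip x y \<in> F \<and> star (ip x y) = ip y x) \<and>
     (\<forall>x y y'. ip x (y + y') = ip x y + ip x y') \<and>
     (\<forall>c x y. ip x (c *\<^sub>C y) = c *\<^sub>C ip x y) \<and>
     (\<forall>f\<in>F. \<forall>x y. ip x (act y f) = ip x y * f) \<and>
     (\<forall>x. \<exists>b\<in>F. ip x x = star b * b) \<and>
     (\<forall>x. ip x x = 0 \<longrightarrow> x = 0) \<and>
     (\<forall>x. norm x = sqrt (norm (ip x x)))"

definition countably_generated ::
  "'a set \<Rightarrow> ('x::complex_banach \<Rightarrow> 'a \<Rightarrow> 'x) \<Rightarrow> bool" where
  "countably_generated F act \<longleftrightarrow>
     (\<exists>Y. countable Y \<and> closure (span {act y f | y f. y \<in> Y \<and> f \<in> F}) = UNIV)"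

definition adjoint_pair :: "('x \<Rightarrow> 'x \<Rightarrow> 'a) \<Rightarrow> ('x \<Rightarrow> 'x) \<Rightarrow> ('x \<Rightarrow> 'x) \<Rightarrow> bool" where
  "adjoint_pair ip T T' \<longleftrightarrow> (\<forall>x y. ip (T x) y = ip x (T' y))"

definition adjointable :: "('x \<Rightarrow> 'x \<Rightarrow> 'a) \<Rightarrow> ('x \<Rightarrow> 'x) \<Rightarrow> bool" where
  "adjointable ip T \<longleftrightarrow> (\<exists>T'. adjoint_pair ip T T')"

definition adjoint_of :: "('x \<Rightarrow> 'x \<Rightarrow> 'a) \<Rightarrow> ('x \<Rightarrow> 'x) \<Rightarrow> 'x \<Rightarrow> 'x" where
  "adjoint_of ip T = (THE T'. adjoint_pair ip T T')"

text \<open>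
  Norm closure of the span of the rank one operators \<open>z \<mapsto> x (y|z)\<close>; the real span is a complex
  subspace since \<open>x\<close> may be multiplied by complex scalars.
\<close>

definition compact_endomorphism ::
  "('x::complex_banach \<Rightarrow> 'a \<Rightarrow> 'x) \<Rightarrow> ('x \<Rightarrow> 'x \<Rightarrow> 'a) \<Rightarrow> ('x \<Rightarrow> 'x) \<Rightarrow> bool" where
  "compact_endomorphism act ip T \<longleftrightarrow>
     (\<exists>K \<in> closure (span {\<Theta> :: 'x \<Rightarrow>\<^sub>L 'x. \<exists>x y. blinfun_apply \<Theta> = (\<lambda>z. act x (ip y z))}).
        T = blinfun_apply K)"

definition star_representation ::
  "('x::complex_banach \<Rightarrow> 'x \<Rightarrow> 'a) \<Rightarrow> ('a::cstar_algebra \<Rightarrow> 'x \<Rightarrow> 'x) \<Rightarrow> bool" where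
  "star_representation ip \<pi> \<longleftrightarrow>
     (\<forall>a. adjoint_pair ip (\<pi> a) (\<pi> (star a))) \<and>
     (\<forall>a b x. \<pi> (a + b) x = \<pi> a x + \<pi> b x \<and> \<pi> (a * b) x = \<pi> a (\<pi> b x)) \<and>
     (\<forall>c a x. \<pi> (c *\<^sub>C a) x = c *\<^sub>C \<pi> a x)"

definition defines_KK1_class ::
  "'a set \<Rightarrow> ('x::complex_banach \<Rightarrow> 'a::cstar_algebra \<Rightarrow> 'x) \<Rightarrow> ('x \<Rightarrow> 'x \<Rightarrow> 'a)
     \<Rightarrow> ('a \<Rightarrow> 'x \<Rightarrow> 'x) \<Rightarrow> ('x \<Rightarrow> 'x) \<Rightarrow> bool" where
  "defines_KK1_class F act ip \<pi> V \<longleftrightarrow>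
     hilbert_module F act ip \<and> countably_generated F act \<and> star_representation ip \<pi> \<and>
     adjointable ip V \<and>
     (\<forall>a. compact_endomorphism act ip (\<lambda>x. \<pi> a (V x - adjoint_of ip V x)) \<and>
          compact_endomorphism act ip (\<lambda>x. \<pi> a (x - V (V x))) \<and>
          compact_endomorphism act ip (\<lambda>x. V (\<pi> a x) - \<pi> a (V x)))"

text \<open>
  For an operator \<open>D\<close> with domain \<open>X0\<close>, \<open>(1 + D\<^sup>2)\<^sup>-\<^sup>1\<close> is the inverse of \<open>1 + D\<^sup>2\<close> on
  \<open>{x \<in> X0. D x \<in> X0}\<close>. The square root is the positive one in the C*-algebra of adjointable
  operators, whose positive elements are those of the form \<open>P\<^sup>* P\<close>.
\<close>

definition inv_one_plus_square :: "'x::complex_banach set \<Rightarrow> ('x \<Rightarrow> 'x) \<Rightarrow> 'x \<Rightarrow> 'x" where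
  "inv_one_plus_square X0 D y = (THE x. x \<in> X0 \<and> D x \<in> X0 \<and> x + D (D x) = y)"

definition positive_sqrt ::
  "('x \<Rightarrow> 'x \<Rightarrow> 'a) \<Rightarrow> ('x::complex_banach \<Rightarrow> 'x) \<Rightarrow> 'x \<Rightarrow> 'x" where
  "positive_sqrt ip T =
     (THE Q. (\<exists>P P'. adjoint_pair ip P P' \<and> Q = P' \<circ> P) \<and> Q \<circ> Q = T)"

definition bounded_transform ::
  "('x \<Rightarrow> 'x \<Rightarrow> 'a) \<Rightarrow> 'x::complex_banach set \<Rightarrow> ('x \<Rightarrow> 'x) \<Rightarrow> 'x \<Rightarrow> 'x" where
  "bounded_transform ip X0 D = D \<circ> positive_sqrt ip (inv_one_plus_square X0 D)"


section \<open>The module \<open>X\<close> and the operator \<open>\<D>\<close>\<close>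

text \<open>\<open>\<iota>\<close> is the canonical map from \<open>A\<close> to its completion \<open>X\<close>.\<close>

definition module_completion ::
  "(complex \<Rightarrow> 'a \<Rightarrow> 'a::cstar_algebra) \<Rightarrow> ('a \<Rightarrow> 'x) \<Rightarrow> ('x::complex_banach \<Rightarrow> 'a \<Rightarrow> 'x)
     \<Rightarrow> ('x \<Rightarrow> 'x \<Rightarrow> 'a) \<Rightarrow> bool" where
  "module_completion \<gamma> \<iota> act ip \<longleftrightarrow>
     hilbert_module (fixed_point_algebra \<gamma>) act ip \<and>
     (\<forall>a b. \<iota> (a + b) = \<iota> a + \<iota> b) \<and> (\<forall>c a. \<iota> (c *\<^sub>C a) = c *\<^sub>C \<iota> a) \<and>
     closure (range \<iota>) = UNIV \<and>
     (\<forall>a b. ip (\<iota> a) (\<iota> b) = expectation_of \<gamma> (star a * b)) \<and>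
     (\<forall>a. \<forall>f\<in>fixed_point_algebra \<gamma>. act (\<iota> a) f = \<iota> (a * f))"

definition extension :: "('a \<Rightarrow> 'x::topological_space) \<Rightarrow> ('a \<Rightarrow> 'a) \<Rightarrow> 'x \<Rightarrow> 'x" where
  "extension \<iota> h = (THE T. continuous_on UNIV T \<and> (\<forall>a. T (\<iota> a) = \<iota> (h a)))"

definition left_mult :: "('a::cstar_algebra \<Rightarrow> 'x) \<Rightarrow> 'a \<Rightarrow> 'x::complex_banach \<Rightarrow> 'x" where
  "left_mult \<iota> a = extension \<iota> (\<lambda>b. a * b)"

definition spectral_projection ::
  "(complex \<Rightarrow> 'a \<Rightarrow> 'a) \<Rightarrow> ('a \<Rightarrow> 'x::complex_banach) \<Rightarrow> int \<Rightarrow> 'x \<Rightarrow> 'x" where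
  "spectral_projection \<gamma> \<iota> k x = (1 / (2 * pi)) *\<^sub>R
     integral {0..2 * pi} (\<lambda>\<theta>. (cis \<theta> powi (- k)) *\<^sub>C extension \<iota> (\<gamma> (cis \<theta>)) x)"

definition number_operator_dom ::
  "(complex \<Rightarrow> 'a \<Rightarrow> 'a) \<Rightarrow> ('a \<Rightarrow> 'x) \<Rightarrow> ('x \<Rightarrow> 'x \<Rightarrow> 'a::cstar_algebra)
     \<Rightarrow> 'x::complex_banach set" where
  "number_operator_dom \<gamma> \<iota> ip = {x. (\<lambda>k. (real_of_int k)\<^sup>2 *\<^sub>R
     ip (spectral_projection \<gamma> \<iota> k x) (spectral_projection \<gamma> \<iota> k x)) summable_on UNIV}"

definition number_operator ::
  "(complex \<Rightarrow> 'a \<Rightarrow> 'a) \<Rightarrow> ('a \<Rightarrow> 'x) \<Rightarrow> 'x \<Rightarrow> 'x::complex_banach" where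
  "number_operator \<gamma> \<iota> x = (\<Sum>\<^sub>\<infinity>k. real_of_int k *\<^sub>R spectral_projection \<gamma> \<iota> k x)"

end

theory Submission
  imports Defs "HOL-Real_Asymp.Real_Asymp"
begin

text \<open>
  Grade \<open>A\<close> by giving \<open>p\<^sub>v\<close>, \<open>S\<^sub>e\<close> and \<open>S\<^sub>e\<^sup>*\<close> the degrees \<open>0\<close>, \<open>1\<close> and \<open>-1\<close>; \<open>\<D>\<close> multiplies elements
  of degree \<open>k\<close> by \<open>k\<close>, so \<open>V\<close> multiplies them by \<open>k / \<surd>(1 + k\<^sup>2)\<close>. On the range of the
  spectral projection \<open>P\<^sub>k\<close>, left multiplication by \<open>p\<^sub>v\<close> is compact: it has rank one for \<open>k = 0\<close>, and
  \<open>p\<^sub>v P\<^sub>k = S\<^sub>e\<^sup>* (p\<^sub>w P\<^bsub>k+1\<^esub>) S\<^sub>e\<close> for any edge \<open>e\<close> from \<open>w\<close> to \<open>v\<close>, while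
  \<open>p\<^sub>v P\<^sub>k = \<Sum> S\<^sub>e (p\<^bsub>r(e)\<^esub> P\<^bsub>k-1\<^esub>) S\<^sub>e\<^sup>*\<close> over the finitely many edges \<open>e\<close> out of \<open>v\<close>, or \<open>0\<close> if \<open>v\<close> is
  a sink and \<open>k > 0\<close>. Hence \<open>a f(\<D>)\<close> is compact whenever \<open>f\<close> vanishes at infinity. This applies to
  \<open>1 - V\<^sup>2\<close>, and to \<open>[V, a] = a g(\<D>)\<close> with \<open>g(k) = v(k + m) - v(k)\<close>, \<open>v(t) = t / \<surd>(1 + t\<^sup>2)\<close>, for \<open>a\<close> of
  degree \<open>m\<close>.

  Uniqueness of the positive square root of \<open>(1 + \<D>\<^sup>2)\<^sup>-\<^sup>1\<close> and the orthogonality of the \<open>S\<^sub>e\<close> rest on the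
  positivity of the elements \<open>c\<^sup>* c\<close>. Contractivity of *-homomorphisms and boundedness of left
  multiplication follow from writing a self-adjoint contraction as the real part of a unitary.
\<close>

section \<open>Elementary C*-algebra theory\<close>

text \<open>The algebra need not have a unit, so \<open>1 - x\<close> is only available as the
  operator \<open>z \<mapsto> z - x * z\<close>. Positivity and unitarity are therefore stated
  through left multiplications, and the norm of an element is recovered from its left multiplication
  operator. The function v does not vanish at infinity: it tends to 1 and -1 at the two ends. A
  shift by a fixed degree m leaves both limits unchanged, and this is why g vanishes there. Since g
  depends on m, the commutator is treated for homogeneous \<open>a\<close> and extended by density
  together with a bound that is linear in the norm of \<open>a\<close>. A function of the degree
  bounded by C acts with norm at most C. Hence cutting off a function that vanishes at infinity
  approximates it in operator norm; strong convergence would not preserve compactness.\<close>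

context complex_banach
begin

lemma scaleC_zero_right [simp]: "c *\<^sub>C (0::'a) = 0"
  using scaleC_add_right[of c 0 0] by simp

lemma scaleC_zero_left [simp]: "0 *\<^sub>C x = 0"
  using scaleC_add_left[of 0 0 x] by simp

lemma scaleC_minus_right [simp]: "c *\<^sub>C (- x) = - (c *\<^sub>C x)"
proof -
  have "c *\<^sub>C (- x) + c *\<^sub>C x = 0" by (simp flip: scaleC_add_right)
  then show ?thesis by (rule minus_unique[symmetric, OF add.commute[THEN trans]])
qed

lemma scaleC_minus_left [simp]: "(- c) *\<^sub>C x = - (c *\<^sub>C x)"
proof -
  have "(- c) *\<^sub>C x + c *\<^sub>C x = 0" by (simp flip: scaleC_add_left)
  then show ?thesis by (rule minus_unique[symmetric, OF add.commute[THEN trans]])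
qed

lemma scaleC_diff_right: "c *\<^sub>C (x - y) = c *\<^sub>C x - c *\<^sub>C y"
  using scaleC_add_right[of c x "- y"] by simp

lemma scaleC_one [simp]: "1 *\<^sub>C x = x"
  using scaleR_scaleC[of 1 x] by (simp add: scaleR_one)

lemma scaleC_scaleR_commute: "c *\<^sub>C (r *\<^sub>R x) = r *\<^sub>R (c *\<^sub>C x)"
  by (simp add: scaleR_scaleC scaleC_scaleC mult.commute)

end

lemma bounded_linear_scaleC: "bounded_linear (\<lambda>x :: 'a::complex_banach. c *\<^sub>C x)"
  by (rule bounded_linear_intro[of _ "cmod c"])
     (simp_all add: scaleC_add_right scaleC_scaleR_commute norm_scaleC mult.commute)

lemma bounded_bilinear_scaleC: "bounded_bilinear (\<lambda>c (x :: 'a::complex_banach). c *\<^sub>C x)"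
proof
  show "\<exists>K. \<forall>a (b::'a). norm (a *\<^sub>C b) \<le> norm a * norm b * K"
    by (rule exI[of _ 1]) (simp add: norm_scaleC)
qed (simp_all add: scaleC_add_right scaleC_add_left scaleC_scaleR_commute,
     simp add: scaleR_scaleC scaleC_scaleC scaleR_conv_of_real)

lemmas continuous_on_scaleC [continuous_intros] =
  bounded_bilinear.continuous_on[OF bounded_bilinear_scaleC]

context cstar_algebra
begin

lemma star_zero [simp]: "star 0 = 0"
  using star_add[of 0 0] by simp

lemma star_minus: "star (- x) = - star x"
  using star_scaleC[of "- 1" x] by simp

lemma star_diff: "star (x - y) = star x - star y"
  using star_add[of x "- y"] by (simp add: star_minus)

lemma star_scaleR: "star (r *\<^sub>R x) = r *\<^sub>R star x"
  by (simp add: scaleR_scaleC star_scaleC)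

lemmas star_simps = star_star star_add star_diff star_minus star_mult star_scaleR star_scaleC

lemma norm_star [simp]: "norm (star x) = norm x"
proof -
  have "norm y \<le> norm (star y)" for y
  proof (cases "norm y = 0")
    case False
    have "norm y * norm y \<le> norm (star y) * norm y"
      using norm_mult_ineq[of "star y" y] by (simp add: norm_star_mult power2_eq_square)
    then show ?thesis using False
      by (metis mult_le_cancel_right norm_ge_zero not_less order.order_iff_strict)
  qed simp
  from this[of x] this[of "star x"] show ?thesis by (simp add: star_star)
qed

lemma norm_mult_star: "norm (x * star x) = (norm x)\<^sup>2"
  using norm_star_mult[of "star x"] by (simp add: star_star)

lemma star_mult_self_eq_0: "star x * x = 0 \<Longrightarrow> x = 0"
  using norm_star_mult[of x] by simp

end

lemma bounded_linear_star: "bounded_linear (star :: 'a::cstar_algebra \<Rightarrow> 'a)"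
  by (rule bounded_linear_intro[of _ 1]) (simp_all add: star_add star_scaleR)

lemmas continuous_on_star [continuous_intros] =
  bounded_linear.continuous_on[OF bounded_linear_star]

text \<open>Testing on \<open>z = star x\<close> and the C*-identity recover the norm of
  \<open>x\<close>. This turns estimates for left multiplication operators into estimates for
  elements.\<close>

lemma norm_le_left_mult:
  fixes x :: "'a::cstar_algebra"
  assumes "\<And>z. norm (x * z) \<le> r * norm z" and "0 \<le> r"
  shows "norm x \<le> r"
proof (cases "norm x = 0")
  case False
  have "norm x * norm x \<le> r * norm x"
    using assms(1)[of "star x"] by (simp add: norm_mult_star power2_eq_square)
  then show ?thesis using False by (simp add: mult_le_cancel_right)
qed (use assms in simp)

text \<open>\<open>1 - k\<close> is \<open>\<surd>(1 - h\<^sup>2)\<close> in the (absent) unitization.\<close>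

lemma ex_defect:
  fixes h :: "'a::cstar_algebra"
  assumes "star h = h" and "norm h < 1"
  obtains k where "star k = k" and "h * k = k * h" and "h * h + k * k = 2 *\<^sub>R k"
proof -
  define S where "S = {k. norm k \<le> norm h \<and> star k = k \<and> h * k = k * h}"
  \<comment> \<open>Fixed points of \<open>f\<close> solve (1 - k)^2 = 1 - h^2. On the ball of
    radius \<open>norm h\<close> this map contracts by the factor \<open>norm h\<close>, which is
    below 1.\<close>
  define f where "f k = (1/2) *\<^sub>R (h * h + k * k)" for k
  have "closed S" unfolding S_def
    by (intro closed_Collect_conj closed_Collect_le closed_Collect_eq continuous_intros)
  then have "complete S" by (simp add: complete_eq_closed)
  moreover have "S \<noteq> {}" by (auto simp: S_def intro: exI[of _ 0])
  moreover have "f ` S \<subseteq> S"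
  proof safe
    fix k assume k: "k \<in> S"
    have "norm (f k) \<le> (1/2) * (norm (h * h) + norm (k * k))"
      unfolding f_def using norm_triangle_ineq[of "h * h" "k * k"] by simp
    also have "\<dots> \<le> (1/2) * (norm h * 1 + norm h * 1)"
      using k assms unfolding S_def
      by (intro mult_left_mono add_mono order_trans[OF norm_mult_ineq] mult_mono) auto
    finally have "norm (f k) \<le> norm h" by simp
    moreover have "h * (k * k) = k * k * h" using k unfolding S_def
      by (metis (mono_tags, lifting) mem_Collect_eq mult.assoc)
    ultimately show "f k \<in> S" using k assms unfolding S_def f_def
      by (simp add: star_simps algebra_simps)
  qed
  moreover have "dist (f k) (f l) \<le> norm h * dist k l" if "k \<in> S" "l \<in> S" for k l
  proof -
    have "f k - f l = (1/2) *\<^sub>R (k * (k - l) + (k - l) * l)"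
      by (simp add: f_def algebra_simps)
    then have "norm (f k - f l) \<le> (1/2) * (norm (k * (k - l)) + norm ((k - l) * l))"
      using norm_triangle_ineq[of "k * (k - l)" "(k - l) * l"] by simp
    also have "\<dots> \<le> (1/2) * (norm h * norm (k - l) + norm (k - l) * norm h)"
      using that unfolding S_def
      by (intro mult_left_mono add_mono order_trans[OF norm_mult_ineq] mult_mono) auto
    finally show ?thesis by (simp add: dist_norm)
  qed
  ultimately have "\<exists>!k\<in>S. f k = k"
    using Banach_fix[of S "norm h" f] assms(2) norm_ge_zero by blast
  then obtain k where k: "k \<in> S" "f k = k" by blast
  then have "h * h + k * k = 2 *\<^sub>R k" unfolding f_def
    by (metis (no_types) scaleR_scaleR mult_numeral_1_right numeral_One divide_self_if scaleR_one
        times_divide_eq_right zero_neq_numeral)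
  with k that show ?thesis by (auto simp: S_def)
qed

text \<open>\<open>h + i(1 - k)\<close> is unitary.\<close>

lemma star_mult_unitary:
  fixes h :: "'a::cstar_algebra"
  assumes "star h = h" "star k = k" "h * k = k * h" "h * h + k * k = 2 *\<^sub>R k"
  shows "star (h * y + \<i> *\<^sub>C (y - k * y)) * (h * z + \<i> *\<^sub>C (z - k * z)) = star y * z"
proof -
  have "star y * (h * h) * z + star y * (k * k) * z = star y * (2 *\<^sub>R k) * z"
    by (simp flip: assms(4) add: algebra_simps)
  then have e1: "star y * (h * (h * z)) = 2 *\<^sub>R (star y * (k * z)) - star y * (k * (k * z))"
    by (simp add: algebra_simps)
  have e2: "star y * (h * (k * z)) = star y * (k * (h * z))"
    by (metis assms(3) mult.assoc)
  show ?thesis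
    by (simp add: star_simps assms scaleC_diff_right scaleC_add_right scaleC_mult_left
        scaleC_mult_right scaleC_scaleC algebra_simps e1 e2 scaleR_2)
qed

lemma norm_eq_of_star_mult_eq:
  fixes x y :: "'a::cstar_algebra"
  shows "star x * x = star y * y \<Longrightarrow> norm x = norm y"
  by (metis norm_ge_zero norm_star_mult power2_eq_imp_eq)

lemma contractive_average:
  fixes u v x :: "'a::complex_banach"
  assumes "u - v = 2 *\<^sub>R x" "norm u \<le> r" "norm v \<le> r"
  shows "norm x \<le> r"
proof -
  have "2 * norm x = norm (u - v)" using assms(1) by simp
  also have "\<dots> \<le> norm u + norm v" by (rule norm_triangle_ineq4)
  finally show ?thesis using assms by simp
qed

text \<open>\<open>h\<close> and \<open>- h\<close> share the same \<open>k\<close>, so h + i(1 - k)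
  and -h + i(1 - k) both multiply isometrically, and half their difference is
  \<open>h\<close>.\<close>

lemma unitary_difference:
  fixes h :: "'a::cstar_algebra"
  shows "(h * y + \<i> *\<^sub>C (y - k * y)) - ((- h) * y + \<i> *\<^sub>C (y - k * y)) = 2 *\<^sub>R (h * y)"
  by (simp add: scaleR_2)

section \<open>Contractivity of *-homomorphisms\<close>

lemma star_hom_of_typeD:
  assumes "star_hom (cstar_of_type :: 'a::cstar_algebra cstar) (cstar_of_type :: 'b::cstar_algebra cstar) \<phi>"
  shows "\<phi> (star x) = star (\<phi> x)" "\<phi> (c *\<^sub>C x) = c *\<^sub>C \<phi> x" "\<phi> (x + y) = \<phi> x + \<phi> y"
    "\<phi> (x * y) = \<phi> x * \<phi> y"
  using assms by (simp_all add: star_hom_def cstar_of_type_def)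

lemma star_hom_contractive:
  fixes \<phi> :: "'a::cstar_algebra \<Rightarrow> 'b::cstar_algebra"
  assumes hom: "star_hom cstar_of_type cstar_of_type \<phi>"
  shows "norm (\<phi> x) \<le> norm x"
proof -
  note \<phi> = star_hom_of_typeD[OF hom]
  have \<phi>R: "\<phi> (r *\<^sub>R a) = r *\<^sub>R \<phi> a" for r a by (simp add: scaleR_scaleC \<phi>)
  have small: "norm (\<phi> h) \<le> 1" if h: "star h = h" "norm h < 1" for h
  proof -
    obtain k where k: "star k = k" "h * k = k * h" "h * h + k * k = 2 *\<^sub>R k"
      using ex_defect[OF h] by blast
    \<comment> \<open>The defect equation survives \<open>\<phi>\<close>, so the unitary argument
      runs in the target although the norm of \<open>\<phi> h\<close> is not yet controlled.\<close>
    have *: "star (\<phi> h) = \<phi> h" "star (\<phi> k) = \<phi> k" "\<phi> h * \<phi> k = \<phi> k * \<phi> h"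
      "\<phi> h * \<phi> h + \<phi> k * \<phi> k = 2 *\<^sub>R \<phi> k"
      by (simp_all add: h k flip: \<phi> \<phi>R)
    have "norm (\<phi> h * y) \<le> 1 * norm y" for y
    proof -
      have "norm (\<phi> h * y + \<i> *\<^sub>C (y - \<phi> k * y)) = norm y"
        by (rule norm_eq_of_star_mult_eq star_mult_unitary *)+
      moreover have "norm ((- \<phi> h) * y + \<i> *\<^sub>C (y - \<phi> k * y)) = norm y"
        using * by (intro norm_eq_of_star_mult_eq star_mult_unitary) (simp_all add: star_minus)
      ultimately show ?thesis
        using contractive_average[OF unitary_difference[of "\<phi> h" y "\<phi> k"], of "norm y"] by simp
    qed
    then show ?thesis by (rule norm_le_left_mult) simp
  qed
  have sa: "norm (\<phi> h) \<le> norm h" if h: "star h = h" for h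
  \<comment> \<open>\<open>small\<close> needs a norm strictly below 1, so \<open>h\<close> is
    scaled to norm \<open>r\<close>, for every \<open>r\<close> below 1.\<close>
  proof (rule field_le_mult_one_interval)
    fix r :: real assume r: "0 < r" "r < 1"
    show "r * norm (\<phi> h) \<le> norm h"
    proof (cases "norm h = 0")
      case True
      then have "norm (\<phi> (s *\<^sub>R h)) \<le> 1" for s using small[of "s *\<^sub>R h"] by simp
      then have "\<bar>s\<bar> * norm (\<phi> h) \<le> 1" for s by (simp add: \<phi>R)
      from this[of "2 / norm (\<phi> h)"] have "norm (\<phi> h) = 0" by (cases "norm (\<phi> h) = 0") auto
      then show ?thesis using True by simp
    next
      case False
      then have "norm (\<phi> ((r / norm h) *\<^sub>R h)) \<le> 1" using r h
        by (intro small) (simp_all add: star_scaleR)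
      then show ?thesis using False r by (simp add: \<phi>R field_simps)
    qed
  qed
  have "(norm (\<phi> x))\<^sup>2 = norm (\<phi> (star x * x))" by (simp add: \<phi> norm_star_mult)
  also have "\<dots> \<le> norm (star x * x)" by (rule sa) (simp add: star_simps)
  finally show ?thesis by (simp add: norm_star_mult)
qed

section \<open>Positivity\<close>

text \<open>This is \<open>\<parallel>t - x\<parallel> \<le> t\<close> in the unitization. It makes sums of positive elements visibly positive.\<close>

definition cpos :: "'a::cstar_algebra \<Rightarrow> bool" where
  "cpos x \<longleftrightarrow> star x = x \<and> (\<exists>t. \<forall>z. norm (t *\<^sub>R z - x * z) \<le> t * norm z)"

text \<open>By the triangle inequality \<open>t\<close> may be enlarged, so it can be taken positive
  and later divided by.\<close>

lemma cposE:
  fixes x :: "'a::cstar_algebra"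
  assumes "cpos x"
  obtains t where "t > 0" "\<And>z. norm (t *\<^sub>R z - x * z) \<le> t * norm z" "star x = x"
proof -
  obtain t where t: "\<And>z. norm (t *\<^sub>R z - x * z) \<le> t * norm z" "star x = x"
    using assms by (auto simp: cpos_def)
  define r where "r = \<bar>t\<bar> + 1 - t"
  have "norm ((t + r) *\<^sub>R z - x * z) \<le> (t + r) * norm z" for z
  proof -
    have "norm ((t + r) *\<^sub>R z - x * z) = norm ((t *\<^sub>R z - x * z) + r *\<^sub>R z)"
      by (simp add: algebra_simps)
    also have "\<dots> \<le> t * norm z + r * norm z"
      using t(1)[of z] by (intro order_trans[OF norm_triangle_ineq] add_mono) (auto simp: r_def)
    finally show ?thesis by (simp add: algebra_simps)
  qed
  then show ?thesis using that[of "t + r"] t(2) by (auto simp: r_def)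
qed

lemma cpos_add:
  assumes "cpos x" "cpos y"
  shows "cpos (x + y)"
proof -
  obtain s t where s: "\<And>z. norm (s *\<^sub>R z - x * z) \<le> s * norm z" "star x = x"
    and t: "\<And>z. norm (t *\<^sub>R z - y * z) \<le> t * norm z" "star y = y"
    using assms by (auto simp: cpos_def)
  have "norm ((s + t) *\<^sub>R z - (x + y) * z) \<le> (s + t) * norm z" for z
  proof -
    have eq: "(s + t) *\<^sub>R z - (x + y) * z = (s *\<^sub>R z - x * z) + (t *\<^sub>R z - y * z)"
      by (simp add: algebra_simps)
    show ?thesis unfolding eq
      using norm_triangle_ineq[of "s *\<^sub>R z - x * z" "t *\<^sub>R z - y * z"] s(1)[of z] t(1)[of z]
      by (simp add: distrib_right)
  qed
  then show ?thesis using s(2) t(2) by (auto simp: cpos_def star_add)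
qed

lemma cpos_scaleR:
  assumes "cpos x" "0 \<le> r"
  shows "cpos (r *\<^sub>R x)"
proof -
  obtain t where t: "\<And>z. norm (t *\<^sub>R z - x * z) \<le> t * norm z" "star x = x"
    using assms by (auto simp: cpos_def)
  have "norm ((r * t) *\<^sub>R z - (r *\<^sub>R x) * z) \<le> (r * t) * norm z" for z
  proof -
    have "(r * t) *\<^sub>R z - (r *\<^sub>R x) * z = r *\<^sub>R (t *\<^sub>R z - x * z)"
      by (simp add: algebra_simps)
    then show ?thesis using mult_left_mono[OF t(1)[of z] assms(2)] assms(2) by simp
  qed
  then show ?thesis using t(2) by (auto simp: cpos_def star_scaleR)
qed

lemma cpos_zero [simp]: "cpos 0"
  by (auto simp: cpos_def intro: exI[of _ 0])

lemma cpos_sum: "(\<And>i. i \<in> I \<Longrightarrow> cpos (f i)) \<Longrightarrow> cpos (\<Sum>i\<in>I. f i)"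
  by (induction I rule: infinite_finite_induct) (auto intro: cpos_add)

text \<open>For a strict contraction the bound holds with t = 1: the operator 1 - h^2 is the square
  of 1 - k, and 1 - k is contractive because, up to the factor \<open>\<i>\<close>, it is half the
  sum of two unitaries.\<close>

lemma cpos_square:
  fixes h :: "'a::cstar_algebra"
  assumes h: "star h = h"
  shows "cpos (h * h)"
proof -
  have small: "cpos (h * h)" if h: "star h = h" "norm h < 1" for h :: 'a
  proof -
    obtain k where k: "star k = k" "h * k = k * h" "h * h + k * k = 2 *\<^sub>R k"
      using ex_defect[OF h] by blast
    have *: "norm (z - k * z) \<le> norm z" for z
    proof -
      have "norm (h * z + \<i> *\<^sub>C (z - k * z)) = norm z"
        by (rule norm_eq_of_star_mult_eq star_mult_unitary k h)+
      moreover have "norm (- ((- h) * z + \<i> *\<^sub>C (z - k * z))) = norm z"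
        unfolding norm_minus_cancel
        using k h by (intro norm_eq_of_star_mult_eq star_mult_unitary) (simp_all add: star_minus)
      moreover have "(h * z + \<i> *\<^sub>C (z - k * z)) - (- ((- h) * z + \<i> *\<^sub>C (z - k * z)))
          = 2 *\<^sub>R (\<i> *\<^sub>C (z - k * z))" by (simp add: scaleR_2)
      ultimately have "norm (\<i> *\<^sub>C (z - k * z)) \<le> norm z"
        using contractive_average by (metis order_refl)
      then show ?thesis by (simp add: norm_scaleC)
    qed
    have "norm (1 *\<^sub>R z - h * h * z) \<le> 1 * norm z" for z
    proof -
      have "h * h * z + k * k * z = 2 *\<^sub>R (k * z)"
        by (simp add: k(3) flip: distrib_right)
      then have hz: "h * h * z = 2 *\<^sub>R (k * z) - k * k * z" by (simp add: eq_diff_eq)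
      have eq: "1 *\<^sub>R z - h * h * z = (z - k * z) - k * (z - k * z)"
        unfolding hz by (simp add: algebra_simps scaleR_2)
      show ?thesis unfolding eq using order_trans[OF *[of "z - k * z"] *[of z]] by simp
    qed
    then show ?thesis using h unfolding cpos_def by (metis star_mult)
  qed
  define r where "r = 1 / (norm h + 1)"
  have r: "r > 0" "norm (r *\<^sub>R h) < 1" unfolding r_def by (simp_all add: add_nonneg_pos)
  have "cpos ((1 / r\<^sup>2) *\<^sub>R ((r *\<^sub>R h) * (r *\<^sub>R h)))"
    by (intro cpos_scaleR small) (use r h in \<open>auto simp: star_scaleR\<close>)
  then show ?thesis using r by (simp add: power2_eq_square)
qed

text \<open>
  With \<open>K = t\<^sub>n - u\<^sub>n\<close> the iteration below is \<open>K \<mapsto> ((1 - x) + K\<^sup>2) / 2\<close>, started at \<open>0\<close>. It converges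
  because it is dominated by its scalar version \<open>t \<mapsto> (1 + t\<^sup>2) / 2\<close>.
\<close>

lemma cpos_sqrt_contraction:
  fixes x :: "'a::cstar_algebra"
  assumes x: "star x = x" and contr: "\<And>z. norm (z - x * z) \<le> norm z"
  obtains s where "cpos s" "s * s = x" "\<And>y. x * y = y * x \<Longrightarrow> s * y = y * s"
proof -
  define t where "t = rec_nat (0::real) (\<lambda>_ r. (1 + r\<^sup>2) / 2)"
  have t0: "t 0 = 0" and tS: "t (Suc n) = (1 + (t n)\<^sup>2) / 2" for n by (simp_all add: t_def)
  define u where "u = rec_nat (0::'a) (\<lambda>n v. (1/2) *\<^sub>R (x + (2 * t n) *\<^sub>R v - v * v))"
  have u0: "u 0 = 0" and uS: "u (Suc n) = (1/2) *\<^sub>R (x + (2 * t n) *\<^sub>R u n - u n * u n)" for n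
    by (simp_all add: u_def)
  have t01: "0 \<le> t n \<and> t n \<le> 1" for n
    by (induction n) (auto simp: t0 tS power_le_one)
  have "t (Suc n) - t n = (1 - t n)\<^sup>2 / 2" for n by (simp add: tS power2_eq_square field_simps)
  then have "t n \<le> t (Suc n)" for n by (metis diff_ge_0_iff_ge divide_nonneg_pos zero_le_power2 zero_less_numeral)
  then have inc: "incseq t" by (simp add: incseq_SucI)
  then obtain l where l: "t \<longlonglongrightarrow> l" using t01 by (metis incseq_convergent)
  have "(\<lambda>n. t (Suc n)) \<longlonglongrightarrow> (1 + l\<^sup>2) / 2" unfolding tS by (intro tendsto_intros l) simp
  then have "(1 + l\<^sup>2) / 2 = l" using LIMSEQ_unique LIMSEQ_Suc[OF l] by blast
  then have "(l - 1)\<^sup>2 = 0" by (simp add: power2_eq_square field_simps)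
  then have l1: "t \<longlonglongrightarrow> 1" using l by simp
  define K where "K n z = t n *\<^sub>R z - u n * z" for n z
  have K2: "K (Suc n) z = (1/2) *\<^sub>R ((z - x * z) + K n (K n z))" for n z
  proof -
    have t2: "2 * t (Suc n) = 1 + t n * t n" by (simp add: tS power2_eq_square)
    have u2: "2 *\<^sub>R u (Suc n) = x + (t n *\<^sub>R u n + t n *\<^sub>R u n) - u n * u n"
      by (simp add: uS flip: scaleR_add_left)
    have "K (Suc n) z = (1/2) *\<^sub>R ((2 * t (Suc n)) *\<^sub>R z - (2 *\<^sub>R u (Suc n)) * z)"
      by (simp add: K_def scaleR_diff_right)
    also have "(2 * t (Suc n)) *\<^sub>R z - (2 *\<^sub>R u (Suc n)) * z = (z - x * z) + K n (K n z)"
      unfolding t2 u2 by (simp add: K_def algebra_simps)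
    finally show ?thesis .
  qed
  have Kn: "norm (K n z) \<le> t n * norm z" for n z
  proof (induction n arbitrary: z)
    case (Suc n)
    have "norm (K (Suc n) z) \<le> (1/2) * (norm (z - x * z) + norm (K n (K n z)))"
      using norm_triangle_ineq[of "z - x * z" "K n (K n z)"] by (simp add: K2)
    also have "\<dots> \<le> (1/2) * (norm z + t n * (t n * norm z))"
      using contr[of z] order_trans[OF Suc[of "K n z"] mult_left_mono[OF Suc[of z]]] t01[of n]
      by (intro mult_left_mono add_mono) auto
    finally show ?case by (simp add: tS power2_eq_square field_simps)
  qed (simp add: K_def t0 u0)
  define d where "d n z = K (Suc n) z - K n z" for n z
  have dn: "norm (d n z) \<le> (t (Suc n) - t n) * norm z" for n z
  proof (induction n arbitrary: z)
    case 0
    have "d 0 z = (1/2) *\<^sub>R (z - x * z)" by (simp add: d_def K_def t0 u0 tS uS algebra_simps)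
    then show ?case using contr[of z] by (simp add: t0 tS)
  next
    case (Suc n)
    \<comment> \<open>With K' the next iterate, K'K' - KK = K'(K' - K) + (K' - K)K. No commutativity
      is involved, and the scalar increments satisfy the same recursion.\<close>
    have "d (Suc n) z = (1/2) *\<^sub>R (K (Suc n) (d n z) + d n (K n z))"
    proof -
      have diff: "K m (z - w) = K m z - K m w" for m z w by (simp add: K_def algebra_simps)
      have "P - Q = (1/2) *\<^sub>R (A - B)"
        if "P = (1/2) *\<^sub>R (C + A)" "Q = (1/2) *\<^sub>R (C + B)" for A B C P Q :: 'a
        using that by (simp add: algebra_simps)
      from this[OF K2[of "Suc n" z] K2[of n z]] show ?thesis by (simp only: d_def diff) simp
    qed
    then have "norm (d (Suc n) z) \<le> (1/2) * (norm (K (Suc n) (d n z)) + norm (d n (K n z)))"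
      using norm_triangle_ineq[of "K (Suc n) (d n z)" "d n (K n z)"] by simp
    also have "\<dots> \<le> (1/2) * (t (Suc n) * ((t (Suc n) - t n) * norm z) + (t (Suc n) - t n) * (t n * norm z))"
      using t01[of n] t01[of "Suc n"] incseq_SucD[OF inc, of n]
      by (intro mult_left_mono add_mono order_trans[OF Kn] order_trans[OF Suc] Kn Suc) auto
    also have "\<dots> = (t (Suc (Suc n)) - t (Suc n)) * norm z"
      by (simp add: tS[of "Suc n"] tS[of n] power2_eq_square field_simps)
    finally show ?case .
  qed
  have un: "norm (u (Suc n) - u n) \<le> 2 * (t (Suc n) - t n)" for n
  proof (rule norm_le_left_mult)
    fix z
    have eq: "(u (Suc n) - u n) * z = (t (Suc n) - t n) *\<^sub>R z - d n z"
      by (simp add: d_def K_def algebra_simps)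
    have "norm ((t (Suc n) - t n) *\<^sub>R z) = (t (Suc n) - t n) * norm z"
      using incseq_SucD[OF inc, of n] by simp
    then show "norm ((u (Suc n) - u n) * z) \<le> 2 * (t (Suc n) - t n) * norm z"
      using norm_triangle_ineq4[of "(t (Suc n) - t n) *\<^sub>R z" "d n z"] dn[of n z]
      unfolding eq mult.assoc by linarith
  qed (use incseq_SucD[OF inc, of n] in simp)
  have um: "norm (u m - u n) \<le> 2 * (t m - t n)" if "n \<le> m" for m n
    using that
  proof (induction m rule: dec_induct)
    case (step m)
    have "norm (u (Suc m) - u n) \<le> norm (u (Suc m) - u m) + norm (u m - u n)"
      using norm_triangle_ineq[of "u (Suc m) - u m" "u m - u n"] by simp
    then show ?case using step un[of m] by simp
  qed simp
  have "Cauchy u"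
  proof (rule CauchyI')
    fix e :: real assume "e > 0"
    then obtain N where "\<And>n. n \<ge> N \<Longrightarrow> \<bar>t n - 1\<bar> < e / 4"
      using l1[THEN LIMSEQ_D, of "e/4"] by auto
    then have N: "\<bar>t n - 1\<bar> < e / 4" if "n \<ge> N" for n using that by blast
    have "norm (u m - u n) < e" if "m \<ge> N" "n > m" for m n
    proof -
      have "norm (u n - u m) \<le> 2 * (t n - t m)" using um that by simp
      then show ?thesis
        using N[OF that(1)] t01[of m] t01[of n] \<open>e > 0\<close> by (simp add: norm_minus_commute)
    qed
    then show "\<exists>M. \<forall>m\<ge>M. \<forall>n>m. dist (u m) (u n) < e" unfolding dist_norm by blast
  qed
  then obtain s where s: "u \<longlonglongrightarrow> s" by (metis Cauchy_convergent convergent_def)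
  have "(\<lambda>n. u (Suc n)) \<longlonglongrightarrow> (1/2) *\<^sub>R (x + (2 * 1) *\<^sub>R s - s * s)"
    unfolding uS by (intro tendsto_intros s l1)
  then have "(1/2) *\<^sub>R (x + (2 * 1) *\<^sub>R s - s * s) = s" using LIMSEQ_unique LIMSEQ_Suc[OF s] by blast
  then have "2 *\<^sub>R ((1/2) *\<^sub>R (x + (2 * 1) *\<^sub>R s - s * s)) = 2 *\<^sub>R s" by simp
  then have ss: "s * s = x" by (simp add: algebra_simps)
  have "star (u n) = u n" for n by (induction n) (simp_all add: u0 uS star_simps x)
  then have "u \<longlonglongrightarrow> star s" using bounded_linear.tendsto[OF bounded_linear_star s] by simp
  then have "star s = s" using s LIMSEQ_unique by blast
  moreover have "norm (1 *\<^sub>R z - s * z) \<le> 1 * norm z" for z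
  proof (rule LIMSEQ_le)
    show "(\<lambda>n. norm (t n *\<^sub>R z - u n * z)) \<longlonglongrightarrow> norm (1 *\<^sub>R z - s * z)"
      by (intro tendsto_intros l1 s)
    show "(\<lambda>n. t n * norm z) \<longlonglongrightarrow> 1 * norm z" by (intro tendsto_intros l1)
  qed (use Kn in \<open>simp add: K_def\<close>)
  ultimately have "cpos s" unfolding cpos_def by blast
  moreover have "s * y = y * s" if y: "x * y = y * x" for y
  proof -
    have "u n * y = y * u n" for n
    proof (induction n)
      case (Suc n)
      have "u n * (u n * y) = y * (u n * u n)" by (metis Suc mult.assoc)
      then show ?case using Suc y by (simp add: uS algebra_simps)
    qed (simp add: u0)
    then have "(\<lambda>n. u n * y) \<longlonglongrightarrow> y * s" by (simp add: tendsto_intros s)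
    moreover have "(\<lambda>n. u n * y) \<longlonglongrightarrow> s * y" by (intro tendsto_intros s)
    ultimately show ?thesis using LIMSEQ_unique by blast
  qed
  ultimately show ?thesis using that ss by blast
qed

lemma cpos_sqrt:
  fixes x :: "'a::cstar_algebra"
  assumes "cpos x"
  obtains s where "cpos s" "s * s = x" "\<And>y. x * y = y * x \<Longrightarrow> s * y = y * s"
proof -
  obtain t where t: "t > 0" "\<And>z. norm (t *\<^sub>R z - x * z) \<le> t * norm z" "star x = x"
    using assms by (rule cposE) blast
  define x' where "x' = (1 / t) *\<^sub>R x"
  have "star x' = x'" by (simp add: x'_def star_scaleR t)
  moreover have "norm (z - x' * z) \<le> norm z" for z
  proof -
    have eq: "z - x' * z = (1 / t) *\<^sub>R (t *\<^sub>R z - x * z)"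
      using t(1) by (simp add: x'_def algebra_simps)
    show ?thesis unfolding eq norm_scaleR using t(1) t(2)[of z]
      by (simp add: pos_divide_le_eq mult.commute)
  qed
  ultimately obtain s where s: "cpos s" "s * s = x'" "\<And>y. x' * y = y * x' \<Longrightarrow> s * y = y * s"
    by (rule cpos_sqrt_contraction) blast
  have "cpos (sqrt t *\<^sub>R s)" using s(1) t(1) by (simp add: cpos_scaleR)
  moreover have "(sqrt t *\<^sub>R s) * (sqrt t *\<^sub>R s) = x" using s(2) t(1) by (simp add: x'_def)
  moreover have "(sqrt t *\<^sub>R s) * y = y * (sqrt t *\<^sub>R s)" if "x * y = y * x" for y
    using s(3)[of y] that by (simp add: x'_def)
  ultimately show ?thesis using that by blast
qed

lemma cpos_star: "cpos x \<Longrightarrow> star x = x"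
  by (simp add: cpos_def)

text \<open>Commuting roots s of x and r of -x give w = s - ir with \<open>star w * w\<close> = s^2
  + r^2 = 0. So w = 0, and its real part s vanishes.\<close>

lemma cpos_antisym:
  fixes x :: "'a::cstar_algebra"
  assumes "cpos x" "cpos (- x)"
  shows "x = 0"
proof -
  obtain s where s: "cpos s" "s * s = x" using assms(1) by (rule cpos_sqrt) blast
  obtain r where r: "cpos r" "r * r = - x" "\<And>y. - x * y = y * - x \<Longrightarrow> r * y = y * r"
    using assms(2) by (rule cpos_sqrt) blast
  have "- x * s = s * - x" unfolding s(2)[symmetric] by (simp add: mult.assoc)
  then have rs: "r * s = s * r" by (rule r(3))
  define w where "w = s - \<i> *\<^sub>C r"
  have sw: "star w = s + \<i> *\<^sub>C r" using s(1) r(1) by (simp add: w_def star_simps cpos_star)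
  have "star w * w = s * s + r * r"
    unfolding sw unfolding w_def
    by (simp add: algebra_simps scaleC_add_right scaleC_diff_right
        scaleC_mult_left scaleC_mult_right scaleC_scaleC rs)
  then have "star w * w = 0" by (simp only: s(2) r(2) add.right_inverse)
  then have "w = 0" by (rule star_mult_self_eq_0)
  moreover have "2 *\<^sub>R s = w + star w" unfolding sw unfolding w_def by (simp add: scaleR_2)
  ultimately have "s = 0" by simp
  then show ?thesis using s by simp
qed

text \<open>Symmetry makes \<open>n \<mapsto> \<parallel>T\<^sup>n z\<parallel>\<close> logarithmically convex.\<close>

lemma symmetric_growth:
  fixes T :: "'a::cstar_algebra \<Rightarrow> 'a"
  assumes sym: "\<And>y z. star (T y) * z = star y * T z"
    and growth: "\<And>n. norm ((T ^^ n) z) \<le> t ^ n * (1 + real n * C)" and t: "t > 0" and C: "C \<ge> 0"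
  shows "norm (T z) \<le> t * norm z"
proof (rule ccontr)
  define a where "a n = norm ((T ^^ n) z)" for n
  have conv: "(a (Suc n))\<^sup>2 \<le> a n * a (Suc (Suc n))" for n
  proof -
    have "(a (Suc n))\<^sup>2 = norm (star ((T ^^ n) z) * (T ^^ (Suc (Suc n))) z)"
      unfolding a_def by (simp add: sym flip: norm_star_mult)
    then show ?thesis unfolding a_def by (metis norm_mult_ineq norm_star)
  qed
  assume "\<not> norm (T z) \<le> t * norm z"
  then have a01: "a 1 > t * a 0" by (simp add: a_def)
  have a0: "a 0 > 0"
  proof (rule ccontr)
    assume "\<not> a 0 > 0"
    then have "a 0 = 0" by (simp add: a_def)
    then have "a 1 = 0" using conv[of 0] by simp
    then show False using a01 \<open>a 0 = 0\<close> by simp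
  qed
  \<comment> \<open>Log-convexity keeps all successive ratios of \<open>a\<close> at or above the
    first one, \<open>r\<close>. If r > t, then (r/t)^n outgrows the linear factor 1 + nC.\<close>
  define r where "r = a 1 / a 0"
  have r: "r > t" using a01 a0 by (simp add: r_def field_simps)
  have step: "a n > 0 \<and> a (Suc n) \<ge> r * a n" for n
  proof (induction n)
    case 0 then show ?case using a0 by (simp add: r_def)
  next
    case (Suc n)
    have p: "a (Suc n) > 0" using Suc r t by (smt (verit) mult_pos_pos)
    have "r * a n * a (Suc n) \<le> a (Suc n) * a (Suc n)" using Suc p by (intro mult_right_mono) auto
    also have "\<dots> \<le> a n * a (Suc (Suc n))" using conv[of n] by (simp add: power2_eq_square)
    finally have "a n * (r * a (Suc n)) \<le> a n * a (Suc (Suc n))" by (simp add: algebra_simps)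
    then show ?case using Suc p by simp
  qed
  have lower: "r ^ n * a 0 \<le> a n" for n
  proof (induction n)
    case (Suc n)
    have "r ^ Suc n * a 0 \<le> r * a n" using mult_left_mono[OF Suc, of r] r t by (simp add: mult.assoc)
    then show ?case using step[of n] by linarith
  qed simp
  define q where "q = r / t"
  have q: "q > 1" using r t by (simp add: q_def)
  have "q ^ n * a 0 \<le> 1 + real n * C" for n
  proof -
    have "r ^ n * a 0 \<le> t ^ n * (1 + real n * C)" using lower[of n] growth[of n] by (simp add: a_def)
    then show ?thesis using t by (simp add: q_def power_divide field_simps)
  qed
  then have "a 0 \<le> (1 + real n * C) * (1/q) ^ n" for n
    using q by (simp add: power_divide field_simps)
  moreover have "(\<lambda>n. (1 + real n * C) * (1/q) ^ n) \<longlonglongrightarrow> 0"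
  proof -
    have n: "norm (1/q) < 1" using q by simp
    have "(\<lambda>n. (1/q) ^ n + C * (real n * (1/q) ^ n)) \<longlonglongrightarrow> 0 + C * 0"
      by (intro tendsto_intros LIMSEQ_power_zero[OF n] powser_times_n_limit_0[OF n])
    moreover have "(1 + real n * C) * (1/q) ^ n = (1/q) ^ n + C * (real n * (1/q) ^ n)" for n
      by (simp add: algebra_simps)
    ultimately show ?thesis by simp
  qed
  ultimately have "a 0 \<le> 0" by (intro LIMSEQ_le_const) auto
  then show False using a0 by simp
qed

text \<open>\<open>(t + d d\<^sup>*)\<^sup>n = t\<^sup>n + d G d\<^sup>*\<close> where \<open>G\<close> is a polynomial in \<open>t + d\<^sup>* d\<close>.\<close>

lemma cpos_neg_swap:
  fixes d :: "'a::cstar_algebra"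
  assumes "cpos (- (star d * d))"
  shows "cpos (- (d * star d))"
proof -
  obtain t where t: "t > 0" "\<And>z. norm (t *\<^sub>R z + star d * (d * z)) \<le> t * norm z"
    using cposE[OF assms] by (metis diff_minus_eq_add minus_mult_left mult.assoc)
  define T where "T z = t *\<^sub>R z + d * (star d * z)" for z
  have sym: "star (T y) * z = star y * T z" for y z
    by (simp add: T_def star_simps algebra_simps)
  have "norm (T z) \<le> t * norm z" for z
  proof -
    \<comment> \<open>\<open>g\<close> collects n terms of norm at most t^(n-1) times that of
      \<open>star d * z\<close>; the extra factor \<open>t\<close> on the left avoids the exponent n
      - 1.\<close>
    have ex: "\<exists>g. (T ^^ n) z = t ^ n *\<^sub>R z + d * g \<and> t * norm g \<le> real n * t ^ n * norm (star d * z)" for n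
    proof (induction n)
      case (Suc n)
      then obtain g where g: "(T ^^ n) z = t ^ n *\<^sub>R z + d * g"
        "t * norm g \<le> real n * t ^ n * norm (star d * z)" by blast
      define g' where "g' = t ^ n *\<^sub>R (star d * z) + (t *\<^sub>R g + star d * (d * g))"
      have "(T ^^ Suc n) z = t ^ Suc n *\<^sub>R z + d * g'"
        by (simp add: g T_def g'_def algebra_simps)
      moreover have "norm g' \<le> t ^ n * norm (star d * z) + t * norm g"
        unfolding g'_def using norm_triangle_ineq[of "t ^ n *\<^sub>R (star d * z)" "t *\<^sub>R g + star d * (d * g)"]
          t(2)[of g] t(1) by simp
      then have "norm g' \<le> real (Suc n) * t ^ n * norm (star d * z)" using g by (simp add: algebra_simps)
      then have "t * norm g' \<le> t * (real (Suc n) * t ^ n * norm (star d * z))"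
        using t(1) by (intro mult_left_mono) auto
      then have "t * norm g' \<le> real (Suc n) * t ^ Suc n * norm (star d * z)" by (simp add: algebra_simps)
      ultimately show ?case by blast
    qed (auto intro: exI[of _ 0])
    show ?thesis
    proof (cases "z = 0")
      case False
      define C where "C = norm d * norm (star d * z) / (t * norm z)"
      have "norm ((T ^^ n) z) \<le> norm z * (t ^ n * (1 + real n * C))" for n
      proof -
        obtain g where g: "(T ^^ n) z = t ^ n *\<^sub>R z + d * g"
          "t * norm g \<le> real n * t ^ n * norm (star d * z)" using ex by blast
        have "norm ((T ^^ n) z) \<le> t ^ n * norm z + norm d * norm g"
          unfolding g using t(1)
          by (intro order_trans[OF norm_triangle_ineq] add_mono norm_mult_ineq) auto
        also have "norm d * norm g \<le> norm d * (real n * t ^ n * norm (star d * z) / t)"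
          using g(2) t(1) by (intro mult_left_mono) (auto simp: field_simps)
        also have "t ^ n * norm z + norm d * (real n * t ^ n * norm (star d * z) / t)
            = t ^ n * norm z + t ^ n * real n * (norm z * C)"
          using False by (simp add: C_def)
        also have "\<dots> = norm z * (t ^ n * (1 + real n * C))" by (simp only: algebra_simps)
        finally show ?thesis by simp
      qed
      \<comment> \<open>The growth bound of \<open>symmetric_growth\<close> carries no factor
        \<open>norm z\<close>, so it is applied to the normalised vector.\<close>
      then have "norm ((T ^^ n) ((1 / norm z) *\<^sub>R z)) \<le> t ^ n * (1 + real n * C)" for n
      proof -
        have "(T ^^ n) (r *\<^sub>R y) = r *\<^sub>R (T ^^ n) y" for r y
          by (induction n) (simp_all add: T_def algebra_simps)
        then show ?thesis using \<open>norm ((T ^^ n) z) \<le> _\<close> False by (simp add: field_simps)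
      qed
      then have "norm (T ((1 / norm z) *\<^sub>R z)) \<le> t * norm ((1 / norm z) *\<^sub>R z)"
        using t(1) by (intro symmetric_growth[OF sym, where C = C]) (auto simp: C_def)
      moreover have "T ((1 / norm z) *\<^sub>R z) = (1 / norm z) *\<^sub>R T z" by (simp add: T_def algebra_simps)
      ultimately show ?thesis using False by (simp add: field_simps)
    qed (simp add: T_def)
  qed
  then have "norm (t *\<^sub>R z - (- (d * star d)) * z) \<le> t * norm z" for z
    by (simp add: T_def mult.assoc)
  then show ?thesis unfolding cpos_def by (auto simp: star_simps)
qed

text \<open>
  \<open>v = \<bar>a\<bar> - a\<close> is twice the negative part of \<open>a = c\<^sup>* c\<close>. With \<open>d = c v\<close>, both \<open>- d\<^sup>* d\<close> and hence
  \<open>- d d\<^sup>*\<close> are positive, whereas \<open>d\<^sup>* d + d d\<^sup>*\<close> is a sum of squares.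
\<close>

theorem cpos_star_mult:
  fixes c :: "'a::cstar_algebra"
  shows "cpos (star c * c)"
proof -
  define a where "a = star c * c"
  have a: "star a = a" by (simp add: a_def star_simps)
  obtain s where s: "cpos s" "s * s = a * a" "\<And>y. a * a * y = y * (a * a) \<Longrightarrow> s * y = y * s"
    using cpos_square[OF a] by (rule cpos_sqrt) blast
  have sa: "s * a = a * s" by (rule s(3)) (simp add: mult.assoc)
  obtain p where p: "cpos p" "p * p = s" "\<And>y. s * y = y * s \<Longrightarrow> p * y = y * p"
    using s(1) by (rule cpos_sqrt) blast
  define v where "v = s - a"
  have v: "star v = v" using s(1) a by (simp add: v_def star_diff cpos_star)
  have pv: "p * v = v * p" using p(3)[of v] sa by (simp add: v_def algebra_simps)
  \<comment> \<open>Since s^2 = a^2 and s commutes with a, multiplication by a acts on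
    \<open>v\<close> as multiplication by -s.\<close>
  have vv: "v * v = 2 *\<^sub>R (s * v)" by (simp add: v_def algebra_simps sa s(2) scaleR_2)
  have av: "a * v = - (s * v)" by (simp add: v_def algebra_simps sa s(2))
  have vav: "v * (a * v) = - ((p * v) * (p * v))"
  proof -
    have "v * (s * v) = (v * p) * (p * v)" unfolding p(2)[symmetric] by (simp only: mult.assoc)
    then show ?thesis unfolding av by (simp add: pv)
  qed
  have spv: "star (p * v) = p * v" using p(1) v pv by (simp add: star_mult cpos_star)
  define d where "d = c * v"
  have dd: "star d * d = - ((p * v) * (p * v))"
    using vav v by (simp add: d_def a_def star_mult mult.assoc)
  then have neg: "cpos (- (star d * d))" using cpos_square[OF spv] by simp
  \<comment> \<open>Up to the factors 2 and -2, \<open>x\<close> and \<open>y\<close> are the real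
    and imaginary parts of \<open>d\<close>.\<close>
  define x where "x = d + star d"
  define y where "y = \<i> *\<^sub>C (d - star d)"
  have "star x = x" "star y = y"
    by (simp_all add: x_def y_def star_simps scaleC_diff_right)
  then have "cpos ((1/2) *\<^sub>R (x * x + y * y))" by (intro cpos_scaleR cpos_add cpos_square) auto
  also have "x * x + y * y = 2 *\<^sub>R (star d * d + d * star d)"
    by (simp add: x_def y_def scaleC_mult_left scaleC_mult_right scaleC_scaleC scaleC_diff_right
        scaleR_2 algebra_simps)
  also have "(1/2) *\<^sub>R 2 *\<^sub>R (star d * d + d * star d) = star d * d + d * star d" by simp
  finally have "cpos (star d * d + d * star d + - (d * star d))"
    using cpos_neg_swap[OF neg] by (rule cpos_add)
  then have "star d * d = 0" using neg by (intro cpos_antisym) auto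
  then have "star (p * v) * (p * v) = 0" using dd spv by simp
  then have "p * v = 0" by (rule star_mult_self_eq_0)
  then have "s * v = 0" by (simp add: mult.assoc flip: p(2))
  then have "star v * v = 0" using vv v by simp
  then have "v = 0" by (rule star_mult_self_eq_0)
  then show ?thesis using s(1) by (simp add: v_def a_def)
qed

text \<open>Each summand is minus the sum of the others, hence both positive and negative. Relations
  between edges are extracted from the Cuntz-Krieger sums in this way.\<close>

lemma sum_star_mult_eq_0:
  fixes c :: "'i \<Rightarrow> 'a::cstar_algebra"
  assumes "(\<Sum>i\<in>I. star (c i) * c i) = 0" and "finite I" "i \<in> I"
  shows "c i = 0"
proof -
  have "- (star (c i) * c i) = (\<Sum>j\<in>I - {i}. star (c j) * c j)"
    using assms by (simp add: sum.remove neg_eq_iff_add_eq_0)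
  then have "cpos (- (star (c i) * c i))" by (simp add: cpos_sum cpos_star_mult)
  then show ?thesis using cpos_antisym cpos_star_mult star_mult_self_eq_0 by blast
qed

section \<open>Hilbert modules\<close>

lemma subspace_closure:
  fixes V :: "'b::real_normed_vector set"
  assumes "subspace V"
  shows "subspace (closure V)"
proof (rule subspaceI)
  show "0 \<in> closure V" using closure_subset subspace_0[OF assms] by blast
next
  fix x y assume "x \<in> closure V" "y \<in> closure V"
  then obtain f g where "\<And>n. f n \<in> V" "f \<longlonglongrightarrow> x" "\<And>n. g n \<in> V" "g \<longlonglongrightarrow> y"
    by (auto simp: closure_sequential)
  then show "x + y \<in> closure V" unfolding closure_sequential
    by (intro exI[of _ "\<lambda>n. f n + g n"]) (auto intro: tendsto_add subspace_add[OF assms])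
next
  fix r :: real and x assume "x \<in> closure V"
  then obtain f where "\<And>n. f n \<in> V" "f \<longlonglongrightarrow> x" by (auto simp: closure_sequential)
  then show "r *\<^sub>R x \<in> closure V" unfolding closure_sequential
    by (intro exI[of _ "\<lambda>n. r *\<^sub>R f n"])
       (auto intro: tendsto_scaleR tendsto_const subspace_scale[OF assms])
qed

locale cstar_module =
  fixes F :: "'a::cstar_algebra set" and act :: "'x::complex_banach \<Rightarrow> 'a \<Rightarrow> 'x"
    and ip :: "'x \<Rightarrow> 'x \<Rightarrow> 'a"
  assumes hilbert: "hilbert_module F act ip"
begin

lemma F_subalgebra: "closed_star_subalgebra F"
  using hilbert by (simp add: hilbert_module_def)

lemma F_closed:
  "f \<in> F \<Longrightarrow> g \<in> F \<Longrightarrow> f + g \<in> F" "f \<in> F \<Longrightarrow> g \<in> F \<Longrightarrow> f * g \<in> F"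
  "f \<in> F \<Longrightarrow> star f \<in> F" "f \<in> F \<Longrightarrow> c *\<^sub>C f \<in> F" "f \<in> F \<Longrightarrow> r *\<^sub>R f \<in> F"
  using F_subalgebra by (auto simp: closed_star_subalgebra_def scaleR_scaleC)

lemma ip_simps:
  "ip x (y + z) = ip x y + ip x z" "ip x (c *\<^sub>C y) = c *\<^sub>C ip x y"
  "star (ip x y) = ip y x" "f \<in> F \<Longrightarrow> ip x (act y f) = ip x y * f"
  using hilbert by (auto simp: hilbert_module_def)

lemma ip_in_F [simp]: "ip x y \<in> F"
  using hilbert by (auto simp: hilbert_module_def)

lemma act_simps:
  "f \<in> F \<Longrightarrow> act (x + y) f = act x f + act y f"
  "f \<in> F \<Longrightarrow> g \<in> F \<Longrightarrow> act x (f + g) = act x f + act x g"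
  "f \<in> F \<Longrightarrow> act (c *\<^sub>C x) f = c *\<^sub>C act x f"
  "f \<in> F \<Longrightarrow> act x (c *\<^sub>C f) = c *\<^sub>C act x f"
  using hilbert by (auto simp: hilbert_module_def)

lemma ip_left:
  "ip (x + y) z = ip x z + ip y z" "ip (c *\<^sub>C x) y = cnj c *\<^sub>C ip x y"
  "f \<in> F \<Longrightarrow> ip (act x f) y = star f * ip x y"
  by (metis ip_simps(1,3) star_add, metis ip_simps(2,3) star_scaleC, metis ip_simps(3,4) star_mult)

lemma ip_scaleR: "ip x (r *\<^sub>R y) = r *\<^sub>R ip x y" "ip (r *\<^sub>R x) y = r *\<^sub>R ip x y"
  by (simp_all add: scaleR_scaleC ip_simps ip_left)

lemma cpos_ip: "cpos (ip x x)"
proof -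
  have "\<exists>b\<in>F. ip x x = star b * b" using hilbert unfolding hilbert_module_def by blast
  then show ?thesis using cpos_star_mult by metis
qed

lemma ip_self_eq_0: "ip x x = 0 \<Longrightarrow> x = 0"
  using hilbert by (auto simp: hilbert_module_def)

lemma norm_ip_self: "norm (ip x x) = (norm x)\<^sup>2"
proof -
  have "norm x = sqrt (norm (ip x x))" using hilbert by (auto simp: hilbert_module_def)
  then show ?thesis by simp
qed

lemma ip_zero [simp]: "ip x 0 = 0" "ip 0 x = 0"
  using ip_simps(2)[of x 0 0] ip_left(2)[of 0 0 x] by simp_all

lemma ip_minus: "ip x (- y) = - ip x y" "ip (- x) y = - ip x y"
  using ip_scaleR(1)[of x "-1" y] ip_scaleR(2)[of "-1" x y] by simp_all

lemma ip_diff: "ip x (y - z) = ip x y - ip x z" "ip (x - y) z = ip x z - ip y z"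
  using ip_simps(1)[of x y "- z"] ip_left(1)[of x "- y" z] by (simp_all add: ip_minus)

lemma norm_act:
  assumes "f \<in> F"
  shows "norm (act x f) \<le> norm x * norm f"
proof (rule power2_le_imp_le)
  have "(norm (act x f))\<^sup>2 = norm (star f * (ip x x * f))"
    using assms by (simp add: ip_simps ip_left mult.assoc flip: norm_ip_self)
  also have "\<dots> \<le> norm f * ((norm x)\<^sup>2 * norm f)"
    by (rule order_trans[OF norm_mult_ineq])
       (auto intro!: mult_left_mono order_trans[OF norm_mult_ineq] simp: norm_ip_self)
  finally show "(norm (act x f))\<^sup>2 \<le> (norm x * norm f)\<^sup>2"
    by (simp add: power2_eq_square algebra_simps)
qed simp

text \<open>
  A Cauchy-Schwarz inequality with the constant 2 is enough below; it follows by polarization from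
  the triangle inequality, which is part of the type class.
\<close>

lemma norm_ip: "norm (ip x y) \<le> 2 * norm x * norm y"
proof (cases "x = 0 \<or> y = 0 \<or> ip x y = 0")
  case False
  define c where "c = ip x y"
  \<comment> \<open>The scaling is chosen so that \<open>act y f\<close> has norm at most
    \<open>norm x\<close>, which balances the two terms of the polarization.\<close>
  define t where "t = norm x / (norm y * norm c)"
  have pos: "norm x > 0" "norm y > 0" "norm c > 0" using False by (auto simp: c_def)
  then have t: "t > 0" by (simp add: t_def)
  define f where "f = t *\<^sub>R star c"
  have f: "f \<in> F" by (simp add: f_def c_def F_closed)
  have nf: "norm (act y f) \<le> norm x"
    using norm_act[OF f, of y] pos t by (simp add: f_def) (simp add: t_def)
  have bound: "norm (ip z z) \<le> 4 * (norm x)\<^sup>2" if "norm z \<le> norm x + norm (act y f)" for z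
  proof -
    have "(norm z)\<^sup>2 \<le> (2 * norm x)\<^sup>2" using that nf by (intro power_mono) auto
    then show ?thesis by (simp add: norm_ip_self power_mult_distrib)
  qed
  have "(4 * t) *\<^sub>R (c * star c) = ip (x + act y f) (x + act y f) - ip (x - act y f) (x - act y f)"
  proof -
    have "ip x (act y f) = t *\<^sub>R (c * star c)" "ip (act y f) x = t *\<^sub>R (c * star c)"
      using f ip_simps(3)[of x y] by (simp_all add: ip_simps ip_left)
         (simp_all add: f_def c_def star_scaleR star_star ip_simps(3))
    moreover have "(4 * t) *\<^sub>R w = (t *\<^sub>R w + t *\<^sub>R w) + (t *\<^sub>R w + t *\<^sub>R w)" for w :: 'a
      by (simp flip: scaleR_add_left)
    ultimately show ?thesis by (simp add: ip_simps(1) ip_left(1) ip_diff)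
  qed
  then have "4 * t * (norm c)\<^sup>2
      = norm (ip (x + act y f) (x + act y f) - ip (x - act y f) (x - act y f))"
    using t by (metis abs_of_pos norm_mult_star norm_scaleR zero_less_mult_iff zero_less_numeral)
  also have "\<dots> \<le> 4 * (norm x)\<^sup>2 + 4 * (norm x)\<^sup>2"
    by (rule order_trans[OF norm_triangle_ineq4])
       (intro add_mono bound norm_triangle_ineq norm_triangle_ineq4)
  finally have "t * (norm c)\<^sup>2 \<le> 2 * (norm x)\<^sup>2" by simp
  moreover have "t * (norm c)\<^sup>2 = norm x * norm c / norm y"
    using pos by (simp add: t_def power2_eq_square)
  ultimately have "norm x * norm c \<le> norm x * (2 * norm x * norm y)"
    using pos by (simp add: pos_divide_le_eq power2_eq_square mult.assoc mult.left_commute)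
  then show ?thesis using pos by (simp add: c_def)
qed auto

sublocale ip: bounded_bilinear ip
proof
  show "\<exists>K. \<forall>a b. norm (ip a b) \<le> norm a * norm b * K"
    using norm_ip by (intro exI[of _ 2]) (simp add: mult.commute mult.left_commute)
qed (simp_all add: ip_simps ip_left ip_scaleR)

lemma ip_ext:
  assumes "\<And>z. ip z x = ip z y"
  shows "x = y"
  using ip_self_eq_0[of "x - y"] assms by (simp add: ip_diff)

lemma adjoint_pairD:
  assumes "adjoint_pair ip T T'"
  shows "ip (T x) y = ip x (T' y)" "ip x (T y) = ip (T' x) y"
  using assms by (metis adjoint_pair_def ip_simps(3))+

lemma adjoint_pair_swap: "adjoint_pair ip T T' \<Longrightarrow> adjoint_pair ip T' T"
  using adjoint_pairD(2) by (metis adjoint_pair_def)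

text \<open>Having an adjoint already forces linearity, by testing against all \<open>z\<close>.
  This serves operators known only through \<open>adjoint_pair\<close>, such as a competing square
  root.\<close>

lemma adjoint_pair_linear:
  assumes "adjoint_pair ip T T'"
  shows "T (x + y) = T x + T y" "T (c *\<^sub>C x) = c *\<^sub>C T x" "T (r *\<^sub>R x) = r *\<^sub>R T x"
    "f \<in> F \<Longrightarrow> T (act x f) = act (T x) f"
  by (rule ip_ext, simp add: adjoint_pairD[OF assms] ip_simps ip_scaleR)+

lemma adjoint_pair_unique: "adjoint_pair ip T T' \<Longrightarrow> adjoint_pair ip T T'' \<Longrightarrow> T' = T''"
  by (intro ext ip_ext) (metis adjoint_pairD(1))

lemma adjoint_of_eq: "adjoint_pair ip T T' \<Longrightarrow> adjoint_of ip T = T'"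
  unfolding adjoint_of_def using adjoint_pair_unique by blast

lemma adjoint_pair_diff:
  "T (x - y) = T x - T y" if "adjoint_pair ip T T'"
  by (rule ip_ext) (simp add: adjoint_pairD[OF that] ip_diff)

lemma bounded_linear_act: "bounded_linear (\<lambda>z. act x (ip y z))"
proof (rule bounded_linear_intro[of _ "norm x * (2 * norm y)"])
  show "norm (act x (ip y z)) \<le> norm z * (norm x * (2 * norm y))" for z
    by (rule order_trans[OF norm_act])
       (use mult_left_mono[OF norm_ip[of y z], of "norm x"] in \<open>simp_all add: algebra_simps\<close>)
qed (simp_all add: ip_simps act_simps scaleR_scaleC)


subsection \<open>Compact endomorphisms\<close>

abbreviation "rank_ones \<equiv> {\<Theta> :: 'x \<Rightarrow>\<^sub>L 'x. \<exists>x y. blinfun_apply \<Theta> = (\<lambda>z. act x (ip y z))}"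

lemma compact_rank_one: "compact_endomorphism act ip (\<lambda>z. act x (ip y z))"
  unfolding compact_endomorphism_def
proof (rule bexI)
  show "(\<lambda>z. act x (ip y z)) = blinfun_apply (Blinfun (\<lambda>z. act x (ip y z)))"
    by (simp add: bounded_linear_Blinfun_apply bounded_linear_act)
  then have "Blinfun (\<lambda>z. act x (ip y z)) \<in> rank_ones"
    unfolding mem_Collect_eq by (intro exI[of _ x] exI[of _ y]) (rule sym)
  then show "Blinfun (\<lambda>z. act x (ip y z)) \<in> closure (span rank_ones)"
    by (intro subsetD[OF closure_subset] span_base)
qed

lemma compact_zero: "compact_endomorphism act ip (\<lambda>x. 0)"
  unfolding compact_endomorphism_def using closure_subset span_0
  by (intro bexI[of _ 0]) (auto simp: zero_blinfun.rep_eq)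

lemma compact_add:
  assumes "compact_endomorphism act ip S" "compact_endomorphism act ip T"
  shows "compact_endomorphism act ip (\<lambda>x. S x + T x)"
proof -
  obtain K L where K: "K \<in> closure (span rank_ones)" "S = blinfun_apply K"
    and L: "L \<in> closure (span rank_ones)" "T = blinfun_apply L"
    using assms by (auto simp: compact_endomorphism_def)
  have "K + L \<in> closure (span rank_ones)"
    using K L by (intro subspace_add subspace_closure) auto
  then show ?thesis unfolding compact_endomorphism_def
    by (rule bexI[rotated]) (simp add: K L plus_blinfun.rep_eq)
qed

lemma compact_scaleR:
  assumes "compact_endomorphism act ip S"
  shows "compact_endomorphism act ip (\<lambda>x. r *\<^sub>R S x)"
proof -
  obtain K where K: "K \<in> closure (span rank_ones)" "S = blinfun_apply K"
    using assms by (auto simp: compact_endomorphism_def)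
  have "r *\<^sub>R K \<in> closure (span rank_ones)"
    using K by (intro subspace_scale subspace_closure) auto
  then show ?thesis unfolding compact_endomorphism_def
    by (rule bexI[rotated]) (simp add: K scaleR_blinfun.rep_eq)
qed

lemma compact_sum:
  "(\<And>i. i \<in> I \<Longrightarrow> compact_endomorphism act ip (T i))
    \<Longrightarrow> compact_endomorphism act ip (\<lambda>x. \<Sum>i\<in>I. T i x)"
  by (induction I rule: infinite_finite_induct) (auto intro: compact_add compact_zero)

lemma compact_limit:
  assumes T: "bounded_linear T"
    and approx: "\<And>e. e > 0 \<Longrightarrow>
      \<exists>S. compact_endomorphism act ip S \<and> (\<forall>x. norm (T x - S x) \<le> e * norm x)"
  shows "compact_endomorphism act ip T"
proof -
  have "Blinfun T \<in> closure (closure (span rank_ones))"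
    unfolding closure_approachable
  proof safe
    fix e :: real assume "e > 0"
    then obtain S where S: "compact_endomorphism act ip S" "\<And>x. norm (T x - S x) \<le> (e/2) * norm x"
      using approx[of "e/2"] by auto
    obtain K where K: "K \<in> closure (span rank_ones)" "S = blinfun_apply K"
      using S(1) by (auto simp: compact_endomorphism_def)
    have "norm (Blinfun T - K) \<le> e / 2"
      using S(2) \<open>e > 0\<close> unfolding K
      by (intro norm_blinfun_bound) (auto simp: minus_blinfun.rep_eq bounded_linear_Blinfun_apply T)
    then show "\<exists>K\<in>closure (span rank_ones). dist K (Blinfun T) < e"
      using K(1) \<open>e > 0\<close> by (intro bexI[of _ K]) (auto simp: dist_norm norm_minus_commute)
  qed
  then show ?thesis unfolding compact_endomorphism_def
    by (intro bexI[of _ "Blinfun T"]) (auto simp: bounded_linear_Blinfun_apply T)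
qed

text \<open>The map K \<mapsto> A K B is bounded linear and sends the rank one operator of
  \<open>x\<close>, \<open>y\<close> to that of \<open>A x\<close>, \<open>B' y\<close>, so it
  preserves the closed span.\<close>

lemma compact_comp:
  assumes A: "adjoint_pair ip A A'" "bounded_linear A"
    and B: "adjoint_pair ip B B'" "bounded_linear B"
    and T: "compact_endomorphism act ip T"
  shows "compact_endomorphism act ip (\<lambda>x. A (T (B x)))"
proof -
  define L where "L K = Blinfun A o\<^sub>L K o\<^sub>L Blinfun B" for K
  have app: "blinfun_apply (L K) = (\<lambda>x. A (K (B x)))" for K
    by (rule ext) (simp add: L_def bounded_linear_Blinfun_apply A B)
  have L: "bounded_linear L" unfolding L_def
    by (intro bounded_linear_intros)
  have "L ` rank_ones \<subseteq> rank_ones"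
  proof safe
    fix K x y assume K: "blinfun_apply K = (\<lambda>z. act x (ip y z))"
    have "blinfun_apply (L K) = (\<lambda>z. act (A x) (ip (B' y) z))"
      unfolding app K by (simp add: adjoint_pair_linear[OF A(1)] adjoint_pairD(2)[OF B(1)])
    then show "\<exists>x y. blinfun_apply (L K) = (\<lambda>z. act x (ip y z))" by blast
  qed
  then have "L ` span rank_ones \<subseteq> span rank_ones"
    by (simp add: span_mono linear_span_image[OF bounded_linear.linear[OF L], symmetric])
  then have "L ` closure (span rank_ones) \<subseteq> closure (span rank_ones)"
    using closure_bounded_linear_image_subset[OF L, of "span rank_ones"] closure_mono by blast
  moreover obtain K where "K \<in> closure (span rank_ones)" "T = blinfun_apply K"
    using T by (auto simp: compact_endomorphism_def)
  ultimately show ?thesis unfolding compact_endomorphism_def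
    by (intro bexI[of _ "L K"]) (auto simp: app)
qed

end

text \<open>Summability becomes a condition on norms of finite sums. Series in different Banach
  spaces can then be compared: one in the module and one of inner products in the algebra.\<close>

lemma summable_on_iff_Cauchy:
  fixes f :: "'i \<Rightarrow> 'b::banach"
  shows "f summable_on UNIV \<longleftrightarrow>
    (\<forall>e>0. \<exists>J. finite J \<and> (\<forall>K. finite K \<and> K \<inter> J = {} \<longrightarrow> norm (sum f K) < e))"
proof safe
  fix e :: real assume e: "e > 0" and "f summable_on UNIV"
  then obtain l where "(sum f \<longlongrightarrow> l) (finite_subsets_at_top UNIV)"
    by (auto simp: summable_on_def has_sum_def)
  then have "eventually (\<lambda>I. dist (sum f I) l < e / 2) (finite_subsets_at_top UNIV)"
    using e by (intro tendstoD) auto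
  then obtain J where J: "finite J" "\<And>I. finite I \<Longrightarrow> J \<subseteq> I \<Longrightarrow> dist (sum f I) l < e / 2"
    by (auto simp: eventually_finite_subsets_at_top)
  have "norm (sum f K) < e" if "finite K" "K \<inter> J = {}" for K
  proof -
    have "sum f K = sum f (J \<union> K) - sum f J"
      using that J(1) by (subst sum.union_disjoint) auto
    then have "norm (sum f K) = dist (sum f (J \<union> K)) (sum f J)" by (simp add: dist_norm)
    also have "\<dots> < e"
      by (rule dist_triangle_half_l[OF J(2) J(2)]) (simp_all add: that J(1))
    finally show ?thesis .
  qed
  then show "\<exists>J. finite J \<and> (\<forall>K. finite K \<and> K \<inter> J = {} \<longrightarrow> norm (sum f K) < e)"
    using J(1) by blast
next
  assume *: "\<forall>e>0. \<exists>J. finite J \<and> (\<forall>K. finite K \<and> K \<inter> J = {} \<longrightarrow> norm (sum f K) < e)"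
  have "\<exists>P. eventually P (finite_subsets_at_top UNIV) \<and>
      (\<forall>I Y. P I \<and> P Y \<longrightarrow> dist (sum f I) (sum f Y) < e)" if "e > 0" for e
  proof -
    obtain J where J: "finite J" "\<And>K. finite K \<Longrightarrow> K \<inter> J = {} \<Longrightarrow> norm (sum f K) < e / 2"
      using * \<open>e > 0\<close> by (metis half_gt_zero)
    have "dist (sum f I) (sum f Y) < e" if "finite I \<and> J \<subseteq> I" "finite Y \<and> J \<subseteq> Y" for I Y
    proof -
      have "dist (sum f Z) (sum f J) < e / 2" if "finite Z \<and> J \<subseteq> Z" for Z
        using J(2)[of "Z - J"] that by (simp add: dist_norm sum_diff Diff_Int_distrib2)
      from this[OF that(1)] this[OF that(2)] show ?thesis
        by (rule dist_triangle_half_l)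
    qed
    moreover have "eventually (\<lambda>I. finite I \<and> J \<subseteq> I) (finite_subsets_at_top UNIV)"
      using J(1) by (auto simp: eventually_finite_subsets_at_top)
    ultimately show ?thesis by blast
  qed
  then have "cauchy_filter (filtermap (sum f) (finite_subsets_at_top UNIV))"
    by (simp add: cauchy_filter_metric_filtermap)
  moreover have "complete (UNIV::'b set)"
    by (meson Cauchy_convergent UNIV_I complete_def convergent_def)
  ultimately obtain l where "(sum f \<longlongrightarrow> l) (finite_subsets_at_top UNIV)"
    using complete_uniform[where S=UNIV] by (force simp add: filterlim_def)
  then show "f summable_on UNIV" using summable_on_def has_sum_def by blast
qed

section \<open>Hilbert modules graded by the integers\<close>

text \<open>Density of the span of the homogeneous elements takes the place of convergence of the
  sum of the \<open>P k x\<close> to \<open>x\<close>. The functional calculus of the grading is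
  thereby independent of graphs.\<close>

locale graded_module = cstar_module F act ip
  for F :: "'a::cstar_algebra set" and act :: "'x::complex_banach \<Rightarrow> 'a \<Rightarrow> 'x" and ip +
  fixes P :: "int \<Rightarrow> 'x \<Rightarrow> 'x"
  assumes P_bounded: "bounded_linear (P k)"
    and P_P: "P j (P k x) = (if j = k then P k x else 0)"
    and P_sym: "adjoint_pair ip (P k) (P k)"
    and homogeneous_dense: "closure (span {x. \<exists>k. P k x = x}) = UNIV"
begin

lemmas P_linear = linear_add[OF bounded_linear.linear[OF P_bounded]]
  linear_diff[OF bounded_linear.linear[OF P_bounded]]
  linear_sum[OF bounded_linear.linear[OF P_bounded]]
  linear_scale[OF bounded_linear.linear[OF P_bounded]]
  linear_0[OF bounded_linear.linear[OF P_bounded]]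

lemma P_scaleC: "P k (c *\<^sub>C x) = c *\<^sub>C P k x"
  by (rule adjoint_pair_linear[OF P_sym])

lemma ip_orthogonal_sum:
  assumes "finite J" and y: "\<And>j. j \<in> J \<Longrightarrow> P j (y j) = y j"
  shows "ip (\<Sum>j\<in>J. y j) (\<Sum>j\<in>J. y j) = (\<Sum>j\<in>J. ip (y j) (y j))"
proof -
  have "ip (y i) (y j) = (if i = j then ip (y i) (y i) else 0)" if "i \<in> J" "j \<in> J" for i j
  proof -
    have "ip (y i) (y j) = ip (P i (y i)) (P j (y j))" using y that by simp
    also have "\<dots> = ip (y i) (P i (P j (y j)))" by (rule adjoint_pairD(1)[OF P_sym])
    also have "P i (P j (y j)) = (if i = j then y j else 0)" using y that P_P[of i j "y j"] by simp
    finally show ?thesis by auto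
  qed
  then have "(\<Sum>i\<in>J. \<Sum>j\<in>J. ip (y i) (y j))
      = (\<Sum>i\<in>J. \<Sum>j\<in>J. if i = j then ip (y i) (y i) else 0)"
    by (intro sum.cong refl)
  moreover have "ip (\<Sum>j\<in>J. y j) (\<Sum>j\<in>J. y j) = (\<Sum>i\<in>J. \<Sum>j\<in>J. ip (y i) (y j))"
    by (simp only: ip.sum_left) (simp only: ip.sum_right)
  ultimately show ?thesis using assms(1) by simp
qed

text \<open>The inner product of the sum with itself is the sum of those of the
  \<open>P k x\<close>, on which phases have no effect. Starting from phases avoids comparing norms
  along the order of the algebra.\<close>

lemma norm_unimodular_sum:
  assumes "finite J" "\<And>k. k \<in> J \<Longrightarrow> cmod (u k) = 1"
  shows "norm (\<Sum>k\<in>J. u k *\<^sub>C P k x) = norm (\<Sum>k\<in>J. P k x)"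
proof -
  have "ip (\<Sum>k\<in>J. u k *\<^sub>C P k x) (\<Sum>k\<in>J. u k *\<^sub>C P k x) = (\<Sum>k\<in>J. ip (P k x) (P k x))"
  proof (subst ip_orthogonal_sum[OF assms(1)])
    have "u k * cnj (u k) = 1" if "k \<in> J" for k
      using assms(2)[OF that] by (metis complex_norm_square of_real_1 one_power2)
    then show "(\<Sum>k\<in>J. ip (u k *\<^sub>C P k x) (u k *\<^sub>C P k x)) = (\<Sum>k\<in>J. ip (P k x) (P k x))"
      by (intro sum.cong) (simp_all add: ip_simps ip_left scaleC_scaleC)
  qed (simp add: P_scaleC P_P)
  also have "\<dots> = ip (\<Sum>k\<in>J. P k x) (\<Sum>k\<in>J. P k x)"
    by (rule ip_orthogonal_sum[OF assms(1), symmetric]) (simp add: P_P)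
  finally have "(norm (\<Sum>k\<in>J. u k *\<^sub>C P k x))\<^sup>2 = (norm (\<Sum>k\<in>J. P k x))\<^sup>2"
    by (simp flip: norm_ip_self)
  then show ?thesis by simp
qed

text \<open>A real \<open>f\<close> with \<open>\<bar>f\<bar> \<le> 1\<close> is the average of the unimodular \<open>f \<plusminus> i\<surd>(1 - f\<^sup>2)\<close>.\<close>

lemma norm_contractive_sum:
  assumes J: "finite J" and f: "\<And>k. k \<in> J \<Longrightarrow> \<bar>f k\<bar> \<le> 1"
  shows "norm (\<Sum>k\<in>J. f k *\<^sub>R P k x) \<le> norm (\<Sum>k\<in>J. P k x)"
proof -
  define u where "u k = Complex (f k) (sqrt (1 - (f k)\<^sup>2))" for k
  have u: "cmod (u k) = 1" if "k \<in> J" for k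
  proof -
    have "(f k)\<^sup>2 \<le> 1" using f[OF that] by (simp add: abs_square_le_1)
    then show ?thesis by (simp add: u_def cmod_def)
  qed
  have "(\<Sum>k\<in>J. u k *\<^sub>C P k x) - (\<Sum>k\<in>J. (- cnj (u k)) *\<^sub>C P k x)
      = 2 *\<^sub>R (\<Sum>k\<in>J. f k *\<^sub>R P k x)"
  proof -
    have "u k *\<^sub>C P k x - (- cnj (u k)) *\<^sub>C P k x = 2 *\<^sub>R f k *\<^sub>R P k x" for k
    proof -
      have "u k *\<^sub>C P k x - (- cnj (u k)) *\<^sub>C P k x = (u k + cnj (u k)) *\<^sub>C P k x"
        by (simp add: scaleC_add_left)
      also have "u k + cnj (u k) = complex_of_real (2 * f k)" by (simp add: u_def complex_add_cnj)
      finally show ?thesis by (simp only: scaleR_scaleC[symmetric] scaleR_scaleR)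
    qed
    then show ?thesis by (simp only: scaleR_sum_right flip: sum_subtractf)
  qed
  then show ?thesis
    by (rule contractive_average) (use u J in \<open>simp_all only: norm_unimodular_sum norm_minus_cancel
      complex_mod_cnj order_refl\<close>)
qed

lemma finite_sum_extend:
  assumes "finite J'" "x = (\<Sum>k\<in>J'. P k x)" "finite J" "J' \<subseteq> J"
  shows "x = (\<Sum>k\<in>J. P k x)"
proof -
  have "P k x = 0" if "k \<notin> J'" for k
    by (subst assms(2)) (use that assms(1) in \<open>simp add: P_linear P_P\<close>)
  then show ?thesis using assms by (metis (no_types, lifting) DiffD2 sum.mono_neutral_left)
qed

lemma P_dense: "closure {x. \<exists>J. finite J \<and> x = (\<Sum>k\<in>J. P k x)} = UNIV" (is "closure ?D = UNIV")
proof -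
  have "subspace ?D"
  proof (rule subspaceI)
    show "0 \<in> ?D" by (auto intro: exI[of _ "{}"])
    fix x y assume "x \<in> ?D" "y \<in> ?D"
    then obtain J K where J: "finite J" "x = (\<Sum>k\<in>J. P k x)" and K: "finite K" "y = (\<Sum>k\<in>K. P k y)"
      unfolding mem_Collect_eq by iprover
    have "x = (\<Sum>k\<in>J \<union> K. P k x)" "y = (\<Sum>k\<in>J \<union> K. P k y)"
      using J(1) K(1) by (intro finite_sum_extend[OF J] finite_sum_extend[OF K]; simp)+
    then have "x + y = (\<Sum>k\<in>J \<union> K. P k (x + y))" by (simp only: P_linear sum.distrib)
    moreover have "finite (J \<union> K)" using J(1) K(1) by simp
    ultimately show "x + y \<in> ?D" unfolding mem_Collect_eq by iprover
  next
    fix r :: real and x assume "x \<in> ?D"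
    then obtain J where J: "finite J" "x = (\<Sum>k\<in>J. P k x)" unfolding mem_Collect_eq by iprover
    then have "r *\<^sub>R x = (\<Sum>k\<in>J. P k (r *\<^sub>R x))" by (simp only: P_linear flip: scaleR_sum_right)
    then show "r *\<^sub>R x \<in> ?D" using J(1) unfolding mem_Collect_eq by iprover
  qed
  moreover have "x \<in> ?D" if "P k x = x" for k x
    using that by (auto intro!: exI[of _ "{k}"])
  ultimately have "span {x. \<exists>k. P k x = x} \<subseteq> ?D" by (intro span_minimal) blast+
  then have "closure (span {x. \<exists>k. P k x = x}) \<subseteq> closure ?D" by (rule closure_mono)
  then show ?thesis unfolding homogeneous_dense by blast
qed

lemma finite_support_closed:
  assumes "closed T" and "\<And>x J. finite J \<Longrightarrow> x = (\<Sum>k\<in>J. P k x) \<Longrightarrow> x \<in> T"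
  shows "x \<in> T"
proof -
  have "closure {x. \<exists>J. finite J \<and> x = (\<Sum>k\<in>J. P k x)} \<subseteq> T"
    using assms by (intro closure_minimal) auto
  then show ?thesis by (auto simp: P_dense)
qed

text \<open>An element of finite support is the sum of its components, so f / C, extended by 0,
  falls under \<open>norm_contractive_sum\<close>. Such elements are dense and the inequality is
  closed.\<close>

lemma norm_finite_multiplier:
  assumes J: "finite J" and f: "\<And>k. k \<in> J \<Longrightarrow> \<bar>f k\<bar> \<le> C" and C: "0 \<le> C"
  shows "norm (\<Sum>k\<in>J. f k *\<^sub>R P k x) \<le> C * norm x"
proof (cases "C = 0")
  case True
  then have "f k = 0" if "k \<in> J" for k using f[OF that] by simp
  then show ?thesis using True by simp
next
  case False
  have "x \<in> {x. norm (\<Sum>k\<in>J. f k *\<^sub>R P k x) \<le> C * norm x}"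
  proof (rule finite_support_closed)
    show "closed {x. norm (\<Sum>k\<in>J. f k *\<^sub>R P k x) \<le> C * norm x}"
      by (intro closed_Collect_le continuous_intros
          bounded_linear.continuous_on[OF P_bounded])
    fix y J' assume J': "finite J'" "y = (\<Sum>k\<in>J'. P k y)"
    define g where "g k = (if k \<in> J then f k / C else 0)" for k
    have y: "y = (\<Sum>k\<in>J \<union> J'. P k y)" using J J' by (intro finite_sum_extend[OF J']) auto
    have "norm (\<Sum>k\<in>J \<union> J'. g k *\<^sub>R P k y) \<le> norm (\<Sum>k\<in>J \<union> J'. P k y)"
      using f J J' C False by (intro norm_contractive_sum) (auto simp: g_def field_simps)
    also have "(\<Sum>k\<in>J \<union> J'. g k *\<^sub>R P k y) = (\<Sum>k\<in>J. g k *\<^sub>R P k y)"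
      using J J' by (intro sum.mono_neutral_right) (auto simp: g_def)
    also have "\<dots> = (1 / C) *\<^sub>R (\<Sum>k\<in>J. f k *\<^sub>R P k y)"
      unfolding scaleR_sum_right by (intro sum.cong) (auto simp: g_def)
    finally have "norm (\<Sum>k\<in>J. f k *\<^sub>R P k y) \<le> C * norm y"
      using C False by (simp add: divide_le_eq mult.commute flip: y)
    then show "y \<in> {x. norm (\<Sum>k\<in>J. f k *\<^sub>R P k x) \<le> C * norm x}" by simp
  qed
  then show ?thesis by simp
qed

lemma dense_approx:
  assumes "e > 0"
  shows "\<exists>w J. finite J \<and> (\<Sum>k\<in>J. P k w) = w \<and> dist w x < e"
proof -
  have "x \<in> closure {x. \<exists>J. finite J \<and> x = (\<Sum>k\<in>J. P k x)}" by (simp add: P_dense)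
  then obtain w where w: "w \<in> {x. \<exists>J. finite J \<and> x = (\<Sum>k\<in>J. P k x)}" "dist w x < e"
    using assms unfolding closure_approachable by blast
  from w(1) obtain J where "finite J \<and> w = (\<Sum>k\<in>J. P k w)" unfolding mem_Collect_eq ..
  then show ?thesis using w(2) sym by (intro exI[of _ w] exI[of _ J] conjI) iprover+
qed

text \<open>If all components of z vanish, a finitely supported w is the sum of finitely many
  \<open>P k (w - z)\<close>. Then \<open>norm w \<le> norm (w - z)\<close>, which is impossible for
  w close to a nonzero z.\<close>

lemma P_ext:
  assumes "\<And>k. P k x = P k y"
  shows "x = y"
proof (rule ccontr)
  assume "x \<noteq> y"
  define z where "z = x - y"
  have z: "P k z = 0" for k using assms by (simp add: z_def P_linear)
  define e where "e = norm z / 2"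
  have e: "e > 0" using \<open>x \<noteq> y\<close> by (simp add: e_def z_def)
  obtain w J where J: "finite J" "(\<Sum>k\<in>J. P k w) = w" "dist w z < e"
    using dense_approx[OF e] by metis
  have "(\<Sum>k\<in>J. 1 *\<^sub>R P k (w - z)) = w" using J(2) by (simp add: P_linear z)
  then have "norm w \<le> 1 * norm (w - z)"
    using norm_finite_multiplier[OF J(1), of "\<lambda>_. 1" 1 "w - z"] by simp
  then have "norm w < e" using J(3) by (simp add: dist_norm)
  moreover have "norm z \<le> norm w + norm (w - z)"
    using norm_triangle_ineq4[of w "w - z"] by simp
  ultimately show False using J(3) by (simp add: e_def dist_norm)
qed

lemma P_ext_iff: "x = y \<longleftrightarrow> (\<forall>k. P k x = P k y)"
  using P_ext by blast

subsection \<open>Multipliers\<close>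

text \<open>This is f(D) for the number operator D. Where the series does not converge, which
  happens only for unbounded \<open>f\<close>, the value is the default 0.\<close>

definition multiplier :: "(int \<Rightarrow> real) \<Rightarrow> 'x \<Rightarrow> 'x" where
  "multiplier f x = (\<Sum>\<^sub>\<infinity>k. f k *\<^sub>R P k x)"

text \<open>Outside the support of a nearby finitely supported \<open>w\<close>, the terms for
  \<open>x\<close> and \<open>x - w\<close> agree, and the latter are controlled by the bound on
  \<open>f\<close>.\<close>

lemma multiplier_has_sum:
  assumes "bounded (range f)"
  shows "((\<lambda>k. f k *\<^sub>R P k x) has_sum multiplier f x) UNIV"
proof -
  obtain C where C: "C > 0" "\<And>k. \<bar>f k\<bar> \<le> C"
    using assms by (auto simp: bounded_pos)
  have "(\<lambda>k. f k *\<^sub>R P k x) summable_on UNIV"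
    unfolding summable_on_iff_Cauchy
  proof safe
    fix e :: real assume "e > 0"
    then have "e / C > 0" using C(1) by simp
    then obtain w J where J: "finite J" "(\<Sum>k\<in>J. P k w) = w" "dist w x < e / C"
      using dense_approx by metis
    have "norm (\<Sum>k\<in>K. f k *\<^sub>R P k x) < e" if K: "finite K" "K \<inter> J = {}" for K
    proof -
      have "P k w = 0" if "k \<in> K" for k
        by (subst J(2)[symmetric]) (use that K J(1) in \<open>auto simp: P_linear P_P\<close>)
      then have "(\<Sum>k\<in>K. f k *\<^sub>R P k x) = (\<Sum>k\<in>K. f k *\<^sub>R P k (x - w))"
        by (simp add: P_linear)
      also have "norm \<dots> \<le> C * norm (x - w)"
        using C K(1) by (intro norm_finite_multiplier) auto
      also have "\<dots> < e" using J(3) C(1) by (simp add: dist_norm norm_minus_commute field_simps)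
      finally show ?thesis .
    qed
    then show "\<exists>J. finite J \<and> (\<forall>K. finite K \<and> K \<inter> J = {} \<longrightarrow> norm (\<Sum>k\<in>K. f k *\<^sub>R P k x) < e)"
      using J(1) by blast
  qed
  then show ?thesis unfolding multiplier_def by (rule has_sum_infsum)
qed

lemma P_infsum:
  assumes "(y has_sum s) UNIV" "\<And>k. P k (y k) = y k"
  shows "P j s = y j"
proof -
  have "((\<lambda>k. P j (y k)) has_sum P j s) UNIV"
    using has_sum_bounded_linear[OF P_bounded assms(1)] by (simp add: o_def)
  moreover have "P j (y k) = (if k = j then y j else 0)" for k
    using P_P[of j k "y k"] assms(2) by auto
  moreover have "((\<lambda>k. if k = j then y j else 0) has_sum y j) UNIV"
    by (rule has_sum_finite_neutralI[of "{j}"]) auto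
  ultimately show ?thesis using has_sum_unique by fastforce
qed

lemma P_multiplier: "bounded (range f) \<Longrightarrow> P j (multiplier f x) = f j *\<^sub>R P j x"
  by (rule P_infsum[OF multiplier_has_sum]) (simp_all add: P_linear P_P)

lemma norm_multiplier:
  assumes "\<And>k. \<bar>f k\<bar> \<le> C"
  shows "norm (multiplier f x) \<le> C * norm x"
proof (rule tendsto_upperbound)
  have "bounded (range f)" using assms by (auto simp: bounded_iff)
  from multiplier_has_sum[OF this, of x]
  show "((\<lambda>K. norm (\<Sum>k\<in>K. f k *\<^sub>R P k x)) \<longlongrightarrow> norm (multiplier f x)) (finite_subsets_at_top UNIV)"
    unfolding has_sum_def by (rule tendsto_norm)
  have "0 \<le> C" using assms[of 0] by linarith
  then show "eventually (\<lambda>K. norm (\<Sum>k\<in>K. f k *\<^sub>R P k x) \<le> C * norm x) (finite_subsets_at_top UNIV)"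
    using assms by (intro eventually_finite_subsets_at_top_weakI norm_finite_multiplier) auto
qed simp

lemma multiplier_adjoint:
  assumes "bounded (range f)"
  shows "adjoint_pair ip (multiplier f) (multiplier f)"
  unfolding adjoint_pair_def
proof safe
  fix x y
  have "((\<lambda>k. ip (f k *\<^sub>R P k x) y) has_sum ip (multiplier f x) y) UNIV"
    using has_sum_bounded_linear[OF ip.bounded_linear_left multiplier_has_sum[OF assms]]
    by (simp add: o_def)
  moreover have "((\<lambda>k. ip x (f k *\<^sub>R P k y)) has_sum ip x (multiplier f y)) UNIV"
    using has_sum_bounded_linear[OF ip.bounded_linear_right multiplier_has_sum[OF assms]]
    by (simp add: o_def)
  ultimately show "ip (multiplier f x) y = ip x (multiplier f y)"
    using has_sum_unique by (simp add: ip_scaleR adjoint_pairD(1)[OF P_sym]) blast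
qed

lemma bounded_linear_multiplier:
  assumes "bounded (range f)"
  shows "bounded_linear (multiplier f)"
proof -
  obtain C where "\<And>k. \<bar>f k\<bar> \<le> C" using assms by (auto simp: bounded_iff)
  then have "norm (multiplier f x) \<le> C * norm x" for x by (rule norm_multiplier)
  then show ?thesis
    by (intro bounded_linear_intro[of _ C])
       (simp_all add: adjoint_pair_linear[OF multiplier_adjoint[OF assms]] mult.commute)
qed

lemma multiplier_multiplier:
  assumes "bounded (range f)" "bounded (range g)" "bounded (range (\<lambda>k. f k * g k))"
  shows "multiplier f (multiplier g x) = multiplier (\<lambda>k. f k * g k) x"
  by (rule P_ext) (simp add: P_multiplier assms)

text \<open>Only finitely many degrees satisfy \<open>e / B \<le> \<bar>f k\<bar>\<close>, where B
  bounds \<open>A\<close>. The remaining part of f(D) has norm at most e / B.\<close>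

lemma multiplier_compact:
  assumes A: "adjoint_pair ip A A'" "bounded_linear A"
    and cpt: "\<And>k. compact_endomorphism act ip (\<lambda>x. A (P k x))"
    and f: "\<And>e. e > 0 \<Longrightarrow> finite {k. e \<le> \<bar>f k\<bar>}"
  shows "compact_endomorphism act ip (\<lambda>x. A (multiplier f x))"
proof (rule compact_limit)
  have "f ` UNIV \<subseteq> f ` {k. 1 \<le> \<bar>f k\<bar>} \<union> {-1..1}" by auto
  moreover have "bounded (f ` {k. 1 \<le> \<bar>f k\<bar>} \<union> {-1..1})"
    unfolding bounded_Un by (intro conjI finite_imp_bounded finite_imageI f bounded_closed_interval) simp
  ultimately have bdd: "bounded (range f)" by (rule bounded_subset[rotated])
  show "bounded_linear (\<lambda>x. A (multiplier f x))"
    using bounded_linear_compose[OF A(2) bounded_linear_multiplier[OF bdd]] .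
  obtain B where B: "B > 0" "\<And>x. norm (A x) \<le> norm x * B"
    using bounded_linear.pos_bounded[OF A(2)] by blast
  fix e :: real assume e: "e > 0"
  define J where "J = {k. e / B \<le> \<bar>f k\<bar>}"
  have J: "finite J" unfolding J_def using e B by (intro f) auto
  define S where "S x = (\<Sum>k\<in>J. f k *\<^sub>R A (P k x))" for x
  have "compact_endomorphism act ip S" unfolding S_def
    by (intro compact_sum compact_scaleR cpt)
  moreover have "norm (A (multiplier f x) - S x) \<le> e * norm x" for x
  proof -
    define g where "g k = (if k \<in> J then 0 else f k)" for k
    have g: "\<bar>g k\<bar> \<le> e / B" for k using e B by (auto simp: g_def J_def)
    then have gb: "bounded (range g)" by (auto simp: bounded_iff)
    have "multiplier g x = multiplier f x - (\<Sum>k\<in>J. f k *\<^sub>R P k x)"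
    proof (rule P_ext)
      fix i
      have "(\<Sum>k\<in>J. f k *\<^sub>R P i (P k x)) = (\<Sum>k\<in>J. if k = i then f i *\<^sub>R P i x else 0)"
        by (intro sum.cong) (auto simp: P_P)
      also have "\<dots> = (if i \<in> J then f i *\<^sub>R P i x else 0)" using J by simp
      finally show "P i (multiplier g x) = P i (multiplier f x - (\<Sum>k\<in>J. f k *\<^sub>R P k x))"
        by (simp add: P_multiplier[OF gb] P_multiplier[OF bdd] P_linear g_def)
    qed
    then have "A (multiplier f x) - S x = A (multiplier g x)"
      using linear_diff linear_sum linear_scale bounded_linear.linear[OF A(2)]
      by (simp add: S_def linear_diff[OF bounded_linear.linear[OF A(2)]]
          linear_sum[OF bounded_linear.linear[OF A(2)]] linear_scale[OF bounded_linear.linear[OF A(2)]])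
    then have "norm (A (multiplier f x) - S x) \<le> norm (multiplier g x) * B" using B(2) by simp
    also have "\<dots> \<le> (e / B * norm x) * B"
      using B(1) by (intro mult_right_mono norm_multiplier g) auto
    finally show ?thesis using B(1) by simp
  qed
  ultimately show "\<exists>S. compact_endomorphism act ip S
      \<and> (\<forall>x. norm (A (multiplier f x) - S x) \<le> e * norm x)" by blast
qed

subsection \<open>The number operator\<close>

abbreviation "dom_N \<equiv> {x. (\<lambda>k. (real_of_int k)\<^sup>2 *\<^sub>R ip (P k x) (P k x)) summable_on UNIV}"

abbreviation "N \<equiv> multiplier real_of_int"

text \<open>By orthogonality, the squared norm of a finite sum of the k P_k x is the norm of the sum
  of the k^2 (x_k | x_k). The two Cauchy criteria thus correspond, with \<open>e\<close> replaced by
  \<open>e\<^sup>2\<close>.\<close>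

lemma dom_N_iff: "x \<in> dom_N \<longleftrightarrow> (\<lambda>k. real_of_int k *\<^sub>R P k x) summable_on UNIV"
proof -
  have *: "(norm (\<Sum>k\<in>K. real_of_int k *\<^sub>R P k x))\<^sup>2
      = norm (\<Sum>k\<in>K. (real_of_int k)\<^sup>2 *\<^sub>R ip (P k x) (P k x))" if "finite K" for K
    using that by (subst norm_ip_self[symmetric], subst ip_orthogonal_sum)
      (simp_all add: P_linear P_P ip_scaleR power2_eq_square)
  have sq: "a < e \<longleftrightarrow> a\<^sup>2 < e\<^sup>2" if "a \<ge> 0" "e > 0" for a e :: real
    using that power_strict_mono[of a e 2] power2_less_imp_less[of a e] by auto
  have **: "norm (\<Sum>k\<in>K. real_of_int k *\<^sub>R P k x) < e \<longleftrightarrow>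
      norm (\<Sum>k\<in>K. (real_of_int k)\<^sup>2 *\<^sub>R ip (P k x) (P k x)) < e\<^sup>2" if "finite K" "e > 0" for K e
    unfolding *[OF that(1), symmetric] by (rule sq) (simp_all add: that(2))
  have equiv: "(\<forall>e>0. \<exists>J. finite J \<and> (\<forall>K. finite K \<and> K \<inter> J = {} \<longrightarrow> a K < e)) \<longleftrightarrow>
      (\<forall>e>0. \<exists>J. finite J \<and> (\<forall>K. finite K \<and> K \<inter> J = {} \<longrightarrow> b K < e))"
    if ab: "\<And>K e. finite K \<Longrightarrow> e > 0 \<Longrightarrow> a K < e \<longleftrightarrow> b K < e\<^sup>2"
    for a b :: "int set \<Rightarrow> real"
  proof (intro iffI allI impI)
    fix e :: real assume e: "e > 0"
      and "\<forall>e>0. \<exists>J. finite J \<and> (\<forall>K. finite K \<and> K \<inter> J = {} \<longrightarrow> a K < e)"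
    from this(2)[rule_format, of "sqrt e"] e
    show "\<exists>J. finite J \<and> (\<forall>K. finite K \<and> K \<inter> J = {} \<longrightarrow> b K < e)"
      using ab[of _ "sqrt e"] by auto
  next
    fix e :: real assume e: "e > 0"
      and "\<forall>e>0. \<exists>J. finite J \<and> (\<forall>K. finite K \<and> K \<inter> J = {} \<longrightarrow> b K < e)"
    from this(2)[rule_format, of "e\<^sup>2"] e
    show "\<exists>J. finite J \<and> (\<forall>K. finite K \<and> K \<inter> J = {} \<longrightarrow> a K < e)"
      using ab[of _ e] by auto
  qed
  show ?thesis unfolding mem_Collect_eq summable_on_iff_Cauchy
    by (rule equiv[symmetric]) (rule **)
qed

lemma P_N: "x \<in> dom_N \<Longrightarrow> P j (N x) = real_of_int j *\<^sub>R P j x"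
  unfolding dom_N_iff multiplier_def
  by (rule P_infsum[OF has_sum_infsum]) (simp_all add: P_linear P_P)

lemma N_multiplier:
  assumes f: "bounded (range f)" and kf: "bounded (range (\<lambda>k. real_of_int k * f k))"
  shows "multiplier f x \<in> dom_N" "N (multiplier f x) = multiplier (\<lambda>k. real_of_int k * f k) x"
proof -
  have "(\<lambda>k. (real_of_int k * f k) *\<^sub>R P k x) summable_on UNIV"
    using multiplier_has_sum[OF kf] by (auto simp: summable_on_def)
  then show dom: "multiplier f x \<in> dom_N" unfolding dom_N_iff by (simp add: P_multiplier f)
  show "N (multiplier f x) = multiplier (\<lambda>k. real_of_int k * f k) x"
    by (rule P_ext) (simp only: P_N[OF dom] P_multiplier[OF f] P_multiplier[OF kf] scaleR_scaleR)
qed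

lemma bounded_range_intro: "(\<And>k. \<bar>f k\<bar> \<le> C) \<Longrightarrow> bounded (range f)" for f :: "int \<Rightarrow> real"
  by (auto simp: bounded_iff)

text \<open>The functions belong to (1 + D^2)^-1, its products with D and D^2, (1 + D^2)^(-1/2), V
  and (1 + D^2)^(-1/4). The last one witnesses positivity of the square root.\<close>

lemma resolvent_bounds:
  fixes k :: int
  shows "\<bar>1 / (1 + (real_of_int k)\<^sup>2)\<bar> \<le> 1" "\<bar>real_of_int k * (1 / (1 + (real_of_int k)\<^sup>2))\<bar> \<le> 1"
    "\<bar>real_of_int k * (real_of_int k * (1 / (1 + (real_of_int k)\<^sup>2)))\<bar> \<le> 1"
    "\<bar>1 / sqrt (1 + (real_of_int k)\<^sup>2)\<bar> \<le> 1" "\<bar>real_of_int k * (1 / sqrt (1 + (real_of_int k)\<^sup>2))\<bar> \<le> 1"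
    "\<bar>1 / sqrt (sqrt (1 + (real_of_int k)\<^sup>2))\<bar> \<le> 1"
proof -
  have *: "\<bar>r\<bar> \<le> sqrt (1 + r\<^sup>2)" for r :: real by (rule real_le_rsqrt) simp
  have "\<bar>r\<bar> \<le> 1 + r\<^sup>2" for r :: real
    using sum_squares_bound[of 1 "\<bar>r\<bar>"] zero_le_power2[of r] by (simp add: power2_abs)
  then show "\<bar>real_of_int k * (1 / (1 + (real_of_int k)\<^sup>2))\<bar> \<le> 1"
    by (simp add: abs_mult divide_le_eq add_pos_nonneg)
  show "\<bar>real_of_int k * (1 / sqrt (1 + (real_of_int k)\<^sup>2))\<bar> \<le> 1"
    using *[of "real_of_int k"] by (simp add: abs_mult divide_le_eq add_pos_nonneg)
qed (simp_all add: divide_le_eq add_pos_nonneg power2_eq_square abs_mult)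

lemma resolvent_bounded:
  "bounded (range (\<lambda>k. 1 / (1 + (real_of_int k)\<^sup>2)))"
  "bounded (range (\<lambda>k. real_of_int k * (1 / (1 + (real_of_int k)\<^sup>2))))"
  "bounded (range (\<lambda>k. real_of_int k * (real_of_int k * (1 / (1 + (real_of_int k)\<^sup>2)))))"
  "bounded (range (\<lambda>k. 1 / sqrt (1 + (real_of_int k)\<^sup>2)))"
  "bounded (range (\<lambda>k. real_of_int k * (1 / sqrt (1 + (real_of_int k)\<^sup>2))))"
  "bounded (range (\<lambda>k. 1 / sqrt (sqrt (1 + (real_of_int k)\<^sup>2))))"
  by (rule bounded_range_intro, rule resolvent_bounds)+

text \<open>In degree k the equation reads (1 + k^2) x_k = y_k and has a unique solution. The bounds
  on k / (1 + k^2) and k^2 / (1 + k^2) put the solution into the domain of D^2.\<close>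

lemma inv_one_plus_square_N:
  "inv_one_plus_square dom_N N = multiplier (\<lambda>k. 1 / (1 + (real_of_int k)\<^sup>2))" (is "_ = ?T")
proof
  fix y
  have N1: "?T y \<in> dom_N" "N (?T y) = multiplier (\<lambda>k. real_of_int k * (1 / (1 + (real_of_int k)\<^sup>2))) y"
    by (rule N_multiplier; rule resolvent_bounded)+
  have N2: "N (?T y) \<in> dom_N"
    unfolding N1(2) by (rule N_multiplier; rule resolvent_bounded)
  have eq: "x + N (N x) = y \<longleftrightarrow> x = ?T y" if x: "x \<in> dom_N" "N x \<in> dom_N" for x
  proof -
    have P1: "P k (x + N (N x)) = (1 + (real_of_int k)\<^sup>2) *\<^sub>R P k x" for k
      using P_N[OF x(1)] P_N[OF x(2)] by (simp add: P_linear algebra_simps power2_eq_square)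
    have pos: "1 + (real_of_int k)\<^sup>2 \<noteq> 0" for k
      by (metis add.commute add_pos_nonneg less_irrefl zero_le_power2 zero_less_one)
    have "x + N (N x) = y \<longleftrightarrow> (\<forall>k. (1 + (real_of_int k)\<^sup>2) *\<^sub>R P k x = P k y)"
      by (simp only: P_ext_iff[of "x + N (N x)" y] P1)
    also have "\<dots> \<longleftrightarrow> (\<forall>k. P k x = (1 / (1 + (real_of_int k)\<^sup>2)) *\<^sub>R P k y)"
    proof -
      have "a *\<^sub>R u = v \<longleftrightarrow> u = (1 / a) *\<^sub>R v" if "a \<noteq> 0" for a and u v :: 'x
        using that by auto
      from this[OF pos] show ?thesis by (simp only:)
    qed
    also have "\<dots> \<longleftrightarrow> x = ?T y"
      by (simp only: P_ext_iff[of x "?T y"] P_multiplier[OF resolvent_bounded(1)])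
    finally show ?thesis .
  qed
  show "inv_one_plus_square dom_N N y = ?T y"
    unfolding inv_one_plus_square_def using N1(1) N2 eq by (intro the_equality) blast+
qed

text \<open>Existence: the fourth root is self-adjoint and its square is \<open>?Q\<close>.
  Uniqueness: for a competitor Q and the expected value c in degree k, w = (Q - c) P_k x satisfies Q
  w = -c w, so (R w | R w) = -c (w | w) is both positive and negative.\<close>

lemma positive_sqrt_resolvent:
  "positive_sqrt ip (multiplier (\<lambda>k. 1 / (1 + (real_of_int k)\<^sup>2)))
    = multiplier (\<lambda>k. 1 / sqrt (1 + (real_of_int k)\<^sup>2))" (is "positive_sqrt ip ?T = ?Q")
  unfolding positive_sqrt_def
proof (rule the_equality)
  let ?R = "multiplier (\<lambda>k. 1 / sqrt (sqrt (1 + (real_of_int k)\<^sup>2)))"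
  have pos: "sqrt (1 + r\<^sup>2) > 0" for r :: real
    by (simp add: add_pos_nonneg)
  have "?Q = ?R \<circ> ?R"
  proof
    fix x
    have "(\<lambda>k. 1 / sqrt (sqrt (1 + (real_of_int k)\<^sup>2)) * (1 / sqrt (sqrt (1 + (real_of_int k)\<^sup>2))))
        = (\<lambda>k. 1 / sqrt (1 + (real_of_int k)\<^sup>2))"
      using pos by (auto simp: less_imp_le)
    then show "?Q x = (?R \<circ> ?R) x"
      using multiplier_multiplier[OF resolvent_bounded(6) resolvent_bounded(6), of x]
        resolvent_bounded(4) by simp
  qed
  moreover have "?Q \<circ> ?Q = ?T"
  proof
    fix x
    have "(\<lambda>k. 1 / sqrt (1 + (real_of_int k)\<^sup>2) * (1 / sqrt (1 + (real_of_int k)\<^sup>2)))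
        = (\<lambda>k. 1 / (1 + (real_of_int k)\<^sup>2))"
      by (auto simp: add_nonneg_nonneg)
    then show "(?Q \<circ> ?Q) x = ?T x"
      using multiplier_multiplier[OF resolvent_bounded(4) resolvent_bounded(4), of x]
        resolvent_bounded(1) by simp
  qed
  ultimately show "(\<exists>P P'. adjoint_pair ip P P' \<and> ?Q = P' \<circ> P) \<and> ?Q \<circ> ?Q = ?T"
    using multiplier_adjoint[OF resolvent_bounded(6)] by blast
next
  fix Q assume "(\<exists>P P'. adjoint_pair ip P P' \<and> Q = P' \<circ> P) \<and> Q \<circ> Q = ?T"
  then obtain R R' where R: "adjoint_pair ip R R'" and Q: "Q = R' \<circ> R" and QQ: "Q \<circ> Q = ?T" by blast
  have Q_adj: "adjoint_pair ip Q Q"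
    unfolding adjoint_pair_def Q comp_apply
    using adjoint_pairD(1)[OF R] adjoint_pairD(1)[OF adjoint_pair_swap[OF R]] by metis
  have on_P: "Q (P k x) = (1 / sqrt (1 + (real_of_int k)\<^sup>2)) *\<^sub>R P k x" for k x
  proof -
    define c where "c = 1 / sqrt (1 + (real_of_int k)\<^sup>2)"
    have c: "c > 0" "c * c = 1 / (1 + (real_of_int k)\<^sup>2)"
      by (simp_all add: c_def add_pos_nonneg)
    define w where "w = Q (P k x) - c *\<^sub>R P k x"
    have "?T (P k x) = (c * c) *\<^sub>R P k x"
      unfolding c(2) by (rule P_ext) (simp add: P_multiplier[OF resolvent_bounded(1)] P_linear P_P)
    then have "Q (Q (P k x)) = (c * c) *\<^sub>R P k x" using QQ by (metis comp_apply)
    then have "Q w = - (c *\<^sub>R w)"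
      by (simp add: w_def adjoint_pair_diff[OF Q_adj] adjoint_pair_linear[OF Q_adj] algebra_simps)
    then have "ip (R w) (R w) = - (c *\<^sub>R ip w w)"
      by (metis Q adjoint_pairD(1)[OF R] comp_apply ip_minus(1) ip_scaleR(1))
    then have "cpos (- (c *\<^sub>R ip w w))" using cpos_ip by metis
    moreover have "cpos (c *\<^sub>R ip w w)" using c by (intro cpos_scaleR cpos_ip) auto
    ultimately have "c *\<^sub>R ip w w = 0" by (intro cpos_antisym)
    then have "w = 0" using c(1) by (intro ip_self_eq_0) simp
    then show ?thesis by (simp add: w_def c_def)
  qed
  show "Q = ?Q"
  proof (rule ext, rule P_ext)
    fix x k
    show "P k (Q x) = P k (?Q x)"
    \<comment> \<open>Continuity of \<open>Q\<close> has not been established, so its values on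
      homogeneous elements are not extended by density; self-adjointness moves \<open>Q\<close> and
      \<open>P k\<close> onto the test vector instead.\<close>
    proof (rule ip_ext)
      fix z
      have "ip z (P k (Q x)) = ip (P k z) (Q x)" by (rule adjoint_pairD(1)[OF P_sym, symmetric])
      also have "\<dots> = ip (Q (P k z)) x" by (rule adjoint_pairD(1)[OF Q_adj, symmetric])
      also have "\<dots> = (1 / sqrt (1 + (real_of_int k)\<^sup>2)) *\<^sub>R ip (P k z) x"
        by (simp only: on_P ip_scaleR)
      also have "ip (P k z) x = ip z (P k x)" by (rule adjoint_pairD(1)[OF P_sym])
      finally show "ip z (P k (Q x)) = ip z (P k (?Q x))"
        by (simp only: P_multiplier[OF resolvent_bounded(4)] ip_scaleR)
    qed
  qed
qed

lemma bounded_transform_N: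
  "bounded_transform ip dom_N N = multiplier (\<lambda>k. real_of_int k / sqrt (1 + (real_of_int k)\<^sup>2))"
proof
  fix x
  show "bounded_transform ip dom_N N x = multiplier (\<lambda>k. real_of_int k / sqrt (1 + (real_of_int k)\<^sup>2)) x"
    using N_multiplier(2)[OF resolvent_bounded(4,5), of x]
    by (simp add: bounded_transform_def inv_one_plus_square_N positive_sqrt_resolvent)
qed

end

section \<open>Cuntz-Krieger families\<close>

lemma cstar_of_type_simps [simp]:
  "carrier cstar_of_type = UNIV" "mult cstar_of_type = (*)" "zero cstar_of_type = 0"
  "add cstar_of_type = (+)" "smult cstar_of_type = scaleC" "adj cstar_of_type = star"
  "nrm cstar_of_type = norm"
  by (simp_all add: cstar_of_type_def)

lemma finsum_cstar_of_type:
  fixes f :: "'i \<Rightarrow> 'a::cstar_algebra"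
  assumes "finite A"
  shows "finsum cstar_of_type f A = sum f A"
proof -
  have "Module.module (ring_of_type_algebra :: complex ring) (cstar_of_type :: 'a cstar)"
    using cstar_structure_of_type[where 'a='a] by (simp add: cstar_structure_def)
  then interpret abelian_group "cstar_of_type :: 'a cstar" by (rule Module.module.axioms)
  show ?thesis using assms
    by (induction A rule: finite_induct) (simp_all add: finsum_insert)
qed

lemma closure_span_image:
  assumes g: "bounded_linear g" and W: "\<And>w. w \<in> W \<Longrightarrow> g w \<in> closure (span V)"
    and x: "x \<in> closure (span W)"
  shows "g x \<in> closure (span V)"
proof -
  let ?T = "g -` closure (span V)"
  have "closed ?T"
    by (intro continuous_closed_vimage closed_closure bounded_linear.isCont[OF g] ballI allI)
       (simp add: linear_continuous_at g)
  moreover have "subspace ?T"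
    by (intro linear_subspace_vimage bounded_linear.linear[OF g] subspace_closure subspace_span)
  ultimately have "closure (span W) \<subseteq> ?T"
    using W by (intro closure_minimal span_minimal) auto
  then show ?thesis using x by blast
qed

locale graph_cstar = wf_digraph E
  for E :: "('v, 'e) pre_digraph" +
  fixes p :: "'v \<Rightarrow> 'a::cstar_algebra" and S :: "'e \<Rightarrow> 'a"
  assumes countable_graph: "countable (verts E)" "countable (arcs E)"
    and loc_fin: "locally_finite_digraph E"
    and no_src: "no_sources E"
    and CK: "CK_family E cstar_of_type p S"
    and generated: "closed_star_subalgebra C \<Longrightarrow> p ` verts E \<subseteq> C \<Longrightarrow> S ` arcs E \<subseteq> C \<Longrightarrow> C = UNIV"
begin

lemma p_simps:
  "v \<in> verts E \<Longrightarrow> star (p v) = p v" "v \<in> verts E \<Longrightarrow> p v * p v = p v"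
  "v \<in> verts E \<Longrightarrow> w \<in> verts E \<Longrightarrow> v \<noteq> w \<Longrightarrow> p v * p w = 0"
  using CK by (simp_all add: CK_family_def)

lemma S_simps:
  "e \<in> arcs E \<Longrightarrow> S e * star (S e) * S e = S e"
  "e \<in> arcs E \<Longrightarrow> star (S e) * S e = p (head E e)"
  using CK by (simp_all add: CK_family_def)

lemma finite_out_arcs: "v \<in> verts E \<Longrightarrow> finite (out_arcs E v)"
  using loc_fin by (simp add: locally_finite_digraph_def)

lemma p_eq_sum:
  assumes "v \<in> verts E" "out_arcs E v \<noteq> {}"
  shows "p v = (\<Sum>e\<in>out_arcs E v. S e * star (S e))"
  using CK assms by (simp add: CK_family_def finsum_cstar_of_type finite_out_arcs)

lemma S_head: "e \<in> arcs E \<Longrightarrow> S e * p (head E e) = S e"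
  by (metis S_simps mult.assoc)

text \<open>Positivity applies to \<open>0 = (1 - p\<^sub>v) p\<^sub>v (1 - p\<^sub>v) = \<Sum> (1 - p\<^sub>v) S\<^sub>j S\<^sub>j\<^sup>* (1 - p\<^sub>v)\<close>.\<close>

lemma S_tail:
  assumes e: "e \<in> arcs E"
  shows "p (tail E e) * S e = S e"
proof -
  define v where "v = tail E e"
  have v: "v \<in> verts E" "e \<in> out_arcs E v" using e by (auto simp: v_def)
  define c where "c j = star (S j) - star (S j) * p v" for j
  have c: "star (c j) * c j = S j * star (S j) - (S j * star (S j)) * p v
      - p v * (S j * star (S j)) + p v * (S j * star (S j)) * p v" for j
    using v by (simp add: c_def star_simps p_simps algebra_simps)
  have "(\<Sum>j\<in>out_arcs E v. star (c j) * c j) = p v - p v * p v - p v * p v + p v * p v * p v"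
    unfolding c using p_eq_sum[OF v(1)] v(2)
    by (simp add: sum.distrib sum_subtractf flip: sum_distrib_left sum_distrib_right) fastforce
  also have "\<dots> = 0" using v by (simp add: p_simps)
  finally have "c e = 0" by (rule sum_star_mult_eq_0) (use v finite_out_arcs in auto)
  then have "star (c e) = 0" by simp
  then show ?thesis using v by (simp add: c_def star_simps p_simps v_def)
qed

lemma S_star_tail: "e \<in> arcs E \<Longrightarrow> star (S e) * p (tail E e) = star (S e)"
  using arg_cong[OF S_tail, of e star] by (simp add: star_mult p_simps)

lemma S_star_head: "e \<in> arcs E \<Longrightarrow> p (head E e) * star (S e) = star (S e)"
  using arg_cong[OF S_head, of e star] by (simp add: star_mult p_simps)

text \<open>For distinct sources the vertex projections separate the edges. For a common source v,
  inserting p_v = sum of the S_j S_j* between S_f* and S_f changes nothing, and the term j = f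
  already gives the total; the other positive terms sum to 0.\<close>

lemma S_orthogonal:
  assumes e: "e \<in> arcs E" and f: "f \<in> arcs E" and "e \<noteq> f"
  shows "star (S e) * S f = 0"
proof (cases "tail E e = tail E f")
  case False
  have "star (S e) * S f = (star (S e) * p (tail E e)) * (p (tail E f) * S f)"
    by (simp only: S_star_tail[OF e] S_tail[OF f])
  also have "\<dots> = star (S e) * (p (tail E e) * p (tail E f)) * S f" by (simp only: mult.assoc)
  finally show ?thesis using e f False by (simp add: p_simps)
next
  case True
  define v where "v = tail E e"
  have v: "v \<in> verts E" "e \<in> out_arcs E v" "f \<in> out_arcs E v" using e f True by (auto simp: v_def)
  define c where "c j = star (S j) * S f" for j
  have fin: "finite (out_arcs E v)" using v by (simp add: finite_out_arcs)
  have c: "star (c j) * c j = star (S f) * ((S j * star (S j)) * S f)" for j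
    by (simp add: c_def star_simps mult.assoc)
  have "(\<Sum>j\<in>out_arcs E v. star (c j) * c j) = star (S f) * (p v * S f)"
    unfolding c using p_eq_sum[OF v(1)] v(2)
    by (simp flip: sum_distrib_left sum_distrib_right) fastforce
  also have "\<dots> = star (c f) * c f"
    using f True by (simp add: c_def S_tail S_simps v_def p_simps)
  finally have "(\<Sum>j\<in>out_arcs E v - {f}. star (c j) * c j) = 0"
    using sum.remove[OF fin v(3), of "\<lambda>j. star (c j) * c j"] by simp
  then have "c e = 0" by (rule sum_star_mult_eq_0) (use v fin \<open>e \<noteq> f\<close> in auto)
  then show ?thesis by (simp add: c_def)
qed

subsection \<open>Words in the generators\<close>

inductive letter :: "int \<Rightarrow> 'a \<Rightarrow> bool" where
  letter_p: "v \<in> verts E \<Longrightarrow> letter 0 (p v)"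
| letter_S: "e \<in> arcs E \<Longrightarrow> letter 1 (S e)"
| letter_S_star: "e \<in> arcs E \<Longrightarrow> letter (- 1) (star (S e))"

text \<open>Arbitrary products of generators are closed under multiplication and adjoints without a
  normal form S_\<mu> S_\<nu>*. The degree is only a relation: a vanishing product may be a word of
  several degrees.\<close>

inductive word :: "int \<Rightarrow> 'a \<Rightarrow> bool" where
  word_letter: "letter k a \<Longrightarrow> word k a"
| word_Cons: "letter k a \<Longrightarrow> word l b \<Longrightarrow> word (k + l) (a * b)"

lemma word_mult: "word k a \<Longrightarrow> word l b \<Longrightarrow> word (k + l) (a * b)"
  by (induction rule: word.induct) (auto intro: word_Cons simp: mult.assoc add.assoc)

lemma letter_star: "letter k a \<Longrightarrow> letter (- k) (star a)"
  by (induction rule: letter.induct)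
     (use letter.intros in \<open>auto simp: p_simps star_star\<close>)

lemma word_star: "word k a \<Longrightarrow> word (- k) (star a)"
proof (induction rule: word.induct)
  case (word_Cons k a l b)
  then have "word (- l + - k) (star b * star a)"
    by (intro word_mult) (auto intro: word_letter letter_star)
  moreover have "- l + - k = - (k + l)" by simp
  ultimately show ?case by (simp only: star_mult)
qed (auto intro: word_letter letter_star)

lemma letter_right: "letter k a \<Longrightarrow> \<exists>v\<in>verts E. a * p v = a"
proof (induction rule: letter.induct)
  case (letter_p v) then show ?case by (intro bexI[of _ v]) (simp_all add: p_simps)
next
  case (letter_S e) then show ?case by (intro bexI[of _ "head E e"]) (simp_all add: S_head)
next
  case (letter_S_star e) then show ?case by (intro bexI[of _ "tail E e"]) (simp_all add: S_star_tail)
qed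

text \<open>The last letter absorbs a vertex projection. In the absence of a unit, this reduces
  compactness statements about words to statements about \<open>p v\<close>.\<close>

lemma word_right: "word k a \<Longrightarrow> \<exists>v\<in>verts E. a * p v = a"
proof (induction rule: word.induct)
  case (word_Cons k a l b)
  then obtain v where v: "v \<in> verts E" "b * p v = b" by blast
  then show ?case by (intro bexI[of _ v]) (simp_all add: mult.assoc)
qed (rule letter_right)

text \<open>Words are products of finite lists over a countable alphabet. Their images will generate
  the module.\<close>

lemma countable_words: "countable {a. \<exists>k. word k a}"
proof -
  define L where "L = p ` verts E \<union> S ` arcs E \<union> (star \<circ> S) ` arcs E"
  have L: "a \<in> L" if "letter k a" for k a using that by cases (auto simp: L_def)
  have "\<exists>xs\<in>lists L. \<exists>x\<in>L. a = foldr (*) xs x" if "word k a" for k a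
    using that
  proof (induction rule: word.induct)
    case (word_letter k a)
    then show ?case using L by (auto intro!: bexI[of _ "[]"])
  next
    case (word_Cons k a l b)
    then obtain xs x where "xs \<in> lists L" "x \<in> L" "b = foldr (*) xs x" by blast
    then show ?case using L[OF word_Cons(1)]
      by (intro bexI[of _ "a # xs"] bexI[of _ x]) auto
  qed
  then have "{a. \<exists>k. word k a} \<subseteq> (\<lambda>(xs, x). foldr (*) xs x) ` (lists L \<times> L)" by force
  moreover have "countable L" using countable_graph by (simp add: L_def)
  ultimately show ?thesis by (metis countable_SIGMA countable_image countable_lists countable_subset)
qed

text \<open>\<open>backpath v n w a\<close>: \<open>a = S\<^sub>\<nu>\<^sup>*\<close> for a path \<open>\<nu>\<close> of length \<open>n\<close> from \<open>w\<close> to \<open>v\<close>.\<close>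

inductive backpath :: "'v \<Rightarrow> nat \<Rightarrow> 'v \<Rightarrow> 'a \<Rightarrow> bool" for v where
  backpath_0: "backpath v 0 v (p v)"
| backpath_Suc: "backpath v n (head E f) a \<Longrightarrow> f \<in> arcs E \<Longrightarrow> backpath v (Suc n) (tail E f) (a * star (S f))"

lemma backpath_end: "backpath v n w a \<Longrightarrow> v \<in> verts E \<Longrightarrow> w \<in> verts E \<and> a * p w = a"
  by (induction rule: backpath.induct) (auto simp: p_simps mult.assoc S_star_tail)

text \<open>In S_\<nu>* S_e either \<open>e\<close> is the first edge of \<nu> and cancels, or
  orthogonality gives 0. In length 0 the product p_v S_e vanishes because the sink emits no
  edge.\<close>

lemma backpath_S:
  assumes v: "v \<in> verts E" "out_arcs E v = {}" and e: "e \<in> arcs E" and b: "backpath v n w a"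
  shows "a * S e = 0 \<or> (\<exists>m. n = Suc m \<and> backpath v m (head E e) (a * S e))"
  using b
proof cases
  case backpath_0
  have "tail E e \<noteq> v" using v(2) e by (auto simp: out_arcs_def)
  then have "a * S e = 0" unfolding backpath_0 using v e
    by (subst S_tail[OF e, symmetric]) (simp add: p_simps flip: mult.assoc)
  then show ?thesis ..
next
  case (backpath_Suc m f a')
  show ?thesis
  proof (cases "e = f")
    case True
    then have "a * S e = a'" using backpath_end[OF backpath_Suc(4) v(1)] backpath_Suc e
      by (simp add: mult.assoc S_simps)
    then show ?thesis using backpath_Suc True by blast
  next
    case False
    then show ?thesis using S_orthogonal[of f e] backpath_Suc e by (simp add: mult.assoc)
  qed
qed

text \<open>When the word is absorbed letter by letter into S_\<nu>*, each \<open>S e\<close>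
  shortens the path and each adjoint lengthens it, unless the product vanishes. A degree above n
  would force a negative length. The goal is n = 0; general n carries the induction.\<close>

lemma sink_word:
  assumes v: "v \<in> verts E" "out_arcs E v = {}"
  shows "word k b \<Longrightarrow> backpath v n w a \<Longrightarrow> k > int n \<Longrightarrow> a * b = 0"
proof (induction arbitrary: n w a rule: word.induct)
  case (word_letter k b)
  from word_letter(1) show ?case
  proof cases
    case (letter_S e)
    then show ?thesis using backpath_S[OF v letter_S(3) word_letter(2)] word_letter(3) by auto
  qed (use word_letter(3) in auto)
next
  case (word_Cons k c l b)
  note w = backpath_end[OF word_Cons(4) v(1)]
  from word_Cons(1) show ?case
  proof cases
    case (letter_p u)
    have "a * c = a \<or> a * c = 0"
      using w letter_p p_simps(3)[of w u] by (cases "u = w") (metis mult.assoc mult_zero_right)+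
    then show ?thesis using word_Cons letter_p by (auto simp flip: mult.assoc)
  next
    case (letter_S e)
    from backpath_S[OF v letter_S(3) word_Cons(4)] show ?thesis
    proof
      assume "\<exists>m. n = Suc m \<and> backpath v m (head E e) (a * S e)"
      then obtain m where "n = Suc m" "backpath v m (head E e) (a * S e)" by blast
      then have "a * S e * b = 0" using word_Cons(5) letter_S by (intro word_Cons(3)) auto
      then show ?thesis using letter_S by (simp add: mult.assoc)
    qed (use letter_S in \<open>simp flip: mult.assoc\<close>)
  next
    case (letter_S_star e)
    show ?thesis
    proof (cases "head E e = w")
      case True
      then have "backpath v (Suc n) (tail E e) (a * star (S e))"
        using word_Cons(4) letter_S_star by (intro backpath_Suc) auto
      then have "a * star (S e) * b = 0" using word_Cons(5) letter_S_star by (intro word_Cons(3)) auto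
      then show ?thesis using letter_S_star by (simp add: mult.assoc)
    next
      case False
      have "a * star (S e) = (a * p w) * (p (head E e) * star (S e))"
        using w letter_S_star by (simp add: S_star_head)
      also have "\<dots> = a * (p w * p (head E e)) * star (S e)" by (simp only: mult.assoc)
      also have "\<dots> = 0" using w False letter_S_star by (simp add: p_simps)
      finally show ?thesis using letter_S_star by (simp flip: mult.assoc)
    qed
  qed
qed

text \<open>Scalar multiples are included since the spans below are real.\<close>

definition homogeneous :: "int \<Rightarrow> 'a \<Rightarrow> bool" where
  "homogeneous k a \<longleftrightarrow> (\<exists>c b. word k b \<and> a = c *\<^sub>C b)"

lemma word_homogeneous: "word k a \<Longrightarrow> homogeneous k a"
  unfolding homogeneous_def by (metis scaleC_one)

lemma p_homogeneous: "v \<in> verts E \<Longrightarrow> homogeneous 0 (p v)"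
  by (intro word_homogeneous word_letter letter_p)

lemma S_homogeneous: "e \<in> arcs E \<Longrightarrow> homogeneous 1 (S e)"
  by (intro word_homogeneous word_letter letter_S)

lemma homogeneous_mult: "homogeneous k a \<Longrightarrow> homogeneous l b \<Longrightarrow> homogeneous (k + l) (a * b)"
  unfolding homogeneous_def
  by (auto simp: scaleC_mult_left scaleC_mult_right scaleC_scaleC) (use word_mult in blast)

lemma homogeneous_star: "homogeneous k a \<Longrightarrow> homogeneous (- k) (star a)"
  unfolding homogeneous_def by (auto simp: star_scaleC) (use word_star in blast)

lemma homogeneous_scaleC: "homogeneous k a \<Longrightarrow> homogeneous k (c *\<^sub>C a)"
  unfolding homogeneous_def by (auto simp: scaleC_scaleC) blast

lemma homogeneous_right:
  assumes "homogeneous k a"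
  shows "\<exists>v\<in>verts E. a * p v = a"
proof -
  obtain c b where b: "word k b" "a = c *\<^sub>C b" using assms by (auto simp: homogeneous_def)
  then obtain v where "v \<in> verts E" "b * p v = b" using word_right by blast
  then show ?thesis by (intro bexI[of _ v]) (simp_all add: b(2) scaleC_mult_left)
qed

lemma homogeneous_sink:
  "v \<in> verts E \<Longrightarrow> out_arcs E v = {} \<Longrightarrow> homogeneous k a \<Longrightarrow> k > 0 \<Longrightarrow> p v * a = 0"
  unfolding homogeneous_def
  by (auto simp: scaleC_mult_right sink_word[OF _ _ _ backpath_0])

text \<open>The closed span of the homogeneous elements is a closed *-subalgebra containing the
  generators, hence everything. Closed linear conditions on the algebra are therefore checked on
  homogeneous elements only.\<close>

lemma homogeneous_closed:
  assumes T: "closed T" "subspace T" and hom: "\<And>k a. homogeneous k a \<Longrightarrow> a \<in> T"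
  shows "a \<in> T"
proof -
  define W where "W = {a. \<exists>k. homogeneous k a}"
  let ?C = "closure (span W)"
  have W: "a \<in> ?C" if "a \<in> W" for a using that closure_subset span_base by blast
  have WW: "w * x \<in> W" if "w \<in> W" "x \<in> W" for w x
    using that homogeneous_mult unfolding W_def by blast
  have W_star: "star w \<in> W" and W_scaleC: "c *\<^sub>C w \<in> W" if "w \<in> W" for c w
    using that homogeneous_star homogeneous_scaleC unfolding W_def by blast+
  have "p v \<in> W" if "v \<in> verts E" for v using p_homogeneous[OF that] unfolding W_def by blast
  moreover have "S e \<in> W" if "e \<in> arcs E" for e using S_homogeneous[OF that] unfolding W_def by blast
  ultimately have gens: "p ` verts E \<subseteq> ?C" "S ` arcs E \<subseteq> ?C" using W by auto
  have left: "w * x \<in> ?C" if "w \<in> W" "x \<in> ?C" for w x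
    using that(2) by (rule closure_span_image[OF bounded_linear_mult_right, rotated])
      (use that(1) in \<open>auto intro!: W WW\<close>)
  have mult: "x * y \<in> ?C" if "x \<in> ?C" "y \<in> ?C" for x y
    using that(1) by (rule closure_span_image[OF bounded_linear_mult_left, rotated])
      (use that(2) left in auto)
  have "closed_star_subalgebra ?C" unfolding closed_star_subalgebra_def
  proof (intro conjI ballI allI)
    show "x + y \<in> ?C" if "x \<in> ?C" "y \<in> ?C" for x y
      using that subspace_closure[OF subspace_span[of W]] by (auto intro: subspace_add)
    show "0 \<in> ?C" using subspace_closure[OF subspace_span[of W]] by (rule subspace_0)
    show "star x \<in> ?C" if "x \<in> ?C" for x
      using that by (rule closure_span_image[OF bounded_linear_star, rotated])
        (intro W W_star)
    show "c *\<^sub>C x \<in> ?C" if "x \<in> ?C" for c x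
      using that by (rule closure_span_image[OF bounded_linear_scaleC, rotated])
        (intro W W_scaleC)
  qed (use mult in auto)
  then have "?C = UNIV"
    using gens by (rule generated)
  moreover have "?C \<subseteq> T" using hom by (intro closure_minimal span_minimal T) (auto simp: W_def)
  ultimately show ?thesis by blast
qed

end

section \<open>The gauge action\<close>

text \<open>A contraction bound uniform in \<open>t\<close> turns convergence of points into uniform
  convergence of their orbits.\<close>

lemma closed_continuous_orbit:
  fixes T :: "'i::topological_space \<Rightarrow> 'b::real_normed_vector \<Rightarrow> 'c::real_normed_vector"
  assumes contr: "\<And>t x y. norm (T t x - T t y) \<le> norm (x - y)"
  shows "closed {x. continuous_on UNIV (\<lambda>t. T t x)}"
  unfolding closed_sequential_limits
proof safe
  fix x l assume x: "\<forall>n. x n \<in> {x. continuous_on UNIV (\<lambda>t. T t x)}" and l: "x \<longlonglongrightarrow> l"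
  show "continuous_on UNIV (\<lambda>t. T t l)"
  proof (rule uniform_limit_theorem[where F = sequentially])
    show "\<forall>\<^sub>F n in sequentially. continuous_on UNIV (\<lambda>t. T t (x n))" using x by simp
    show "uniform_limit UNIV (\<lambda>n t. T t (x n)) (\<lambda>t. T t l) sequentially"
      unfolding uniform_limit_iff
    proof safe
      fix e :: real assume "e > 0"
      with l have "eventually (\<lambda>n. dist (x n) l < e) sequentially" by (rule tendstoD)
      then show "eventually (\<lambda>n. \<forall>t\<in>UNIV. dist (T t (x n)) (T t l) < e) sequentially"
        by (rule eventually_mono) (use contr in \<open>auto simp: dist_norm intro: le_less_trans\<close>)
    qed
  qed simp
qed

definition circle_average :: "(real \<Rightarrow> 'b::banach) \<Rightarrow> 'b" where
  "circle_average f = (1 / (2 * pi)) *\<^sub>R integral {0..2 * pi} f"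

lemma circle_average_bounded_linear:
  fixes T :: "real \<Rightarrow> 'b::real_normed_vector \<Rightarrow> 'c::banach"
  assumes lin: "\<And>t. linear (T t)" and contr: "\<And>t x. norm (T t x) \<le> norm x"
    and cont: "\<And>x. continuous_on UNIV (\<lambda>t. T t x)"
  shows "bounded_linear (\<lambda>x. circle_average (\<lambda>t. T t x))"
    and "norm (circle_average (\<lambda>t. T t x)) \<le> norm x"
proof -
  have int: "(\<lambda>t. T t x) integrable_on {0..2 * pi}" for x
    by (intro integrable_continuous_interval continuous_on_subset[OF cont]) auto
  have bound: "norm (circle_average (\<lambda>t. T t x)) \<le> norm x" for x
  proof -
    have "norm (integral {0..2 * pi} (\<lambda>t. T t x)) \<le> norm x * (2 * pi - 0)"
      by (intro integral_bound continuous_on_subset[OF cont] contr) auto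
    then show ?thesis by (simp add: circle_average_def divide_le_eq)
  qed
  show "norm (circle_average (\<lambda>t. T t x)) \<le> norm x" by (rule bound)
  show "bounded_linear (\<lambda>x. circle_average (\<lambda>t. T t x))"
  proof (rule bounded_linear_intro[of _ 1])
    show "circle_average (\<lambda>t. T t (x + y)) = circle_average (\<lambda>t. T t x) + circle_average (\<lambda>t. T t y)" for x y
      unfolding circle_average_def linear_add[OF lin] integral_add[OF int int] scaleR_add_right ..
    show "circle_average (\<lambda>t. T t (r *\<^sub>R x)) = r *\<^sub>R circle_average (\<lambda>t. T t x)" for r x
      unfolding circle_average_def linear_scale[OF lin] integral_cmul by (simp add: mult.commute)
  qed (use bound in simp)
qed

lemma circle_average_character:
  "circle_average (\<lambda>t. cis (of_int k * t) *\<^sub>C a) = (if k = 0 then a else 0)" for a :: "'b::complex_banach"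
proof (cases "k = 0")
  case True
  then show ?thesis by (simp add: circle_average_def)
next
  case False
  have "((\<lambda>t. cis (of_int k * t)) has_integral
      (cis (of_int k * (2 * pi)) / (\<i> * of_int k) - cis (of_int k * 0) / (\<i> * of_int k))) {0..2 * pi}"
  proof (rule fundamental_theorem_of_calculus)
    fix t :: real
    have "((\<lambda>t. exp (\<i> * of_int k * complex_of_real t) / (\<i> * of_int k)) has_vector_derivative
        exp (\<i> * of_int k * complex_of_real t)) (at t within {0..2 * pi})"
      using False by (auto intro!: derivative_eq_intros has_vector_derivative_real_field)
    then show "((\<lambda>t. cis (of_int k * t) / (\<i> * of_int k)) has_vector_derivative cis (of_int k * t))
        (at t within {0..2 * pi})"
      by (simp add: cis_conv_exp mult.assoc)
  qed simp
  moreover have "cis (of_int k * (2 * pi)) = 1"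
    using cis_multiple_2pi[of "of_int k"] by (simp add: mult.commute)
  ultimately have "((\<lambda>t. cis (of_int k * t)) has_integral 0) {0..2 * pi}" by simp
  from has_integral_linear[OF this bounded_bilinear.bounded_linear_left[OF bounded_bilinear_scaleC, of a]]
  have "integral {0..2 * pi} (\<lambda>t. cis (of_int k * t) *\<^sub>C a) = 0"
    by (intro integral_unique) (simp add: o_def)
  then show ?thesis using False by (simp add: circle_average_def)
qed

locale gauge_graph = graph_cstar E p S
  for E :: "('v, 'e) pre_digraph" and p :: "'v \<Rightarrow> 'a::cstar_algebra" and S +
  fixes \<gamma> :: "complex \<Rightarrow> 'a \<Rightarrow> 'a"
  assumes gauge: "gauge_action E p S \<gamma>"
begin

lemma \<gamma>_hom: "cmod z = 1 \<Longrightarrow> star_hom cstar_of_type cstar_of_type (\<gamma> z)"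
  using gauge by (simp add: gauge_action_def)

lemmas \<gamma>_simps = star_hom_of_typeD[OF \<gamma>_hom]

lemma \<gamma>_linear: "cmod z = 1 \<Longrightarrow> linear (\<gamma> z)"
  by (intro linearI) (simp_all add: \<gamma>_simps scaleR_scaleC)

lemma \<gamma>_contractive: "cmod z = 1 \<Longrightarrow> norm (\<gamma> z a) \<le> norm a"
  by (rule star_hom_contractive[OF \<gamma>_hom])

lemma \<gamma>_letter:
  assumes "letter k a" and z: "cmod z = 1"
  shows "\<gamma> z a = (z powi k) *\<^sub>C a"
  using assms(1)
proof cases
  case (letter_p v) then show ?thesis using gauge z by (simp add: gauge_action_def)
next
  case (letter_S e) then show ?thesis using gauge z by (simp add: gauge_action_def)
next
  case (letter_S_star e)
  have "z * cnj z = 1" using z by (metis complex_norm_square of_real_1 one_power2)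
  then have "cnj z = inverse z" by (rule inverse_unique[symmetric])
  moreover have "\<gamma> z (S e) = z *\<^sub>C S e" using gauge z letter_S_star by (simp add: gauge_action_def)
  ultimately show ?thesis using z letter_S_star by (simp add: \<gamma>_simps star_scaleC power_int_minus)
qed

lemma \<gamma>_homogeneous:
  assumes "homogeneous k a" and z: "cmod z = 1"
  shows "\<gamma> z a = (z powi k) *\<^sub>C a"
proof -
  have "\<gamma> z b = (z powi k) *\<^sub>C b" if "word k b" for b
    using that
  proof (induction rule: word.induct)
    case (word_Cons k a l b)
    have "z \<noteq> 0" using z by auto
    then show ?case using word_Cons z
      by (simp add: \<gamma>_simps \<gamma>_letter scaleC_mult_left scaleC_mult_right scaleC_scaleC power_int_add
          mult.commute)
  qed (rule \<gamma>_letter[OF _ z])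
  then show ?thesis using assms
    by (auto simp: homogeneous_def \<gamma>_simps scaleC_scaleC mult.commute)
qed

lemma p_fixed: "v \<in> verts E \<Longrightarrow> p v \<in> fixed_point_algebra \<gamma>"
  using gauge by (auto simp: fixed_point_algebra_def gauge_action_def)

lemma \<gamma>_cis_homogeneous: "homogeneous k a \<Longrightarrow> \<gamma> (cis t) a = cis (of_int k * t) *\<^sub>C a"
  by (simp add: \<gamma>_homogeneous cis_power_int)

text \<open>\<open>gauge_action\<close> states no continuity in z. On homogeneous elements the orbit
  is explicit, and contractivity of each \<open>\<gamma> z\<close> carries continuity to norm
  limits.\<close>

lemma orbit_continuous: "continuous_on UNIV (\<lambda>t. \<gamma> (cis t) a)"
proof -
  have "a \<in> {a. continuous_on UNIV (\<lambda>t. \<gamma> (cis t) a)}"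
  proof (rule homogeneous_closed)
    show "closed {a. continuous_on UNIV (\<lambda>t. \<gamma> (cis t) a)}"
      by (rule closed_continuous_orbit)
        (simp add: \<gamma>_contractive flip: linear_diff[OF \<gamma>_linear])
    show "subspace {a. continuous_on UNIV (\<lambda>t. \<gamma> (cis t) a)}"
      by (rule subspaceI)
        (auto simp: linear_0[OF \<gamma>_linear] linear_add[OF \<gamma>_linear] linear_scale[OF \<gamma>_linear]
          intro!: continuous_intros)
    show "a \<in> {a. continuous_on UNIV (\<lambda>t. \<gamma> (cis t) a)}" if "homogeneous k a" for k a
      unfolding mem_Collect_eq \<gamma>_cis_homogeneous[OF that]
      by (intro continuous_on_scaleC continuous_on_cis continuous_intros)
  qed
  then show ?thesis by simp
qed

abbreviation "\<Phi> \<equiv> expectation_of \<gamma>"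

lemma \<Phi>_average: "\<Phi> a = circle_average (\<lambda>t. \<gamma> (cis t) a)"
  by (simp add: expectation_of_def circle_average_def)

lemma \<Phi>_bounded_linear: "bounded_linear \<Phi>"
  unfolding \<Phi>_average[abs_def]
  by (intro circle_average_bounded_linear \<gamma>_linear \<gamma>_contractive orbit_continuous) auto

lemma \<Phi>_contractive: "norm (\<Phi> a) \<le> norm a"
  unfolding \<Phi>_average
  by (intro circle_average_bounded_linear \<gamma>_linear \<gamma>_contractive orbit_continuous) auto

lemma \<Phi>_homogeneous: "homogeneous k a \<Longrightarrow> \<Phi> a = (if k = 0 then a else 0)"
  by (simp add: \<Phi>_average \<gamma>_cis_homogeneous circle_average_character)

text \<open>On a homogeneous element both sides vanish unless the degree is 0, where
  \<open>\<gamma> z\<close> is the identity. The invariance makes the gauge action isometric for the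
  module norm.\<close>

lemma \<Phi>_\<gamma>:
  assumes z: "cmod z = 1"
  shows "\<Phi> (\<gamma> z a) = \<Phi> a"
proof -
  have lin: "bounded_linear (\<gamma> z)"
    using \<gamma>_linear[OF z] \<gamma>_contractive[OF z]
    by (intro bounded_linear_intro[of _ 1]) (auto simp: linear_add linear_scale)
  have "a \<in> {a. \<Phi> (\<gamma> z a) = \<Phi> a}"
  proof (rule homogeneous_closed)
    show "closed {a. \<Phi> (\<gamma> z a) = \<Phi> a}"
      by (intro closed_Collect_eq linear_continuous_on bounded_linear_compose[OF \<Phi>_bounded_linear lin]
          \<Phi>_bounded_linear)
    note linear = bounded_linear.linear[OF \<Phi>_bounded_linear] \<gamma>_linear[OF z]
    show "subspace {a. \<Phi> (\<gamma> z a) = \<Phi> a}"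
      by (rule subspaceI)
        (simp_all add: linear[THEN linear_0] linear[THEN linear_add] linear[THEN linear_scale])
    show "a \<in> {a. \<Phi> (\<gamma> z a) = \<Phi> a}" if "homogeneous k a" for k a
      unfolding mem_Collect_eq \<gamma>_homogeneous[OF that z] \<Phi>_homogeneous[OF that]
        \<Phi>_homogeneous[OF homogeneous_scaleC[OF that]] by simp
  qed
  then show ?thesis by simp
qed

end

section \<open>The module of the gauge action\<close>

locale gauge_module = gauge_graph E p S \<gamma>
  for E :: "('v, 'e) pre_digraph" and p :: "'v \<Rightarrow> 'a::cstar_algebra" and S and \<gamma> +
  fixes \<iota> :: "'a \<Rightarrow> 'x::complex_banach" and act :: "'x \<Rightarrow> 'a \<Rightarrow> 'x" and ip :: "'x \<Rightarrow> 'x \<Rightarrow> 'a"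
  assumes completion: "module_completion \<gamma> \<iota> act ip"
begin

sublocale cstar_module "fixed_point_algebra \<gamma>" act ip
  using completion by unfold_locales (simp add: module_completion_def)

lemma \<iota>_simps:
  "\<iota> (a + b) = \<iota> a + \<iota> b" "\<iota> (c *\<^sub>C a) = c *\<^sub>C \<iota> a" "\<iota> (r *\<^sub>R a) = r *\<^sub>R \<iota> a"
  "ip (\<iota> a) (\<iota> b) = \<Phi> (star a * b)"
  "f \<in> fixed_point_algebra \<gamma> \<Longrightarrow> act (\<iota> a) f = \<iota> (a * f)"
  using completion by (simp_all add: module_completion_def scaleR_scaleC)

lemma \<iota>_bounded_linear: "bounded_linear \<iota>"
proof (rule bounded_linear_intro[of _ 1])
  fix a
  have "(norm (\<iota> a))\<^sup>2 \<le> (norm a)\<^sup>2"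
    using \<Phi>_contractive[of "star a * a"] by (simp add: \<iota>_simps norm_star_mult flip: norm_ip_self)
  then show "norm (\<iota> a) \<le> norm a * 1" by simp
qed (simp_all add: \<iota>_simps)

lemmas \<iota>_linear = linear_diff[OF bounded_linear.linear[OF \<iota>_bounded_linear]]
  linear_sum[OF bounded_linear.linear[OF \<iota>_bounded_linear]]
  linear_0[OF bounded_linear.linear[OF \<iota>_bounded_linear]]

lemma \<iota>_dense:
  assumes "closed T" "\<And>a. \<iota> a \<in> T"
  shows "x \<in> T"
proof -
  have "closure (range \<iota>) \<subseteq> T" using assms by (intro closure_minimal) auto
  then show ?thesis using completion by (auto simp: module_completion_def)
qed

lemma bounded_linear_ext:
  fixes f g :: "'x \<Rightarrow> 'b::real_normed_vector"
  assumes f: "bounded_linear f" and g: "bounded_linear g"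
    and hom: "\<And>k a. homogeneous k a \<Longrightarrow> f (\<iota> a) = g (\<iota> a)"
  shows "f x = g x"
proof -
  have "a \<in> {a. f (\<iota> a) = g (\<iota> a)}" for a
  proof (rule homogeneous_closed)
    show "closed {a. f (\<iota> a) = g (\<iota> a)}"
      by (intro closed_Collect_eq linear_continuous_on bounded_linear_compose[OF f \<iota>_bounded_linear]
          bounded_linear_compose[OF g \<iota>_bounded_linear])
    note linear = bounded_linear.linear[OF f] bounded_linear.linear[OF g]
    show "subspace {a. f (\<iota> a) = g (\<iota> a)}"
      by (rule subspaceI) (simp_all add: linear[THEN linear_0] linear[THEN linear_add]
          linear[THEN linear_scale] \<iota>_simps \<iota>_linear)
  qed (use hom in simp)
  then have eq: "f (\<iota> a) = g (\<iota> a)" for a by blast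
  have "x \<in> {x. f x = g x}"
    by (rule \<iota>_dense, intro closed_Collect_eq linear_continuous_on f g) (simp add: eq)
  then show ?thesis by simp
qed

text \<open>\<open>extension\<close> is a definite description, so existence and uniqueness are both
  required. The bound makes \<open>h\<close> descend to the range of \<open>\<iota>\<close>, even
  where \<open>\<iota>\<close> identifies elements, as a Lipschitz map; this extends to the closure,
  and density gives uniqueness.\<close>

lemma extension:
  assumes h: "linear h" and bound: "\<And>a. norm (\<iota> (h a)) \<le> C * norm (\<iota> a)"
  shows "bounded_linear (extension \<iota> h)"
    and "extension \<iota> h (\<iota> a) = \<iota> (h a)"
    and "norm (extension \<iota> h x) \<le> C * norm x"
proof -
  define f where "f y = \<iota> (h (SOME a. \<iota> a = y))" for y
  have diff: "norm (\<iota> (h a) - \<iota> (h b)) \<le> C * norm (\<iota> a - \<iota> b)" for a b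
    using bound[of "a - b"] by (simp add: linear_diff[OF h] \<iota>_linear)
  have f\<iota>: "f (\<iota> a) = \<iota> (h a)" for a
  proof -
    have "\<iota> (SOME b. \<iota> b = \<iota> a) = \<iota> a" by (rule someI[of _ a]) simp
    then show ?thesis using diff[of "SOME b. \<iota> b = \<iota> a" a] by (simp add: f_def)
  qed
  have "(max C 0)-lipschitz_on (range \<iota>) f"
  proof (rule lipschitz_onI)
    fix x y assume "x \<in> range \<iota>" "y \<in> range \<iota>"
    then obtain a b where "x = \<iota> a" "y = \<iota> b" by blast
    then show "dist (f x) (f y) \<le> max C 0 * dist x y"
      using order_trans[OF diff[of a b] mult_right_mono[of C "max C 0"]] by (simp add: f\<iota> dist_norm)
  qed simp
  then have "uniformly_continuous_on (range \<iota>) f" by (rule lipschitz_on_uniformly_continuous)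
  then obtain g where g: "uniformly_continuous_on (closure (range \<iota>)) g" "\<And>x. x \<in> range \<iota> \<Longrightarrow> f x = g x"
    by (rule uniformly_continuous_on_extension_on_closure) blast
  have cont: "continuous_on UNIV g"
    using uniformly_continuous_imp_continuous[OF g(1)] completion by (simp add: module_completion_def)
  have g\<iota>: "g (\<iota> a) = \<iota> (h a)" for a using g(2)[of "\<iota> a"] f\<iota> by simp
  have ext: "extension \<iota> h = g" unfolding extension_def
  proof (rule the_equality)
    fix T assume T: "continuous_on UNIV T \<and> (\<forall>a. T (\<iota> a) = \<iota> (h a))"
    have "x \<in> {x. T x = g x}" for x
      by (rule \<iota>_dense, intro closed_Collect_eq) (use T cont in \<open>simp_all add: g\<iota>\<close>)
    then show "T = g" by auto
  qed (use cont g\<iota> in simp)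
  have cont': "continuous_on UNIV (\<lambda>x. g (k x))" if "continuous_on UNIV k" for k :: "'x \<Rightarrow> 'x"
    using continuous_on_compose2[OF cont that] by simp
  show "extension \<iota> h (\<iota> a) = \<iota> (h a)" by (simp add: ext g\<iota>)
  have norm: "norm (g x) \<le> C * norm x" for x
  proof -
    have "x \<in> {x. norm (g x) \<le> C * norm x}"
      by (rule \<iota>_dense, intro closed_Collect_le continuous_intros cont) (simp add: g\<iota> bound)
    then show ?thesis by simp
  qed
  then show "norm (extension \<iota> h x) \<le> C * norm x" by (simp add: ext)
  \<comment> \<open>Additivity passes to the limit in one variable at a time; the left argument
    still lies in the range of \<open>\<iota>\<close> here.\<close>
  have add\<iota>: "g (\<iota> a + y) = g (\<iota> a) + g y" for a y
  proof -
    have "y \<in> {y. g (\<iota> a + y) = g (\<iota> a) + g y}"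
      by (rule \<iota>_dense, intro closed_Collect_eq continuous_intros cont cont')
         (simp add: g\<iota> linear_add[OF h] \<iota>_simps flip: \<iota>_simps(1))
    then show ?thesis by simp
  qed
  have "g (x + y) = g x + g y" for x y
  proof -
    have "x \<in> {x. g (x + y) = g x + g y}"
      by (rule \<iota>_dense, intro closed_Collect_eq continuous_intros cont cont') (simp add: add\<iota>)
    then show ?thesis by simp
  qed
  moreover have "g (r *\<^sub>R x) = r *\<^sub>R g x" for r x
  proof -
    have "x \<in> {x. g (r *\<^sub>R x) = r *\<^sub>R g x}"
      by (rule \<iota>_dense, intro closed_Collect_eq continuous_intros cont cont')
         (simp add: g\<iota> linear_scale[OF h] flip: \<iota>_simps(3))
    then show ?thesis by simp
  qed
  ultimately show "bounded_linear (extension \<iota> h)"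
    unfolding ext using norm by (intro bounded_linear_intro[of _ C]) (auto simp: mult.commute)
qed

subsection \<open>Left multiplication\<close>

text \<open>The norm of \<open>\<iota> x\<close> depends only on \<open>star x * x\<close>, so the
  unitary argument also works in the module for self-adjoint contractions. General \<open>a\<close>
  is reduced to \<open>star a * a\<close>; one factor 2 comes from \<open>norm_ip\<close>, one from
  scaling to norm 1/2, and the square root of their product remains.\<close>

lemma norm_\<iota>_mult: "norm (\<iota> (a * b)) \<le> 2 * norm a * norm (\<iota> b)"
proof -
  have iso: "norm (\<iota> x) = norm (\<iota> y)" if "star x * x = star y * y" for x y
  proof -
    have "(norm (\<iota> x))\<^sup>2 = (norm (\<iota> y))\<^sup>2" using that by (simp add: \<iota>_simps flip: norm_ip_self)
    then show ?thesis by simp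
  qed
  have small: "norm (\<iota> (h * b)) \<le> norm (\<iota> b)" if h: "star h = h" "norm h < 1" for h
  proof -
    obtain k where k: "star k = k" "h * k = k * h" "h * h + k * k = 2 *\<^sub>R k"
      using ex_defect[OF h] by blast
    define u where "u = h * b + \<i> *\<^sub>C (b - k * b)"
    define v where "v = (- h) * b + \<i> *\<^sub>C (b - k * b)"
    have "norm (\<iota> u) = norm (\<iota> b)" unfolding u_def by (rule iso star_mult_unitary h k)+
    moreover have "norm (\<iota> v) = norm (\<iota> b)" unfolding v_def
      by (intro iso star_mult_unitary) (use h k in \<open>simp_all add: star_minus\<close>)
    moreover have "u - v = 2 *\<^sub>R (h * b)" unfolding u_def v_def by (rule unitary_difference)
    then have "\<iota> (u - v) = \<iota> (2 *\<^sub>R (h * b))" by (rule arg_cong)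
    then have "\<iota> u - \<iota> v = 2 *\<^sub>R \<iota> (h * b)" by (simp only: \<iota>_linear(1) \<iota>_simps(3))
    ultimately show ?thesis using contractive_average[of "\<iota> u" "\<iota> v" "\<iota> (h * b)" "norm (\<iota> b)"] by simp
  qed
  have sa: "norm (\<iota> (h * b)) \<le> 2 * norm h * norm (\<iota> b)" if h: "star h = h" for h
  proof (cases "h = 0")
    case False
    then have "norm (\<iota> (((1 / (2 * norm h)) *\<^sub>R h) * b)) \<le> norm (\<iota> b)"
      using h by (intro small) (simp_all add: star_scaleR)
    then show ?thesis using False by (simp add: \<iota>_simps divide_le_eq mult.commute)
  qed (simp add: \<iota>_linear)
  have "(norm (\<iota> (a * b)))\<^sup>2 = norm (ip (\<iota> b) (\<iota> ((star a * a) * b)))"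
    by (simp add: \<iota>_simps star_mult mult.assoc flip: norm_ip_self)
  also have "\<dots> \<le> 2 * norm (\<iota> b) * norm (\<iota> ((star a * a) * b))" by (rule norm_ip)
  also have "\<dots> \<le> 2 * norm (\<iota> b) * (2 * norm (star a * a) * norm (\<iota> b))"
    by (intro mult_left_mono sa) (simp_all add: star_simps)
  also have "\<dots> = (2 * norm a * norm (\<iota> b))\<^sup>2"
    by (simp add: norm_star_mult power2_eq_square)
  finally show ?thesis by (rule power2_le_imp_le) simp
qed

abbreviation "\<pi> \<equiv> left_mult \<iota>"

lemma \<pi>_bounded_linear: "bounded_linear (\<pi> a)"
  and \<pi>_\<iota>: "\<pi> a (\<iota> b) = \<iota> (a * b)"
  and norm_\<pi>: "norm (\<pi> a x) \<le> 2 * norm a * norm x"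
  using extension[OF bounded_linear.linear[OF bounded_linear_mult_right] norm_\<iota>_mult]
  unfolding left_mult_def by blast+

lemma \<pi>_simps: "\<pi> (a + b) x = \<pi> a x + \<pi> b x" "\<pi> (a * b) x = \<pi> a (\<pi> b x)"
  "\<pi> (r *\<^sub>R a) x = r *\<^sub>R \<pi> a x"
proof -
  show "\<pi> (a + b) x = \<pi> a x + \<pi> b x"
    by (rule bounded_linear_ext[of "\<pi> (a + b)" "\<lambda>x. \<pi> a x + \<pi> b x"])
       ((intro bounded_linear_add \<pi>_bounded_linear)+, simp add: \<pi>_\<iota> \<iota>_simps distrib_right)
  show "\<pi> (a * b) x = \<pi> a (\<pi> b x)"
    by (rule bounded_linear_ext[of "\<pi> (a * b)" "\<lambda>x. \<pi> a (\<pi> b x)"])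
       ((intro bounded_linear_compose[OF \<pi>_bounded_linear] \<pi>_bounded_linear)+, simp add: \<pi>_\<iota> mult.assoc)
  show "\<pi> (r *\<^sub>R a) x = r *\<^sub>R \<pi> a x"
    by (rule bounded_linear_ext[of "\<pi> (r *\<^sub>R a)" "\<lambda>x. r *\<^sub>R \<pi> a x"])
       ((intro bounded_linear_const_scaleR \<pi>_bounded_linear)+, simp add: \<pi>_\<iota> \<iota>_simps)
qed

lemma \<pi>_scaleC: "\<pi> (c *\<^sub>C a) x = c *\<^sub>C \<pi> a x"
  by (rule bounded_linear_ext[of "\<pi> (c *\<^sub>C a)" "\<lambda>x. c *\<^sub>C \<pi> a x"])
     ((intro bounded_linear_compose[OF bounded_linear_scaleC] \<pi>_bounded_linear)+,
      simp add: \<pi>_\<iota> \<iota>_simps scaleC_mult_left)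

lemma \<pi>_adjoint: "adjoint_pair ip (\<pi> a) (\<pi> (star a))"
  unfolding adjoint_pair_def
proof safe
  fix x y
  have *: "ip (\<pi> a (\<iota> b)) y = ip (\<iota> b) (\<pi> (star a) y)" for b
    by (rule bounded_linear_ext[of "\<lambda>y. ip (\<pi> a (\<iota> b)) y" "\<lambda>y. ip (\<iota> b) (\<pi> (star a) y)"])
       ((intro bounded_linear_compose[OF ip.bounded_linear_right] \<pi>_bounded_linear
         ip.bounded_linear_right)+,
        simp add: \<pi>_\<iota> \<iota>_simps star_mult mult.assoc)
  show "ip (\<pi> a x) y = ip x (\<pi> (star a) y)"
    by (rule bounded_linear_ext[of "\<lambda>x. ip (\<pi> a x) y" "\<lambda>x. ip x (\<pi> (star a) y)"])
       ((intro bounded_linear_compose[OF ip.bounded_linear_left] \<pi>_bounded_linear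
         ip.bounded_linear_left)+, rule *)
qed

lemma \<pi>_star_representation: "star_representation ip \<pi>"
  unfolding star_representation_def using \<pi>_adjoint \<pi>_simps \<pi>_scaleC by blast

subsection \<open>Spectral projections\<close>

abbreviation "U t \<equiv> extension \<iota> (\<gamma> (cis t))"

lemma norm_\<iota>_\<gamma>: "cmod z = 1 \<Longrightarrow> norm (\<iota> (\<gamma> z a)) \<le> 1 * norm (\<iota> a)"
proof -
  assume z: "cmod z = 1"
  have "(norm (\<iota> (\<gamma> z a)))\<^sup>2 = norm (\<Phi> (\<gamma> z (star a * a)))"
    using z by (simp add: \<iota>_simps \<gamma>_simps flip: norm_ip_self)
  also have "\<dots> = (norm (\<iota> a))\<^sup>2" using z by (simp add: \<Phi>_\<gamma> \<iota>_simps flip: norm_ip_self)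
  finally show ?thesis by simp
qed

lemma U_bounded_linear: "bounded_linear (U t)"
  and U_\<iota>: "U t (\<iota> a) = \<iota> (\<gamma> (cis t) a)"
  and norm_U: "norm (U t x) \<le> 1 * norm x"
  using extension[OF \<gamma>_linear norm_\<iota>_\<gamma>] by simp_all

lemma U_continuous: "continuous_on UNIV (\<lambda>t. U t x)"
proof -
  have "x \<in> {x. continuous_on UNIV (\<lambda>t. U t x)}"
  proof (rule \<iota>_dense)
    have "norm (U t x - U t y) \<le> norm (x - y)" for t x y
      using norm_U[of t "x - y"] by (simp add: linear_diff[OF bounded_linear.linear[OF U_bounded_linear]])
    then show "closed {x. continuous_on UNIV (\<lambda>t. U t x)}" by (rule closed_continuous_orbit)
    show "\<iota> a \<in> {x. continuous_on UNIV (\<lambda>t. U t x)}" for a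
      by (simp add: U_\<iota> bounded_linear.continuous_on[OF \<iota>_bounded_linear] orbit_continuous)
  qed
  then show ?thesis by simp
qed

abbreviation "P \<equiv> spectral_projection \<gamma> \<iota>"

lemma P_average: "P k x = circle_average (\<lambda>t. cis (of_int (- k) * t) *\<^sub>C U t x)"
  by (simp only: spectral_projection_def circle_average_def cis_power_int)

lemma spectral_projection_bounded_linear: "bounded_linear (P k)"
  unfolding P_average[abs_def]
proof (rule circle_average_bounded_linear)
  show "linear (\<lambda>x. cis (of_int (- k) * t) *\<^sub>C U t x)" for t
    by (intro bounded_linear.linear bounded_linear_compose[OF bounded_linear_scaleC] U_bounded_linear)
  show "norm (cis (of_int (- k) * t) *\<^sub>C U t x) \<le> norm x" for t x
    using norm_U[of t x] by (simp add: norm_scaleC)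
  show "continuous_on UNIV (\<lambda>t. cis (of_int (- k) * t) *\<^sub>C U t x)" for x
    by (intro continuous_on_scaleC continuous_on_cis continuous_intros U_continuous)
qed

lemma P_homogeneous:
  assumes "homogeneous k a"
  shows "P j (\<iota> a) = (if j = k then \<iota> a else 0)"
proof -
  have "cis (of_int (- j) * t) *\<^sub>C U t (\<iota> a) = cis (of_int (k - j) * t) *\<^sub>C \<iota> a" for t
    by (simp add: U_\<iota> \<gamma>_cis_homogeneous[OF assms] \<iota>_simps scaleC_scaleC cis_mult algebra_simps)
  then show ?thesis by (simp only: P_average circle_average_character) simp
qed

sublocale graded_module "fixed_point_algebra \<gamma>" act ip P
proof (intro graded_module.intro graded_module_axioms.intro cstar_module_axioms)
  show "bounded_linear (P k)" for k by (rule spectral_projection_bounded_linear)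
  note bl = spectral_projection_bounded_linear
  show "P j (P k x) = (if j = k then P k x else 0)" for j k x
  proof (rule bounded_linear_ext[of "\<lambda>x. P j (P k x)" "\<lambda>x. if j = k then P k x else 0"])
    show "bounded_linear (\<lambda>x. P j (P k x))" by (intro bounded_linear_compose[OF bl] bl)
    show "bounded_linear (\<lambda>x. if j = k then P k x else 0)"
      by (cases "j = k") (simp_all add: bl bounded_linear_zero)
  qed (simp add: P_homogeneous linear_0[OF bounded_linear.linear[OF bl]])
  show "adjoint_pair ip (P k) (P k)" for k
    unfolding adjoint_pair_def
  proof safe
    fix x y
    \<comment> \<open>If the degrees i and j differ, \<open>\<Phi>\<close> kills
      \<open>star a * b\<close>; if they agree, \<open>P k\<close> keeps both arguments or kills
      both.\<close>
    have *: "ip (P k (\<iota> a)) (\<iota> b) = ip (\<iota> a) (P k (\<iota> b))" if "homogeneous i a" "homogeneous j b" for i j a b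
      using \<Phi>_homogeneous[OF homogeneous_mult[OF homogeneous_star[OF that(1)] that(2)]]
      by (auto simp: P_homogeneous[OF that(1)] P_homogeneous[OF that(2)] \<iota>_simps)
    have **: "ip (P k (\<iota> a)) y = ip (\<iota> a) (P k y)" if "homogeneous i a" for a i
      by (rule bounded_linear_ext[of "\<lambda>y. ip (P k (\<iota> a)) y" "\<lambda>y. ip (\<iota> a) (P k y)", OF _ _ *[OF that]])
         (intro bounded_linear_compose[OF ip.bounded_linear_right] bl bounded_linear_ident)+
    show "ip (P k x) y = ip x (P k y)"
      by (rule bounded_linear_ext[of "\<lambda>x. ip (P k x) y" "\<lambda>x. ip x (P k y)"])
         ((intro bounded_linear_compose[OF ip.bounded_linear_left] bl ip.bounded_linear_left)+, rule **)
  qed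
  show "closure (span {x. \<exists>k. P k x = x}) = UNIV"
  proof -
    let ?C = "closure (span {x. \<exists>k. P k x = x})"
    have "a \<in> \<iota> -` ?C" for a
    proof (rule homogeneous_closed)
      show "closed (\<iota> -` ?C)"
        by (intro continuous_closed_vimage closed_closure) (simp add: linear_continuous_at \<iota>_bounded_linear)
      show "subspace (\<iota> -` ?C)"
        by (intro linear_subspace_vimage bounded_linear.linear[OF \<iota>_bounded_linear] subspace_closure subspace_span)
      show "a \<in> \<iota> -` ?C" if "homogeneous k a" for k a
      proof -
        have "P k (\<iota> a) = \<iota> a" by (simp add: P_homogeneous[OF that])
        then have "\<iota> a \<in> {x. \<exists>k. P k x = x}" by blast
        then have "\<iota> a \<in> ?C" by (intro subsetD[OF closure_subset] span_base)
        then show ?thesis by simp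
      qed
    qed
    then have *: "\<iota> a \<in> ?C" for a by (rule vimageD)
    have "x \<in> ?C" for x by (rule \<iota>_dense[OF closed_closure *])
    then show ?thesis by blast
  qed
qed

lemma number_operator_eq: "number_operator \<gamma> \<iota> = N" "number_operator_dom \<gamma> \<iota> ip = dom_N"
  by (simp_all add: number_operator_def[abs_def] multiplier_def[abs_def] number_operator_dom_def)

end

section \<open>Compactness\<close>

lemma finite_superlevel_int:
  fixes f :: "real \<Rightarrow> real"
  assumes "(f \<longlongrightarrow> 0) at_top" "(f \<longlongrightarrow> 0) at_bot" "e > 0"
  shows "finite {k :: int. e \<le> \<bar>f (of_int k)\<bar>}"
proof -
  have "eventually (\<lambda>t. \<bar>f t\<bar> < e) at_top" "eventually (\<lambda>t. \<bar>f t\<bar> < e) at_bot"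
    using assms(1,2)[THEN tendstoD, OF assms(3)] by (simp_all add: dist_real_def)
  then obtain b c where b: "\<And>t. t \<ge> b \<Longrightarrow> \<bar>f t\<bar> < e" and c: "\<And>t. t \<le> c \<Longrightarrow> \<bar>f t\<bar> < e"
    by (auto simp: eventually_at_top_linorder eventually_at_bot_linorder)
  have "{k :: int. e \<le> \<bar>f (of_int k)\<bar>} \<subseteq> {\<lfloor>c\<rfloor>..\<lceil>b\<rceil>}"
  proof
    fix k :: int assume "k \<in> {k. e \<le> \<bar>f (of_int k)\<bar>}"
    then have "\<not> of_int k \<ge> b" "\<not> of_int k \<le> c" using b[of "of_int k"] c[of "of_int k"] by auto
    then show "k \<in> {\<lfloor>c\<rfloor>..\<lceil>b\<rceil>}" by (simp add: floor_le_iff le_ceiling_iff)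
  qed
  then show ?thesis by (rule finite_subset) simp
qed

context gauge_module
begin

lemma P_\<pi>:
  assumes "homogeneous m a"
  shows "P j (\<pi> a x) = \<pi> a (P (j - m) x)"
proof (rule bounded_linear_ext[of "\<lambda>x. P j (\<pi> a x)" "\<lambda>x. \<pi> a (P (j - m) x)"])
  show "bounded_linear (\<lambda>x. P j (\<pi> a x))"
    by (intro bounded_linear_compose[OF P_bounded] \<pi>_bounded_linear)
  show "bounded_linear (\<lambda>x. \<pi> a (P (j - m) x))"
    by (intro bounded_linear_compose[OF \<pi>_bounded_linear] P_bounded)
  fix k b assume b: "homogeneous k b"
  show "P j (\<pi> a (\<iota> b)) = \<pi> a (P (j - m) (\<iota> b))"
    by (auto simp: \<pi>_\<iota> P_homogeneous[OF homogeneous_mult[OF assms b]] P_homogeneous[OF b]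
        linear_0[OF bounded_linear.linear[OF \<pi>_bounded_linear]])
qed

lemma compact_\<pi>_comp:
  assumes "compact_endomorphism act ip T"
  shows "compact_endomorphism act ip (\<lambda>x. \<pi> a (T (\<pi> b x)))"
    and "compact_endomorphism act ip (\<lambda>x. \<pi> a (T x))"
proof -
  have "adjoint_pair ip (\<lambda>x. x) (\<lambda>x. x)" by (simp add: adjoint_pair_def)
  then show "compact_endomorphism act ip (\<lambda>x. \<pi> a (T (\<pi> b x)))"
    and "compact_endomorphism act ip (\<lambda>x. \<pi> a (T x))"
    using compact_comp[OF \<pi>_adjoint \<pi>_bounded_linear] \<pi>_adjoint \<pi>_bounded_linear
      bounded_linear_ident assms by blast+
qed

text \<open>The inner product \<Phi>(p_v b) equals p_v b in degree 0 and vanishes in every other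
  degree. This is the rank one operator from which all compactness is derived.\<close>

lemma \<pi>_p_P_0:
  assumes v: "v \<in> verts E"
  shows "\<pi> (p v) (P 0 x) = act (\<iota> (p v)) (ip (\<iota> (p v)) x)"
proof (rule bounded_linear_ext[of "\<lambda>x. \<pi> (p v) (P 0 x)"])
  show "bounded_linear (\<lambda>x. \<pi> (p v) (P 0 x))"
    by (intro bounded_linear_compose[OF \<pi>_bounded_linear] P_bounded)
  show "bounded_linear (\<lambda>x. act (\<iota> (p v)) (ip (\<iota> (p v)) x))" by (rule bounded_linear_act)
  fix k b assume b: "homogeneous k b"
  have "ip (\<iota> (p v)) (\<iota> b) = (if k = 0 then p v * b else 0)"
    using \<Phi>_homogeneous[OF homogeneous_mult[OF p_homogeneous[OF v] b]] v
    by (simp add: \<iota>_simps p_simps)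
  moreover have "p v * (if k = 0 then p v * b else 0) = (if k = 0 then p v * b else 0)"
    using v by (simp add: p_simps flip: mult.assoc)
  ultimately have "act (\<iota> (p v)) (ip (\<iota> (p v)) (\<iota> b)) = \<iota> (if k = 0 then p v * b else 0)"
    using \<iota>_simps(5)[OF ip_in_F, of "p v" "\<iota> (p v)" "\<iota> b"] by simp
  then show "\<pi> (p v) (P 0 (\<iota> b)) = act (\<iota> (p v)) (ip (\<iota> (p v)) (\<iota> b))"
    by (simp add: P_homogeneous[OF b] \<pi>_\<iota> \<iota>_linear linear_0[OF bounded_linear.linear[OF \<pi>_bounded_linear]])
qed

text \<open>Both signs are reduced to degree 0: by one edge into \<open>v\<close>, or by all edges out of \<open>v\<close>.\<close>

lemma compact_p_P_neg:
  "v \<in> verts E \<Longrightarrow> compact_endomorphism act ip (\<lambda>x. \<pi> (p v) (P (- int n) x))"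
proof (induction n arbitrary: v)
  case 0
  then show ?case using \<pi>_p_P_0 compact_rank_one by simp
next
  case (Suc n)
  then have "in_arcs E v \<noteq> {}" using no_src by (simp add: no_sources_def)
  then obtain e where "e \<in> in_arcs E v" by blast
  then have e: "e \<in> arcs E" "head E e = v" by simp_all
  have "\<pi> (p v) (P (- int (Suc n)) x) = \<pi> (star (S e)) (\<pi> (p (tail E e)) (P (- int n) (\<pi> (S e) x)))" for x
  proof -
    have "- int (Suc n) = - int n - 1" by simp
    then have "\<pi> (p v) (P (- int (Suc n)) x) = \<pi> (star (S e)) (\<pi> (S e) (P (- int n - 1) x))"
      by (simp only: S_simps(2)[OF e(1)] e(2) flip: \<pi>_simps(2))
    \<comment> \<open>\<open>S e\<close> lifts degree -n - 1 to -n, and its left unit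
      \<open>p (tail E e)\<close> supplies the projection of the induction hypothesis.\<close>
    also have "\<pi> (S e) (P (- int n - 1) x) = P (- int n - 0) (\<pi> (p (tail E e)) (\<pi> (S e) x))"
      using P_\<pi>[OF S_homogeneous[OF e(1)], of "- int n" x] S_tail[OF e(1)]
      by (simp flip: \<pi>_simps(2))
    also have "\<dots> = \<pi> (p (tail E e)) (P (- int n) (\<pi> (S e) x))"
      using P_\<pi>[OF p_homogeneous] e(1) by simp
    finally show ?thesis .
  qed
  then show ?case using compact_\<pi>_comp(1)[OF Suc.IH[of "tail E e"]] e by simp
qed

lemma compact_p_P_pos:
  "v \<in> verts E \<Longrightarrow> compact_endomorphism act ip (\<lambda>x. \<pi> (p v) (P (int n) x))"
proof (induction n arbitrary: v)
  case 0
  then show ?case using \<pi>_p_P_0 compact_rank_one by simp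
next
  case (Suc n)
  show ?case
  proof (cases "out_arcs E v = {}")
    case True
    have "\<pi> (p v) (P (int (Suc n)) x) = 0" for x
    proof (rule bounded_linear_ext[of "\<lambda>x. \<pi> (p v) (P (int (Suc n)) x)" "\<lambda>x. 0"])
      show "bounded_linear (\<lambda>x. \<pi> (p v) (P (int (Suc n)) x))"
        by (intro bounded_linear_compose[OF \<pi>_bounded_linear] P_bounded)
      fix k b assume b: "homogeneous k b"
      show "\<pi> (p v) (P (int (Suc n)) (\<iota> b)) = 0"
        using homogeneous_sink[OF Suc.prems True b]
        by (auto simp: P_homogeneous[OF b] \<pi>_\<iota> \<iota>_linear
            linear_0[OF bounded_linear.linear[OF \<pi>_bounded_linear]])
    qed (rule bounded_linear_zero)
    then show ?thesis using compact_zero by simp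
  next
    case False
    have e: "e \<in> arcs E" "head E e \<in> verts E" if "e \<in> out_arcs E v" for e using that by auto
    have eq: "\<pi> (p v) (P (int (Suc n)) x)
        = (\<Sum>e\<in>out_arcs E v. \<pi> (S e) (\<pi> (p (head E e)) (P (int n) (\<pi> (star (S e)) x))))" for x
    proof -
      have sum: "\<pi> (\<Sum>e\<in>J. f e) y = (\<Sum>e\<in>J. \<pi> (f e) y)" if "finite J" for J f y
        using that by (induction J rule: finite_induct) (use \<pi>_simps(3)[of 0 0 y] in \<open>simp_all add: \<pi>_simps(1)\<close>)
      have "\<pi> (p v) (P (int (Suc n)) x)
          = (\<Sum>e\<in>out_arcs E v. \<pi> (S e * star (S e)) (P (int (Suc n)) x))"
        unfolding p_eq_sum[OF Suc.prems False] by (rule sum[OF finite_out_arcs[OF Suc.prems]])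
      also have "\<dots> = (\<Sum>e\<in>out_arcs E v. \<pi> (S e) (\<pi> (p (head E e)) (P (int n) (\<pi> (star (S e)) x))))"
      proof (rule sum.cong[OF refl])
        fix e assume "e \<in> out_arcs E v"
        note e = e[OF this]
        have "\<pi> (star (S e)) (P (int (Suc n)) x) = P (int n) (\<pi> (star (S e)) x)"
          using P_\<pi>[OF homogeneous_star[OF S_homogeneous[OF e(1)]], of "int n" x]
          by (simp add: add.commute)
        also have "\<pi> (star (S e)) x = \<pi> (p (head E e)) (\<pi> (star (S e)) x)"
          using S_star_head[OF e(1)] by (simp flip: \<pi>_simps(2))
        also have "P (int n) \<dots> = \<pi> (p (head E e)) (P (int n) (\<pi> (star (S e)) x))"
          using P_\<pi>[OF p_homogeneous[OF e(2)], of "int n"] by simp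
        finally show "\<pi> (S e * star (S e)) (P (int (Suc n)) x)
            = \<pi> (S e) (\<pi> (p (head E e)) (P (int n) (\<pi> (star (S e)) x)))" by (simp add: \<pi>_simps(2))
      qed
      finally show ?thesis .
    qed
    show ?thesis unfolding eq
      by (rule compact_sum) (rule compact_\<pi>_comp(1)[OF Suc.IH[OF e(2)]])
  qed
qed

lemma compact_p_P:
  assumes "v \<in> verts E"
  shows "compact_endomorphism act ip (\<lambda>x. \<pi> (p v) (P k x))"
  using compact_p_P_neg[OF assms, of "nat (- k)"] compact_p_P_pos[OF assms, of "nat k"]
  by (cases "k \<ge> 0") simp_all

text \<open>Both \<open>a\<close> against \<open>P k\<close> and the commutator with
  \<open>V\<close> are instances of \<open>L\<close>. The bound makes \<open>L\<close> continuous
  into the operator norm, so compactness persists under norm limits of \<open>a\<close>.\<close>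

lemma compact_of_homogeneous:
  fixes L :: "'a \<Rightarrow> 'x \<Rightarrow> 'x"
  assumes add: "\<And>a b x. L (a + b) x = L a x + L b x" and scale: "\<And>r a x. L (r *\<^sub>R a) x = r *\<^sub>R L a x"
    and bl: "\<And>a. bounded_linear (L a)" and bound: "\<And>a x. norm (L a x) \<le> C * norm a * norm x"
    and hom: "\<And>k a. homogeneous k a \<Longrightarrow> compact_endomorphism act ip (L a)"
  shows "compact_endomorphism act ip (L a)"
proof -
  let ?T = "{a. compact_endomorphism act ip (L a)}"
  have "a \<in> ?T"
  proof (rule homogeneous_closed)
    have "L 0 x = 0" for x using scale[of 0 0 x] by simp
    then have "L 0 = (\<lambda>x. 0)" by blast
    then have zero: "compact_endomorphism act ip (L 0)" by (simp add: compact_zero)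
    have "L (a + b) = (\<lambda>x. L a x + L b x)" "L (r *\<^sub>R a) = (\<lambda>x. r *\<^sub>R L a x)" for a b r
      by (auto simp: add scale)
    then show "subspace ?T" using zero by (intro subspaceI) (simp_all add: compact_add compact_scaleR)
    have diff: "L (a - b) x = L a x - L b x" for a b x
      using add[of "a - b" b x] by simp
    show "closed ?T" unfolding closed_sequential_limits
    proof safe
      fix f l assume f: "\<forall>n. f n \<in> ?T" and l: "f \<longlonglongrightarrow> l"
      show "compact_endomorphism act ip (L l)"
      proof (rule compact_limit[OF bl])
        fix e :: real assume e: "e > 0"
        have "(\<lambda>n. \<bar>C\<bar> * norm (l - f n)) \<longlonglongrightarrow> \<bar>C\<bar> * norm (l - l)" by (intro tendsto_intros l)
        then have "eventually (\<lambda>n. \<bar>C\<bar> * norm (l - f n) < e) sequentially"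
          using e by (intro order_tendstoD) auto
        then obtain n where n: "\<bar>C\<bar> * norm (l - f n) < e" by (auto simp: eventually_sequentially)
        have "norm (L l x - L (f n) x) \<le> e * norm x" for x
        proof -
          have "norm (L l x - L (f n) x) \<le> C * norm (l - f n) * norm x"
            using bound[of "l - f n" x] by (simp add: diff)
          also have "\<dots> \<le> \<bar>C\<bar> * norm (l - f n) * norm x" by (intro mult_right_mono) auto
          also have "\<dots> \<le> e * norm x" using n by (intro mult_right_mono) auto
          finally show ?thesis .
        qed
        then show "\<exists>S. compact_endomorphism act ip S \<and> (\<forall>x. norm (L l x - S x) \<le> e * norm x)"
          using f by blast
      qed
    qed
  qed (use hom in simp)
  then show ?thesis by simp
qed

lemma norm_P: "norm (P k x) \<le> norm x"
  using norm_finite_multiplier[of "{k}" "\<lambda>_. 1" 1 x] by simp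

lemma compact_\<pi>_P: "compact_endomorphism act ip (\<lambda>x. \<pi> a (P k x))"
proof (rule compact_of_homogeneous[of "\<lambda>a x. \<pi> a (P k x)"])
  show "bounded_linear (\<lambda>x. \<pi> a (P k x))" for a
    by (intro bounded_linear_compose[OF \<pi>_bounded_linear] P_bounded)
  show "norm (\<pi> a (P k x)) \<le> 2 * norm a * norm x" for a x
    by (rule order_trans[OF norm_\<pi>]) (intro mult_left_mono norm_P, simp)
  fix j a assume "homogeneous j a"
  then obtain v where v: "v \<in> verts E" "a * p v = a" using homogeneous_right by blast
  have "\<pi> a y = \<pi> a (\<pi> (p v) y)" for y by (simp add: v(2) flip: \<pi>_simps(2))
  then show "compact_endomorphism act ip (\<lambda>x. \<pi> a (P k x))"
    using compact_\<pi>_comp(2)[OF compact_p_P[OF v(1), of k], of a] by simp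
qed (simp_all add: \<pi>_simps)

lemma compact_\<pi>_multiplier:
  assumes "\<And>e. e > 0 \<Longrightarrow> finite {k. e \<le> \<bar>f k\<bar>}"
  shows "compact_endomorphism act ip (\<lambda>x. \<pi> a (multiplier f x))"
  using \<pi>_adjoint \<pi>_bounded_linear compact_\<pi>_P assms by (rule multiplier_compact)

section \<open>The compactness conditions on V\<close>

abbreviation "V \<equiv> multiplier (\<lambda>k. real_of_int k / sqrt (1 + (real_of_int k)\<^sup>2))"

lemma V_bound: "\<bar>real_of_int k / sqrt (1 + (real_of_int k)\<^sup>2)\<bar> \<le> 1"
  using resolvent_bounds(5)[of k] by simp

lemma V_bounded: "bounded (range (\<lambda>k. real_of_int k / sqrt (1 + (real_of_int k)\<^sup>2)))"
  by (rule bounded_range_intro) (rule V_bound)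

text \<open>Since 1 - t^2 / (1 + t^2) = 1 / (1 + t^2), the operator is \<open>a\<close> times the
  resolvent (1 + D^2)^-1, whose symbol vanishes at infinity.\<close>

lemma compact_one_minus_V_square: "compact_endomorphism act ip (\<lambda>x. \<pi> a (x - V (V x)))"
proof -
  have "x - V (V x) = multiplier (\<lambda>k. 1 / (1 + (real_of_int k)\<^sup>2)) x" for x
  proof (rule P_ext)
    fix k
    define r where "r = real_of_int k"
    have r: "1 + r\<^sup>2 > 0" by (simp add: add_pos_nonneg)
    have "1 - (r / sqrt (1 + r\<^sup>2)) * (r / sqrt (1 + r\<^sup>2)) = 1 / (1 + r\<^sup>2)"
      using r by (simp add: divide_simps flip: power2_eq_square)
    then show "P k (x - V (V x)) = P k (multiplier (\<lambda>k. 1 / (1 + (real_of_int k)\<^sup>2)) x)"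
      by (simp add: P_linear P_multiplier[OF V_bounded] P_multiplier[OF resolvent_bounded(1)]
          flip: r_def scaleR_diff_left)
         (metis scaleR_diff_left scaleR_one)
  qed
  moreover have "finite {k :: int. e \<le> \<bar>1 / (1 + (real_of_int k)\<^sup>2)\<bar>}" if "e > 0" for e
  proof (rule finite_superlevel_int[OF _ _ that, of "\<lambda>t. 1 / (1 + t\<^sup>2)"])
    show "((\<lambda>t::real. 1 / (1 + t\<^sup>2)) \<longlongrightarrow> 0) at_top" by real_asymp
    show "((\<lambda>t::real. 1 / (1 + t\<^sup>2)) \<longlongrightarrow> 0) at_bot" by real_asymp
  qed
  ultimately show ?thesis using compact_\<pi>_multiplier by simp
qed

lemma compact_commutator: "compact_endomorphism act ip (\<lambda>x. V (\<pi> a x) - \<pi> a (V x))"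
\<comment> \<open>The constant 4 is 2 + 2: \<open>V\<close> is contractive, and
  \<open>norm_\<pi>\<close> contributes a factor 2 to each term.\<close>
proof (rule compact_of_homogeneous[of "\<lambda>a x. V (\<pi> a x) - \<pi> a (V x)" 4])
  note V = bounded_linear_multiplier[OF V_bounded]
  note V_linear = bounded_linear.linear[OF V]
  show "V (\<pi> (a + b) x) - \<pi> (a + b) (V x) = V (\<pi> a x) - \<pi> a (V x) + (V (\<pi> b x) - \<pi> b (V x))" for a b x
    by (simp add: \<pi>_simps linear_add[OF V_linear])
  show "V (\<pi> (r *\<^sub>R a) x) - \<pi> (r *\<^sub>R a) (V x) = r *\<^sub>R (V (\<pi> a x) - \<pi> a (V x))" for r a x
    by (simp add: \<pi>_simps linear_scale[OF V_linear] scaleR_diff_right)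
  show "bounded_linear (\<lambda>x. V (\<pi> a x) - \<pi> a (V x))" for a
    by (intro bounded_linear_sub bounded_linear_compose[OF V] bounded_linear_compose[OF \<pi>_bounded_linear]
        \<pi>_bounded_linear V)
  have "norm (V x) \<le> 1 * norm x" for x by (rule norm_multiplier) (rule V_bound)
  then have V_norm: "norm (V x) \<le> norm x" for x by simp
  show "norm (V (\<pi> a x) - \<pi> a (V x)) \<le> 4 * norm a * norm x" for a x
  proof -
    have "norm (V (\<pi> a x) - \<pi> a (V x)) \<le> norm (V (\<pi> a x)) + norm (\<pi> a (V x))"
      by (rule norm_triangle_ineq4)
    also have "\<dots> \<le> 2 * norm a * norm x + 2 * norm a * norm x"
      by (intro add_mono order_trans[OF V_norm norm_\<pi>] order_trans[OF norm_\<pi>] mult_left_mono V_norm) simp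
    finally show ?thesis by simp
  qed
  fix m a assume a: "homogeneous m a"
  define v where "v t = t / sqrt (1 + t\<^sup>2)" for t :: real
  define g where "g t = v (t + of_int m) - v t" for t
  \<comment> \<open>In degree j both terms are multiples of \<open>\<pi> a (P (j - m) x)\<close>,
    with coefficients v(j) and v(j - m); their difference is g(j - m).\<close>
  have "V (\<pi> a x) - \<pi> a (V x) = \<pi> a (multiplier (\<lambda>k. g (of_int k)) x)" for x
  proof (rule P_ext)
    fix j
    have "\<bar>g (of_int k)\<bar> \<le> 2" for k :: int
    proof -
      have "\<bar>v (of_int (k + m))\<bar> \<le> 1" "\<bar>v (of_int k)\<bar> \<le> 1" unfolding v_def by (rule V_bound)+
      then show ?thesis unfolding g_def of_int_add by linarith
    qed
    then have gb: "bounded (range (\<lambda>k. g (real_of_int k)))" by (rule bounded_range_intro)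
    note \<pi>_linear = bounded_linear.linear[OF \<pi>_bounded_linear]
    have "P j (V (\<pi> a x)) = v (of_int j) *\<^sub>R \<pi> a (P (j - m) x)"
      by (simp add: P_multiplier[OF V_bounded] P_\<pi>[OF a] v_def)
    moreover have "P j (\<pi> a (V x)) = v (of_int (j - m)) *\<^sub>R \<pi> a (P (j - m) x)"
      by (simp only: P_multiplier[OF V_bounded] P_\<pi>[OF a] v_def linear_scale[OF \<pi>_linear])
    moreover have "P j (\<pi> a (multiplier (\<lambda>k. g (of_int k)) x)) = g (of_int (j - m)) *\<^sub>R \<pi> a (P (j - m) x)"
      by (simp only: P_multiplier[OF gb] P_\<pi>[OF a] linear_scale[OF \<pi>_linear])
    moreover have "g (of_int (j - m)) = v (of_int j) - v (of_int (j - m))" by (simp add: g_def)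
    ultimately show "P j (V (\<pi> a x) - \<pi> a (V x)) = P j (\<pi> a (multiplier (\<lambda>k. g (of_int k)) x))"
      by (simp only: P_linear scaleR_diff_left)
  qed
  moreover have "compact_endomorphism act ip (\<lambda>x. \<pi> a (multiplier (\<lambda>k. g (of_int k)) x))"
  proof (rule compact_\<pi>_multiplier)
    fix e :: real assume "e > 0"
    moreover have "(g \<longlongrightarrow> 0) at_top" unfolding g_def[abs_def] v_def by real_asymp
    moreover have "(g \<longlongrightarrow> 0) at_bot" unfolding g_def[abs_def] v_def by real_asymp
    ultimately show "finite {k. e \<le> \<bar>g (real_of_int k)\<bar>}" by (intro finite_superlevel_int)
  qed
  ultimately show "compact_endomorphism act ip (\<lambda>x. V (\<pi> a x) - \<pi> a (V x))" by simp
qed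

text \<open>If b is a word with b p_v = b, then c b is b acted on by the fixed element c p_v.
  Countably many words thus suffice although the span is real.\<close>

lemma X_countably_generated: "countably_generated (fixed_point_algebra \<gamma>) act"
proof -
  define W where "W = {a. \<exists>k. word k a}"
  let ?Z = "{act y f | y f. y \<in> \<iota> ` W \<and> f \<in> fixed_point_algebra \<gamma>}"
  have "a \<in> \<iota> -` closure (span ?Z)" for a
  proof (rule homogeneous_closed)
    show "closed (\<iota> -` closure (span ?Z))"
      by (intro continuous_closed_vimage closed_closure) (simp add: linear_continuous_at \<iota>_bounded_linear)
    show "subspace (\<iota> -` closure (span ?Z))"
      by (intro linear_subspace_vimage bounded_linear.linear[OF \<iota>_bounded_linear] subspace_closure subspace_span)
    fix k a assume "homogeneous k a"
    then obtain c b where b: "word k b" "a = c *\<^sub>C b" by (auto simp: homogeneous_def)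
    then obtain v where v: "v \<in> verts E" "b * p v = b" using word_right by blast
    have f: "c *\<^sub>C p v \<in> fixed_point_algebra \<gamma>" using p_fixed[OF v(1)] by (rule F_closed)
    have "\<iota> a = act (\<iota> b) (c *\<^sub>C p v)" using f v(2) b(2) by (simp add: \<iota>_simps(5) scaleC_mult_right)
    then have "\<iota> a \<in> ?Z" using f b(1) by (auto simp: W_def)
    then show "a \<in> \<iota> -` closure (span ?Z)"
      using span_base[of "\<iota> a" ?Z] closure_subset[of "span ?Z"] by blast
  qed
  then have *: "\<iota> a \<in> closure (span ?Z)" for a by (rule vimageD)
  have "x \<in> closure (span ?Z)" for x by (rule \<iota>_dense[OF closed_closure *])
  moreover have "countable (\<iota> ` W)" unfolding W_def by (intro countable_image countable_words)
  ultimately show ?thesis unfolding countably_generated_def by (intro exI[of _ "\<iota> ` W"]) blast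
qed

text \<open>\<open>V\<close> is a real function of the degree, hence self-adjoint, so the operator
  in the first compactness condition is 0.\<close>

lemma V_defines_KK1_class: "defines_KK1_class (fixed_point_algebra \<gamma>) act ip \<pi> V"
proof -
  have V: "adjoint_pair ip V V" by (rule multiplier_adjoint[OF V_bounded])
  have "compact_endomorphism act ip (\<lambda>x. \<pi> a (V x - adjoint_of ip V x))" for a
    unfolding adjoint_of_eq[OF V]
    by (simp add: linear_0[OF bounded_linear.linear[OF \<pi>_bounded_linear]] compact_zero)
  moreover have "adjointable ip V" using V by (auto simp: adjointable_def)
  ultimately show ?thesis unfolding defines_KK1_class_def
    using hilbert X_countably_generated \<pi>_star_representation compact_one_minus_V_square
      compact_commutator by blast
qed

end

theorem proposition4p9:
  fixes E :: "('v, 'e) pre_digraph"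
    and p :: "'v \<Rightarrow> 'a::cstar_algebra" and S :: "'e \<Rightarrow> 'a"
    and \<gamma> :: "complex \<Rightarrow> 'a \<Rightarrow> 'a"
    and \<iota> :: "'a \<Rightarrow> 'x::complex_banach"
    and act :: "'x \<Rightarrow> 'a \<Rightarrow> 'x" and ip :: "'x \<Rightarrow> 'x \<Rightarrow> 'a"
  assumes "wf_digraph E" and "countable (verts E)" and "countable (arcs E)"
    and "locally_finite_digraph E" and "no_sources E"
    and "graph_algebra E p S"
    and "gauge_action E p S \<gamma>"
    and "module_completion \<gamma> \<iota> act ip"
  shows "defines_KK1_class (fixed_point_algebra \<gamma>) act ip (left_mult \<iota>)
           (bounded_transform ip (number_operator_dom \<gamma> \<iota> ip) (number_operator \<gamma> \<iota>))"
proof -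
  interpret gauge_module E p S \<gamma> \<iota> act ip
    using assms
    by (intro gauge_module.intro gauge_graph.intro graph_cstar.intro graph_cstar_axioms.intro
        gauge_graph_axioms.intro gauge_module_axioms.intro) (auto simp: graph_algebra_def)
  show ?thesis
    unfolding number_operator_eq bounded_transform_N by (rule V_defines_KK1_class)
qed

end
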